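(* Let $\Lambda$ be an infinite finitely generated group. If $\Lambda$ is finitely presented and, for a residual filtration $(N_k)_{k\in\mathbb{N}}$ of $\Lambda$, the box space $\Box_{(N_k)}\Lambda$ is coarsely equivalent to a warped system, then the rank gradient $\mathrm{RG}(\Lambda,(N_k))$ is $0$. In particular, if $\Lambda$ has fixed price $p>1$, then no box space of $\Lambda$ is coarsely equivalent to a warped system.
   Context: Rank gradient. $\mathrm{RG}(\Lambda,(N_k))=\lim_{k\to\infty}\mathrm{rk}(N_k)/[\Lambda:N_k]$, where $\mathrm{rk}$ is the minimal number of generators. $\Lambda$ has fixed price $p$ if every essentially free probability measure preserving action of $\Lambda$ has cost $p$. Box spaces. A residual filtration of $\Lambda$ is a nested sequence of finite index normal subgroups $N_{k+1}\lhd N_k\lhd\Lambda$ (each normal in $\Lambda$) with $\bigcap_kN_k=\{e\}$. The box space $\Box_{(N_k)}\Lambda$ is the sequence of Cayley graphs $(\mathrm{Cay}(\Lambda/N_k))_k$ with respect to a fixed finite generating set of $\Lambda$. Warped systems. Given a finite set $S$ of homeomorphisms of a metric space $(X,d)$, with $F_S$ the free group on $S$, for $t\ge1$ let $\delta_S^t$ be the largest metric on $X$ with $\delta_S^t\le t\cdot d$ and $\delta_S^t(x,s(x))\le1$ for all $x\in X,s\in S$. The warped system $\mathrm{WSys}(F_S\curvearrowright X)$ is the family $\{(X,\delta_S^t)\}_{t\ge1}$ together with $S$. A jumping-path is a sequence of continuous paths $\gamma_0,\dots,\gamma_n$ in $X$ and $\vec s_1,\dots,\vec s_n\in S\cup S^{-1}$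 with $\gamma_i(0)=\vec s_i\gamma_{i-1}(1)$; its length at scale $t$ is $n+\sum_i t\|\gamma_i\|$ ($\|\gamma_i\|$ the length in $(X,d)$). $(X,\delta_S^t)$ is jumping-geodesic if $(X,d)$ is geodesic and any two points $x,y$ are joined by a jumping-path of length exactly $\delta_S^t(x,y)$ at scale $t$. Standing assumption on all warped systems: $(X,d)$ is compact, path-connected, locally path-connected, semi-locally simply connected, every continuous path in $X$ is homotopic (rel endpoints) to one of finite length, and $(X,\delta_S^t)$ is jumping-geodesic for all $t$ large enough. Coarse equivalence. Two sequences of metric spaces $(Z_k)$, $(W_k)$ are coarsely equivalent if there are constants $L,A$ such that $Z_k$ and $W_k$ are $(L,A)$-quasi-isometric for every $k$. A box space is coarsely equivalent to a warped system if it is coarsely equivalent to a sequence $(X,\delta_S^{t_k})_{k\in\mathbb{N}}$ of spaces of some warped system with $(t_k)$ unbounded. *)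

theory Defs
  imports
    "HOL-Analysis.Analysis"
    "HOL-Probability.Probability_Measure"
    "HOL-Algebra.Generated_Groups"
    "HOL-Algebra.Group_Action"
begin

section \<open>Finite generation, finite presentation, rank gradient\<close>

definition finite_generating_set :: "('g, 'm) monoid_scheme \<Rightarrow> 'g set \<Rightarrow> bool" where
  "finite_generating_set G T \<longleftrightarrow> finite T \<and> T \<subseteq> carrier G \<and> generate G T = carrier G"

definition finitely_generated :: "('g, 'm) monoid_scheme \<Rightarrow> bool" where
  "finitely_generated G \<longleftrightarrow> (\<exists>T. finite_generating_set G T)"

text \<open>A letter \<open>(s, True)\<close> stands for the generator \<open>s\<close>, and \<open>(s, False)\<close> for its formal inverse.\<close>

definition group_words :: "'s set \<Rightarrow> ('s \<times> bool) list set" where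
  "group_words S = lists (S \<times> UNIV)"

definition null_words :: "'s set \<Rightarrow> ('s \<times> bool) list set \<Rightarrow> ('s \<times> bool) list set" where
  "null_words S R = R \<union> {[(s, b), (s, \<not> b)] | s b. s \<in> S}"

definition pres_step ::
  "'s set \<Rightarrow> ('s \<times> bool) list set \<Rightarrow> (('s \<times> bool) list \<times> ('s \<times> bool) list) set" where
  "pres_step S R = {(u @ r @ v, u @ v) | u r v.
     u \<in> group_words S \<and> v \<in> group_words S \<and> r \<in> null_words S R}"

definition pres_rel ::
  "'s set \<Rightarrow> ('s \<times> bool) list set \<Rightarrow> (('s \<times> bool) list \<times> ('s \<times> bool) list) set" where
  "pres_rel S R = Restr ((pres_step S R \<union> (pres_step S R)\<inverse>)\<^sup>*) (group_words S)"

text \<open>The group with presentation \<open>\<langle>S | R\<rangle>\<close>.\<close>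

definition presented_group ::
  "'s set \<Rightarrow> ('s \<times> bool) list set \<Rightarrow> ('s \<times> bool) list set monoid" where
  "presented_group S R =
     \<lparr>carrier = group_words S // pres_rel S R,
      mult = (\<lambda>A B. \<Union>u\<in>A. \<Union>v\<in>B. pres_rel S R `` {u @ v}),
      one = pres_rel S R `` {[]}\<rparr>"

definition finitely_presented :: "('g, 'm) monoid_scheme \<Rightarrow> bool" where
  "finitely_presented G \<longleftrightarrow>
     (\<exists>(n::nat) R. finite R \<and> R \<subseteq> group_words {..<n} \<and> G \<cong> presented_group {..<n} R)"

text \<open>The minimal number of generators of the subgroup \<open>H\<close> of \<open>G\<close>. It is used only for
  subgroups of finite index in a finitely generated group, which are finitely generated, so that
  the minimum is over a nonempty set.\<close>

definition subgroup_rank :: "('g, 'm) monoid_scheme \<Rightarrow> 'g set \<Rightarrow> nat" where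
  "subgroup_rank G H = (LEAST n. \<exists>A. finite A \<and> card A = n \<and> A \<subseteq> carrier G \<and> generate G A = H)"

definition residual_filtration :: "('g, 'm) monoid_scheme \<Rightarrow> (nat \<Rightarrow> 'g set) \<Rightarrow> bool" where
  "residual_filtration G N \<longleftrightarrow>
     (\<forall>k. N k \<lhd> G \<and> finite (rcosets\<^bsub>G\<^esub> (N k)) \<and> N (Suc k) \<subseteq> N k) \<and>
     (\<Inter>k. N k) = {\<one>\<^bsub>G\<^esub>}"

definition has_rank_gradient ::
  "('g, 'm) monoid_scheme \<Rightarrow> (nat \<Rightarrow> 'g set) \<Rightarrow> real \<Rightarrow> bool" where
  "has_rank_gradient G N r \<longleftrightarrow>
     (\<lambda>k. real (subgroup_rank G (N k)) / real (card (rcosets\<^bsub>G\<^esub> (N k)))) \<longlonglongrightarrow> r"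


section \<open>Cayley graphs and coarse equivalence\<close>

text \<open>Symmetrised edge relation, since Cayley graphs are regarded as undirected.\<close>

definition cayley_edges :: "('g, 'm) monoid_scheme \<Rightarrow> 'g set \<Rightarrow> ('g \<times> 'g) set" where
  "cayley_edges G T =
     {(x, x \<otimes>\<^bsub>G\<^esub> s) | x s. x \<in> carrier G \<and> s \<in> T} \<union>
     {(x \<otimes>\<^bsub>G\<^esub> s, x) | x s. x \<in> carrier G \<and> s \<in> T}"

text \<open>The path metric on the vertices; all graphs below are connected.\<close>

definition graph_dist :: "('v \<times> 'v) set \<Rightarrow> 'v \<Rightarrow> 'v \<Rightarrow> real" where
  "graph_dist E x y = real (LEAST n. (x, y) \<in> E ^^ n)"

text \<open>The graph \<open>Cay(G/H)\<close> with respect to the image of the generating set \<open>T\<close> of \<open>G\<close>.\<close>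

definition quotient_cayley_dist ::
  "('g, 'm) monoid_scheme \<Rightarrow> 'g set \<Rightarrow> 'g set \<Rightarrow> 'g set \<Rightarrow> 'g set \<Rightarrow> real" where
  "quotient_cayley_dist G T H =
     graph_dist (cayley_edges (G Mod H) ((\<lambda>s. H #>\<^bsub>G\<^esub> s) ` T))"

definition quasi_isometric ::
  "real \<Rightarrow> real \<Rightarrow> 'a set \<Rightarrow> ('a \<Rightarrow> 'a \<Rightarrow> real) \<Rightarrow> 'b set \<Rightarrow> ('b \<Rightarrow> 'b \<Rightarrow> real) \<Rightarrow> bool" where
  "quasi_isometric L A Z dZ W dW \<longleftrightarrow>
     (\<exists>f. f \<in> Z \<rightarrow> W \<and>
       (\<forall>x\<in>Z. \<forall>y\<in>Z. dZ x y / L - A \<le> dW (f x) (f y) \<and> dW (f x) (f y) \<le> L * dZ x y + A) \<and>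
       (\<forall>w\<in>W. \<exists>x\<in>Z. dW (f x) w \<le> A))"

definition coarsely_equivalent ::
  "(nat \<Rightarrow> 'a set) \<Rightarrow> (nat \<Rightarrow> 'a \<Rightarrow> 'a \<Rightarrow> real) \<Rightarrow>
   (nat \<Rightarrow> 'b set) \<Rightarrow> (nat \<Rightarrow> 'b \<Rightarrow> 'b \<Rightarrow> real) \<Rightarrow> bool" where
  "coarsely_equivalent Z dZ W dW \<longleftrightarrow>
     (\<exists>L A. 1 \<le> L \<and> 0 \<le> A \<and> (\<forall>k. quasi_isometric L A (Z k) (dZ k) (W k) (dW k)))"


section \<open>Warped systems\<close>

text \<open>The length of a curve defined on \<open>[0,1]\<close>, as a supremum over finite partitions.\<close>

definition path_length :: "(real \<Rightarrow> 'x::metric_space) \<Rightarrow> ennreal" where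
  "path_length \<gamma> =
     (SUP (n, \<tau>) \<in> {(n::nat, \<tau>::nat \<Rightarrow> real). mono \<tau> \<and> range \<tau> \<subseteq> {0..1}}.
        \<Sum>i<n. ennreal (dist (\<gamma> (\<tau> i)) (\<gamma> (\<tau> (Suc i)))))"

definition geodesic_space :: "'x::metric_space set \<Rightarrow> bool" where
  "geodesic_space X \<longleftrightarrow>
     (\<forall>x\<in>X. \<forall>y\<in>X. \<exists>c :: real \<Rightarrow> 'x. c \<in> {0..dist x y} \<rightarrow> X \<and> c 0 = x \<and> c (dist x y) = y \<and>
        (\<forall>a\<in>{0..dist x y}. \<forall>b\<in>{0..dist x y}. dist (c a) (c b) = \<bar>a - b\<bar>))"

definition semilocally_simply_connected :: "'x::topological_space set \<Rightarrow> bool" where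
  "semilocally_simply_connected X \<longleftrightarrow>
     (\<forall>x\<in>X. \<exists>U. openin (top_of_set X) U \<and> x \<in> U \<and>
        (\<forall>\<gamma>. path \<gamma> \<and> path_image \<gamma> \<subseteq> U \<and> pathstart \<gamma> = x \<and> pathfinish \<gamma> = x \<longrightarrow>
           homotopic_paths X \<gamma> (\<lambda>_. x)))"

definition warped_candidates ::
  "'x::metric_space set \<Rightarrow> ('x \<Rightarrow> 'x) set \<Rightarrow> real \<Rightarrow> ('x \<Rightarrow> 'x \<Rightarrow> real) set" where
  "warped_candidates X S t =
     {\<delta>. Metric_space X \<delta> \<and> (\<forall>x\<in>X. \<forall>y\<in>X. \<delta> x y \<le> t * dist x y) \<and>
         (\<forall>s\<in>S. \<forall>x\<in>X. \<delta> x (s x) \<le> 1)}"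

text \<open>The metric \<open>\<delta>\<^sub>S\<^sup>t\<close>, as the pointwise supremum of the metrics in
  \<open>warped_candidates X S t\<close>. That it is the largest of these metrics is shown in
  \<open>warped_dist_in_candidates\<close> and \<open>warped_dist_greatest\<close>.\<close>

definition warped_dist ::
  "'x::metric_space set \<Rightarrow> ('x \<Rightarrow> 'x) set \<Rightarrow> real \<Rightarrow> 'x \<Rightarrow> 'x \<Rightarrow> real" where
  "warped_dist X S t x y =
     (if x \<in> X \<and> y \<in> X then SUP \<delta> \<in> warped_candidates X S t. \<delta> x y else 0)"

lemma warped_dist_greatest:
  assumes "\<delta> \<in> warped_candidates X S t" "x \<in> X" "y \<in> X"
  shows "\<delta> x y \<le> warped_dist X S t x y"
proof -
  have "bdd_above ((\<lambda>\<delta>. \<delta> x y) ` warped_candidates X S t)"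
    by (rule bdd_aboveI[where M = "t * dist x y"])
       (use assms(2,3) in \<open>auto simp: warped_candidates_def\<close>)
  then show ?thesis
    using assms by (auto simp: warped_dist_def intro: cSUP_upper)
qed

lemma warped_candidates_nonempty:
  assumes "t > 0"
  shows "(\<lambda>x y. min (t * dist x y) 1) \<in> warped_candidates X S t"
proof -
  have "Metric_space X (\<lambda>x y. min (t * dist x y) 1)"
  proof
    fix x y z :: 'a
    have "t * dist x z \<le> t * dist x y + t * dist y z"
      using mult_left_mono[OF dist_triangle[of x z y], of t] assms by (simp add: distrib_left)
    moreover have "0 \<le> t * dist x y" "0 \<le> t * dist y z" using assms by simp_all
    ultimately show "min (t * dist x z) 1 \<le> min (t * dist x y) 1 + min (t * dist y z) 1"
      by linarith
  qed (use assms in \<open>auto simp: dist_commute min_def\<close>)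
  then show ?thesis
    by (auto simp: warped_candidates_def)
qed

lemma warped_dist_in_candidates:
  assumes "t > 0"
  shows "warped_dist X S t \<in> warped_candidates X S t"
    (is "?D \<in> ?C")
proof -
  have ne: "?C \<noteq> {}"
    using warped_candidates_nonempty[OF assms] by blast
  have least: "?D x y \<le> c" if "x \<in> X" "y \<in> X" "\<And>\<delta>. \<delta> \<in> ?C \<Longrightarrow> \<delta> x y \<le> c" for x y c
    using that ne by (auto simp: warped_dist_def intro: cSUP_least)
  have MS: "Metric_space X \<delta>" if "\<delta> \<in> ?C" for \<delta>
    using that by (simp add: warped_candidates_def)
  note up = warped_dist_greatest[of _ X S t]
  obtain \<delta>0 where \<delta>0: "\<delta>0 \<in> ?C" using ne by blast
  have nonneg: "0 \<le> ?D x y" for x y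
  proof (cases "x \<in> X \<and> y \<in> X")
    case True
    then show ?thesis
      using up[OF \<delta>0, of x y] Metric_space.nonneg[OF MS[OF \<delta>0], of x y] by linarith
  qed (auto simp: warped_dist_def)
  have D_le: "?D x y \<le> t * dist x y" if "x \<in> X" "y \<in> X" for x y
    by (rule least) (use that in \<open>auto simp: warped_candidates_def\<close>)
  have "Metric_space X ?D"
  proof
    fix x y
    have "(\<lambda>\<delta>. \<delta> x y) ` ?C = (\<lambda>\<delta>. \<delta> y x) ` ?C"
      by (intro image_cong refl) (metis MS Metric_space.commute)
    then show "?D x y = ?D y x"
      by (simp add: warped_dist_def)
  next
    fix x y assume xy: "x \<in> X" "y \<in> X"
    show "?D x y = 0 \<longleftrightarrow> x = y"
    proof
      assume "?D x y = 0"
      then have "\<delta>0 x y = 0"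
        using up[OF \<delta>0 xy] Metric_space.nonneg[OF MS[OF \<delta>0], of x y] by linarith
      then show "x = y"
        using Metric_space.zero[OF MS[OF \<delta>0] xy] by simp
    next
      assume "x = y"
      then show "?D x y = 0"
        using D_le[OF xy] nonneg[of x y] by simp
    qed
  next
    fix x y z assume xyz: "x \<in> X" "y \<in> X" "z \<in> X"
    show "?D x z \<le> ?D x y + ?D y z"
    proof (rule least)
      fix \<delta> assume \<delta>: "\<delta> \<in> ?C"
      show "\<delta> x z \<le> ?D x y + ?D y z"
        using Metric_space.triangle[OF MS[OF \<delta>] xyz] up[OF \<delta> xyz(1,2)] up[OF \<delta> xyz(2,3)]
        by linarith
    qed (use xyz in auto)
  qed (rule nonneg)
  moreover have "?D x (s x) \<le> 1" if "s \<in> S" "x \<in> X" for s x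
  proof (cases "s x \<in> X")
    case True
    then show ?thesis
      by (intro least) (use that in \<open>auto simp: warped_candidates_def\<close>)
  qed (simp add: warped_dist_def)
  ultimately show ?thesis
    using D_le by (auto simp: warped_candidates_def)
qed

text \<open>The sequences \<open>\<gamma>\<^sub>0, \<dots>, \<gamma>\<^sub>n\<close> and \<open>\<sigma>\<^sub>1, \<dots>, \<sigma>\<^sub>n\<close> of a jumping-path are
  encoded as functions on the naturals, whose values beyond \<open>n\<close> (and at \<open>0\<close> for \<open>\<sigma>\<close>) are
  irrelevant.\<close>

definition jumping_path ::
  "'x::metric_space set \<Rightarrow> ('x \<Rightarrow> 'x) set \<Rightarrow> nat \<Rightarrow> (nat \<Rightarrow> real \<Rightarrow> 'x) \<Rightarrow> (nat \<Rightarrow> 'x \<Rightarrow> 'x) \<Rightarrow> bool"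
  where
  "jumping_path X S n \<gamma> \<sigma> \<longleftrightarrow>
     (\<forall>i\<le>n. path (\<gamma> i) \<and> path_image (\<gamma> i) \<subseteq> X) \<and>
     (\<forall>i\<in>{1..n}. \<sigma> i \<in> S \<union> inv_into X ` S \<and> pathstart (\<gamma> i) = \<sigma> i (pathfinish (\<gamma> (i - 1))))"

definition jumping_length :: "real \<Rightarrow> nat \<Rightarrow> (nat \<Rightarrow> real \<Rightarrow> 'x::metric_space) \<Rightarrow> ennreal" where
  "jumping_length t n \<gamma> = of_nat n + (\<Sum>i\<le>n. ennreal t * path_length (\<gamma> i))"

definition jumping_geodesic ::
  "'x::metric_space set \<Rightarrow> ('x \<Rightarrow> 'x) set \<Rightarrow> real \<Rightarrow> bool" where
  "jumping_geodesic X S t \<longleftrightarrow>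
     geodesic_space X \<and>
     (\<forall>x\<in>X. \<forall>y\<in>X. \<exists>n \<gamma> \<sigma>. jumping_path X S n \<gamma> \<sigma> \<and> pathstart (\<gamma> 0) = x \<and> pathfinish (\<gamma> n) = y \<and>
        jumping_length t n \<gamma> = ennreal (warped_dist X S t x y))"

definition warped_system :: "'x::metric_space set \<Rightarrow> ('x \<Rightarrow> 'x) set \<Rightarrow> bool" where
  "warped_system X S \<longleftrightarrow>
     finite S \<and> (\<forall>s\<in>S. \<exists>s'. homeomorphism X X s s') \<and>
     compact X \<and> path_connected X \<and> locally path_connected X \<and> semilocally_simply_connected X \<and>
     (\<forall>\<gamma>. path \<gamma> \<and> path_image \<gamma> \<subseteq> X \<longrightarrow>
        (\<exists>\<gamma>'. homotopic_paths X \<gamma> \<gamma>' \<and> path_length \<gamma>' < \<infinity>)) \<and>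
     (\<forall>\<^sub>F t in at_top. jumping_geodesic X S t)"

definition box_space_coarsely_equivalent_to_warped_system ::
  "('g, 'm) monoid_scheme \<Rightarrow> 'g set \<Rightarrow> (nat \<Rightarrow> 'g set) \<Rightarrow>
   'x::metric_space set \<Rightarrow> ('x \<Rightarrow> 'x) set \<Rightarrow> bool" where
  "box_space_coarsely_equivalent_to_warped_system G T N X S \<longleftrightarrow>
     (\<exists>t::nat \<Rightarrow> real. (\<forall>k. 1 \<le> t k) \<and> \<not> bdd_above (range t) \<and>
        coarsely_equivalent
          (\<lambda>k. carrier (G Mod N k)) (\<lambda>k. quotient_cayley_dist G T (N k))
          (\<lambda>k. X) (\<lambda>k. warped_dist X S (t k)))"


section \<open>Cost and fixed price\<close>

text \<open>Actions on standard probability spaces. Every standard Borel space is isomorphic to a Borel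
  subset of the real line with its Borel sets, so spaces of the latter kind suffice.\<close>

definition standard_prob_space :: "real measure \<Rightarrow> bool" where
  "standard_prob_space M \<longleftrightarrow>
     prob_space M \<and> space M \<in> sets borel \<and> sets M = sets (restrict_space borel (space M))"

definition pmp_action :: "('g, 'm) monoid_scheme \<Rightarrow> 'x measure \<Rightarrow> ('g \<Rightarrow> 'x \<Rightarrow> 'x) \<Rightarrow> bool" where
  "pmp_action G M \<alpha> \<longleftrightarrow>
     group_action G (space M) \<alpha> \<and>
     (\<forall>g\<in>carrier G. \<alpha> g \<in> measurable M M \<and> distr M M (\<alpha> g) = M)"

definition essentially_free ::
  "('g, 'm) monoid_scheme \<Rightarrow> 'x measure \<Rightarrow> ('g \<Rightarrow> 'x \<Rightarrow> 'x) \<Rightarrow> bool" where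
  "essentially_free G M \<alpha> \<longleftrightarrow> (AE x in M. stabilizer G \<alpha> x = {\<one>\<^bsub>G\<^esub>})"

text \<open>A graphing of the orbit equivalence relation is a countable family of measure preserving
  partial Borel isomorphisms \<open>f\<^sub>i : A\<^sub>i \<rightarrow> f\<^sub>i(A\<^sub>i)\<close> with graphs contained in the relation, which
  together generate it up to a null set. Finite families are included, since \<open>A\<^sub>i\<close> may be empty.\<close>

definition graphing_edges :: "(nat \<Rightarrow> 'x set) \<Rightarrow> (nat \<Rightarrow> 'x \<Rightarrow> 'x) \<Rightarrow> ('x \<times> 'x) set" where
  "graphing_edges A f = {(x, f i x) | i x. x \<in> A i}"

definition graphing ::
  "('g, 'm) monoid_scheme \<Rightarrow> 'x measure \<Rightarrow> ('g \<Rightarrow> 'x \<Rightarrow> 'x) \<Rightarrow>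
   (nat \<Rightarrow> 'x set) \<Rightarrow> (nat \<Rightarrow> 'x \<Rightarrow> 'x) \<Rightarrow> bool" where
  "graphing G M \<alpha> A f \<longleftrightarrow>
     (\<forall>i. A i \<in> sets M \<and> inj_on (f i) (A i) \<and> f i \<in> measurable (restrict_space M (A i)) M \<and>
        (\<forall>C\<in>sets M. C \<subseteq> A i \<longrightarrow> f i ` C \<in> sets M \<and> emeasure M (f i ` C) = emeasure M C) \<and>
        (\<forall>x\<in>A i. f i x \<in> orbit G \<alpha> x)) \<and>
     (AE x in M. \<forall>y\<in>orbit G \<alpha> x. (x, y) \<in> (graphing_edges A f \<union> (graphing_edges A f)\<inverse>)\<^sup>*)"

definition cost :: "('g, 'm) monoid_scheme \<Rightarrow> 'x measure \<Rightarrow> ('g \<Rightarrow> 'x \<Rightarrow> 'x) \<Rightarrow> ennreal" where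
  "cost G M \<alpha> = (INF (A, f) \<in> {(A, f). graphing G M \<alpha> A f}. \<Sum>i. emeasure M (A i))"

definition fixed_price :: "('g, 'm) monoid_scheme \<Rightarrow> ennreal \<Rightarrow> bool" where
  "fixed_price G p \<longleftrightarrow>
     (\<forall>M \<alpha>. standard_prob_space M \<and> pmp_action G M \<alpha> \<and> essentially_free G M \<alpha> \<longrightarrow>
        cost G M \<alpha> = p)"

end

theory Submission
  imports Defs "HOL-Probability.Infinite_Product_Measure" "HOL-Probability.Probability_Mass_Function"
begin

text \<open>A quasi-isometry from \<open>Cay(\<Lambda>/N\<^sub>k)\<close> to \<open>(X, \<delta>\<^sup>t)\<close> pulls the covering
  \<open>\<Lambda> \<rightarrow> \<Lambda>/N\<^sub>k\<close> back to a coarse principal \<open>N\<^sub>k\<close>-bundle over \<open>X\<close>. Its holonomy is defined along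
  jumping-paths, is homotopy invariant along continuous paths, and attains every element of \<open>N\<^sub>k\<close>.
  Small loops in \<open>X\<close> are null-homotopic, so finitely many loops attached to a finite net of \<open>X\<close>,
  together with one jump for each \<open>s \<in> S\<close>, generate the holonomy: the rank of \<open>N\<^sub>k\<close> is bounded
  independently of \<open>k\<close> whenever \<open>k\<close> and \<open>t\<^sub>k\<close> are large. Since \<open>rk(N\<^sub>k)/[\<Lambda>:N\<^sub>k]\<close> is
  non-increasing by Schreier's argument, the rank gradient vanishes.

  For fixed price, the translation action on the inverse limit of the \<open>\<Lambda>/N\<^sub>k\<close> is free and has
  cost at most \<open>1 + rk(N\<^sub>k)/[\<Lambda>:N\<^sub>k]\<close> for every \<open>k\<close>, hence at most \<open>1\<close>.\<close>

section \<open>Lifting paths to coarse bundles\<close>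

text \<open>A quasi-isometry is not continuous, so \<open>X\<close> receives no honest covering
  along which paths could be lifted. A lift is instead a function whose values over close points
  differ by an element of a word ball \<open>B\<close>, and everything rests on one rigidity: a
  product of three elements of \<open>B\<close> that lies in \<open>N\<close> is trivial. The radius
  of \<open>B\<close> depends on the quasi-isometry constants alone, so residuality provides this
  for all large k. Unbounded scales, however, give the rank bound only for infinitely many k; this
  is why a comparison between different levels of the filtration is required. In the fixed price
  half, one free action suffices, because every essentially free action has cost p; only an upper
  bound for its cost is computed. Since standard spaces are taken to be Borel sets of reals, the
  inverse limit has to be laid out inside the real line, with gaps wide enough that its levels can
  be recovered from distances.\<close>

lemma (in group) inv_mult_cancel [simp]:
  assumes "x \<in> carrier G" "y \<in> carrier G"
  shows "inv x \<otimes> (x \<otimes> y) = y" "x \<otimes> (inv x \<otimes> y) = y"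
  using assms by (simp_all flip: m_assoc)

text \<open>A uniform step size \<open>d\<close> replaces continuity, which the propagated
  properties lack: any two points of a ball of radius d/2 are less than \<open>d\<close> apart, so
  the property is locally constant there.\<close>

lemma metric_connected_induct:
  fixes K :: "'k::metric_space set"
  assumes "connected K" "a \<in> K" "u \<in> K" "P a"
    and "d > 0" "\<And>u v. \<lbrakk>u \<in> K; v \<in> K; dist u v < d; P u\<rbrakk> \<Longrightarrow> P v"
  shows "P u"
proof (rule connected_induction_simple[where P = P, OF assms(1-4)])
  fix w assume w: "w \<in> K"
  have "openin (top_of_set K) (K \<inter> ball w (d/2))" by (simp add: openin_open_Int)
  moreover have "P y" if "x \<in> K \<inter> ball w (d/2)" "y \<in> K \<inter> ball w (d/2)" "P x" for x y
  proof -
    have "dist x y \<le> dist w x + dist w y" by (metis dist_commute dist_triangle)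
    then show ?thesis using that assms(6)[of x y] by auto
  qed
  moreover have "w \<in> K \<inter> ball w (d/2)" using w \<open>d > 0\<close> by simp
  ultimately show "\<exists>T. openin (top_of_set K) T \<and> w \<in> T \<and> (\<forall>x\<in>T. \<forall>y\<in>T. P x \<longrightarrow> P y)"
    by blast
qed

text \<open>The \<open>N\<close>-torsors \<open>q x\<close> over the points of \<open>X\<close> play the role of a principal bundle with discrete
  fibres: \<open>step\<close> and \<open>separated\<close> make parallel transport between points at distance at most \<open>D\<close>
  possible and unique, without any topology on the total space.\<close>

locale coset_bundle = normal N G for N and G (structure) +
  fixes X :: "'x::metric_space set" and \<delta> :: "'x \<Rightarrow> 'x \<Rightarrow> real" and D :: real
    and q :: "'x \<Rightarrow> 'a set" and B :: "'a set"
  assumes metric: "Metric_space X \<delta>"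
    and fibre: "x \<in> X \<Longrightarrow> q x \<in> rcosets N"
    and B: "B \<subseteq> carrier G" "\<one> \<in> B" "b \<in> B \<Longrightarrow> inv b \<in> B"
    and step: "\<lbrakk>x \<in> X; y \<in> X; \<delta> x y \<le> D; g \<in> q x\<rbrakk> \<Longrightarrow> \<exists>h\<in>q y. inv g \<otimes> h \<in> B"
    and separated: "\<lbrakk>a \<in> B; b \<in> B; c \<in> B; a \<otimes> b \<otimes> c \<in> N\<rbrakk> \<Longrightarrow> a \<otimes> b \<otimes> c = \<one>"
begin

text \<open>The order of the factors makes nearness invariant under left multiplication, and left
  multiplication is how \<open>N\<close> acts on its right cosets, the fibres.\<close>

definition near :: "'a \<Rightarrow> 'a \<Rightarrow> bool" where
  "near g h \<longleftrightarrow> inv g \<otimes> h \<in> B"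

lemma fibre_carrier: "x \<in> X \<Longrightarrow> g \<in> q x \<Longrightarrow> g \<in> carrier G"
  using fibre rcosets_carrier by blast

lemma fibre_nonempty: "x \<in> X \<Longrightarrow> \<exists>g. g \<in> q x"
  using fibre rcosets_non_empty by blast

lemma fibre_quotient:
  assumes "x \<in> X" "g \<in> q x" "h \<in> q x"
  shows "g \<otimes> inv h \<in> N"
proof -
  have c: "g \<in> carrier G" "h \<in> carrier G" using assms fibre_carrier by auto
  obtain a where a: "a \<in> carrier G" "q x = N #> a"
    using fibre[OF assms(1)] by (auto simp: RCOSETS_def)
  then have "q x = N #> h"
    using assms(3) by (metis is_group is_subgroup repr_independence)
  then show ?thesis
    using assms(2) c rcos_module_imp[OF is_group] by metis
qed

lemma fibre_translate:
  assumes "x \<in> X" "g \<in> q x" "n \<in> N"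
  shows "n \<otimes> g \<in> q x"
proof -
  obtain a where a: "a \<in> carrier G" "q x = N #> a"
    using fibre[OF assms(1)] by (auto simp: RCOSETS_def)
  then have "q x = N #> g"
    using assms(2) by (metis is_group is_subgroup repr_independence)
  then show ?thesis using assms(3) by (auto simp: r_coset_def)
qed

lemma near_refl: "g \<in> carrier G \<Longrightarrow> near g g"
  using B(2) by (simp add: near_def)

lemma near_sym:
  assumes "near g h" "g \<in> carrier G" "h \<in> carrier G"
  shows "near h g"
  using B(3)[of "inv g \<otimes> h"] assms by (simp add: near_def inv_mult_group)

lemma near_translate:
  assumes "n \<in> carrier G" "g \<in> carrier G" "h \<in> carrier G"
  shows "near (n \<otimes> g) (n \<otimes> h) \<longleftrightarrow> near g h"
  using assms by (simp add: near_def inv_mult_group m_assoc)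

text \<open>The chain h, g, k, h' writes \<open>inv h \<otimes> h'\<close> as a product of three
  elements of \<open>B\<close>. Normality puts this product into \<open>N\<close>, and
  \<open>separated\<close> makes it trivial.\<close>

lemma near3_same_fibre:
  assumes "y \<in> X" "h \<in> q y" "h' \<in> q y" "g \<in> carrier G" "k \<in> carrier G"
    and "near h g" "near g k" "near k h'"
  shows "h = h'"
proof -
  have c: "h \<in> carrier G" "h' \<in> carrier G" using assms fibre_carrier by auto
  have e: "(inv h \<otimes> g) \<otimes> (inv g \<otimes> k) \<otimes> (inv k \<otimes> h') = inv h \<otimes> h'"
    using c assms(4,5) by (simp add: m_assoc)
  have "inv h \<otimes> (h' \<otimes> inv h) \<otimes> h \<in> N"
    by (rule inv_op_closed1[OF c(1) fibre_quotient[OF assms(1,3,2)]])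
  then have "inv h \<otimes> h' \<in> N" using c by (simp add: m_assoc)
  then have "inv h \<otimes> h' = \<one>"
    using separated[of "inv h \<otimes> g" "inv g \<otimes> k" "inv k \<otimes> h'"] assms(6-8) e by (simp add: near_def)
  then show ?thesis using c by (metis inv_equality inv_inv inv_closed)
qed

lemma near_unique:
  assumes "y \<in> X" "h \<in> q y" "h' \<in> q y" "g \<in> carrier G" "near g h" "near g h'"
  shows "h = h'"
  using near3_same_fibre[of y h h' g h'] assms fibre_carrier near_sym near_refl by blast

lemma near_same_fibre:
  assumes "y \<in> X" "h \<in> q y" "h' \<in> q y" "near h h'"
  shows "h = h'"
  using near_unique[of y h h' h] assms fibre_carrier near_refl by blast

text \<open>\<open>B\<close> is not closed under products, so nearness composes only over base
  points at distance at most \<open>D\<close>: there \<open>step\<close> supplies an element of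
  \<open>q z\<close> near \<open>g\<close>, and the three links through \<open>g\<close> and
  \<open>h\<close> identify it with \<open>k\<close>.\<close>

lemma near_trans:
  assumes "x \<in> X" "y \<in> X" "z \<in> X" "\<delta> x z \<le> D"
    and "g \<in> q x" "h \<in> q y" "k \<in> q z" "near g h" "near h k"
  shows "near g k"
proof -
  obtain k' where k': "k' \<in> q z" "near g k'"
    using step[OF assms(1,3,4,5)] by (auto simp: near_def)
  have "k' = k"
    using near3_same_fibre[of z k' k g h] assms k' fibre_carrier near_sym by blast
  with k' show ?thesis by simp
qed

text \<open>Uniform nearness takes the place of continuity. The scale \<open>d\<close> may depend on
  the lift, so any two lifts can be compared at the smaller of their scales.\<close>

definition lift :: "'k::metric_space set \<Rightarrow> ('k \<Rightarrow> 'x) \<Rightarrow> ('k \<Rightarrow> 'a) \<Rightarrow> bool" where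
  "lift K H b \<longleftrightarrow> (\<forall>u\<in>K. b u \<in> q (H u)) \<and>
     (\<exists>d>0. \<forall>u\<in>K. \<forall>v\<in>K. dist u v < d \<longrightarrow> near (b u) (b v))"

lemma liftI:
  assumes "\<And>u. u \<in> K \<Longrightarrow> b u \<in> q (H u)" "d > 0"
    "\<And>u v. \<lbrakk>u \<in> K; v \<in> K; dist u v < d\<rbrakk> \<Longrightarrow> near (b u) (b v)"
  shows "lift K H b"
  using assms unfolding lift_def by blast

lemma lift_fibre: "lift K H b \<Longrightarrow> u \<in> K \<Longrightarrow> b u \<in> q (H u)"
  by (simp add: lift_def)

text \<open>Translating a lift by an element of \<open>N\<close> gives a lift again, and nearby
  values in one fibre are unique. The factor \<open>n\<close> is allowed in order to show that the
  transition between two local sections is constant on connected sets.\<close>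

lemma lift_unique:
  assumes "connected K" "a \<in> K" "u \<in> K" "H ` K \<subseteq> X" "lift K H b1" "lift K H b2"
    and "n \<in> N" "b1 a = n \<otimes> b2 a"
  shows "b1 u = n \<otimes> b2 u"
proof -
  obtain d1 where d1: "d1 > 0" "\<And>u v. \<lbrakk>u \<in> K; v \<in> K; dist u v < d1\<rbrakk> \<Longrightarrow> near (b1 u) (b1 v)"
    using assms(5) by (auto simp: lift_def)
  obtain d2 where d2: "d2 > 0" "\<And>u v. \<lbrakk>u \<in> K; v \<in> K; dist u v < d2\<rbrakk> \<Longrightarrow> near (b2 u) (b2 v)"
    using assms(6) by (auto simp: lift_def)
  have n: "n \<in> carrier G" using assms(7) mem_carrier by blast
  note f = lift_fibre[OF assms(5)] lift_fibre[OF assms(6)]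
  have HX: "H u \<in> X" if "u \<in> K" for u using assms(4) that by blast
  show ?thesis
  proof (rule metric_connected_induct[of K a u "\<lambda>u. b1 u = n \<otimes> b2 u" "min d1 d2"])
    fix u v assume uv: "u \<in> K" "v \<in> K" "dist u v < min d1 d2" "b1 u = n \<otimes> b2 u"
    have c: "b2 u \<in> carrier G" "b2 v \<in> carrier G"
      using uv f HX fibre_carrier by blast+
    have "near (b1 u) (n \<otimes> b2 v)"
      using uv c d2(2)[of u v] n by (simp add: near_translate)
    moreover have "near (b1 u) (b1 v)" using uv d1(2)[of u v] by simp
    ultimately show "b1 v = n \<otimes> b2 v"
      by (intro near_unique[of "H v" "b1 v" "n \<otimes> b2 v" "b1 u"] HX f fibre_translate
          fibre_carrier[OF HX f(1)] assms(7) uv)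
  qed (use assms d1 d2 in auto)
qed

corollary lift_unique_same_start:
  assumes "connected K" "a \<in> K" "u \<in> K" "H ` K \<subseteq> X" "lift K H b1" "lift K H b2" "b1 a = b2 a"
  shows "b1 u = b2 u"
proof -
  have c: "b2 a \<in> carrier G" "b2 u \<in> carrier G"
    using assms lift_fibre fibre_carrier by blast+
  then show ?thesis
    using lift_unique[OF assms(1-6) subgroup.one_closed[OF is_subgroup]] assms(7) by simp
qed

lemma lift_reparam:
  assumes "lift K H b" "f ` K' \<subseteq> K" "\<And>u v. \<lbrakk>u \<in> K'; v \<in> K'\<rbrakk> \<Longrightarrow> dist (f u) (f v) \<le> dist u v"
    and "\<And>u. u \<in> K' \<Longrightarrow> H' u = H (f u)"
  shows "lift K' H' (\<lambda>u. b (f u))"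
proof -
  obtain d where "d > 0" "\<And>u v. \<lbrakk>u \<in> K; v \<in> K; dist u v < d\<rbrakk> \<Longrightarrow> near (b u) (b v)"
    using assms(1) by (auto simp: lift_def)
  then show ?thesis
    using assms(2,4) lift_fibre[OF assms(1)] le_less_trans[OF assms(3)]
    by (intro liftI[where d = d]) (simp_all add: image_subset_iff)
qed

lemma lift_const:
  assumes "x \<in> X" "g \<in> q x"
  shows "lift K (\<lambda>_. x) (\<lambda>_. g)"
  using assms by (intro liftI[where d = 1]) (auto intro: near_refl fibre_carrier)

text \<open>The lift at \<open>u\<close> is obtained by following the segment from the centre \<open>a\<close> to \<open>u\<close> in \<open>n\<close> small
  steps; the values at the \<open>i\<close>-th steps towards two close points stay near each other.\<close>

lemma lift_exists:
  fixes K :: "'v::real_normed_vector set"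
  assumes "compact K" "a \<in> K" "\<And>u. u \<in> K \<Longrightarrow> closed_segment a u \<subseteq> K"
    and "continuous_on K H" "H ` K \<subseteq> X"
    and e: "e > 0" "\<And>x y. \<lbrakk>x \<in> X; y \<in> X; dist x y < e\<rbrakk> \<Longrightarrow> \<delta> x y \<le> D"
    and g0: "g0 \<in> q (H a)"
  shows "\<exists>b. b a = g0 \<and> lift K H b"
proof -
  obtain d where d: "d > 0" "\<And>u v. \<lbrakk>u \<in> K; v \<in> K; dist u v < d\<rbrakk> \<Longrightarrow> dist (H u) (H v) < e"
    using compact_uniformly_continuous[OF assms(4,1)] e(1)
    unfolding uniformly_continuous_on_def by (metis dist_commute)
  obtain M where M: "M > 0" "\<And>u. u \<in> K \<Longrightarrow> norm (u - a) \<le> M"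
  proof -
    obtain M where "\<And>u. u \<in> K \<Longrightarrow> dist a u \<le> M"
      using compact_imp_bounded[OF assms(1)] unfolding bounded_any_center[where a = a] by blast
    then have "norm (u - a) \<le> max M 1" if "u \<in> K" for u
      using that by (fastforce simp: dist_norm norm_minus_commute)
    then show ?thesis using that[of "max M 1"] by auto
  qed
  obtain n :: nat where n: "n > 0" "M / n < d / 2"
  proof -
    obtain n :: nat where "real n > M / (d/2)" using reals_Archimedean2 by blast
    moreover have "M / (d/2) > 0" using M d by simp
    ultimately have "real n > M / (d/2)" "n > 0" by (auto intro: gr0I)
    then have "n > 0" "M / n < d/2" using d by (simp_all add: field_simps)
    then show ?thesis using that by blast
  qed
  define pt where "pt u i = a + (real i / real n) *\<^sub>R (u - a)" for u i
  have ptK: "pt u i \<in> K" if "u \<in> K" "i \<le> n" for u i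
  proof -
    have "pt u i = (1 - real i / real n) *\<^sub>R a + (real i / real n) *\<^sub>R u"
      by (simp add: pt_def algebra_simps)
    then have "pt u i \<in> closed_segment a u"
      using that n unfolding closed_segment_def by (auto intro!: exI[of _ "real i / real n"])
    then show ?thesis using assms(3) that by blast
  qed
  have pt_same: "dist (pt u i) (pt v i) \<le> dist u v" if "i \<le> n" for u v i
  proof -
    have "pt u i - pt v i = (real i / real n) *\<^sub>R (u - v)" by (simp add: pt_def algebra_simps)
    then have "dist (pt u i) (pt v i) = (real i / real n) * dist u v" by (simp add: dist_norm)
    also have "\<dots> \<le> 1 * dist u v" using that n by (intro mult_right_mono) auto
    finally show ?thesis by simp
  qed
  have pt_Suc: "dist (pt u i) (pt u (Suc i)) < d/2" if "u \<in> K" for u i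
  proof -
    have "pt u (Suc i) - pt u i = (1 / real n) *\<^sub>R (u - a)"
      by (simp add: pt_def algebra_simps add_divide_distrib)
    then have "dist (pt u i) (pt u (Suc i)) = norm (u - a) / n"
      by (subst dist_commute) (simp add: dist_norm)
    also have "\<dots> \<le> M / n" using M(2)[OF that] n by (simp add: divide_right_mono)
    also have "\<dots> < d/2" by (rule n)
    finally show ?thesis .
  qed
  define \<beta> where
    "\<beta> u = rec_nat g0 (\<lambda>i g. SOME h. h \<in> q (H (pt u (Suc i))) \<and> near g h)" for u
  have HX: "H (pt u i) \<in> X" if "u \<in> K" "i \<le> n" for u i using ptK[OF that] assms(5) by blast
  have adj: "\<delta> (H (pt u i)) (H (pt v j)) \<le> D"
    if "u \<in> K" "v \<in> K" "i \<le> n" "j \<le> n" "dist (pt u i) (pt v j) < d" for u v i j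
    using e(2)[OF HX[OF that(1,3)] HX[OF that(2,4)]] d(2)[OF ptK ptK] that by blast
  have \<beta>0: "\<beta> u 0 = g0" "\<beta> u 0 \<in> q (H (pt u 0))" for u using g0 by (simp_all add: \<beta>_def pt_def)
  have \<beta>_Suc: "\<beta> u (Suc i) \<in> q (H (pt u (Suc i))) \<and> near (\<beta> u i) (\<beta> u (Suc i))"
    if "\<beta> u i \<in> q (H (pt u i))" "u \<in> K" "i < n" for u i
  proof -
    have *: "\<beta> u (Suc i) = (SOME h. h \<in> q (H (pt u (Suc i))) \<and> near (\<beta> u i) h)"
      by (simp add: \<beta>_def)
    have "\<delta> (H (pt u i)) (H (pt u (Suc i))) \<le> D"
      using adj[of u u i "Suc i"] pt_Suc[OF that(2), of i] that d by simp
    then have "\<exists>h. h \<in> q (H (pt u (Suc i))) \<and> near (\<beta> u i) h"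
      using step[OF HX HX _ that(1), of u "Suc i"] that by (auto simp: near_def)
    then show ?thesis unfolding * by (rule someI_ex)
  qed
  have \<beta>q: "\<beta> u i \<in> q (H (pt u i))" if "u \<in> K" "i \<le> n" for u i
    using that(2) by (induction i) (use \<beta>0 \<beta>_Suc that in auto)
  have \<beta>c: "\<beta> u i \<in> carrier G" if "u \<in> K" "i \<le> n" for u i
    using fibre_carrier[OF HX \<beta>q] that by blast
  \<comment> \<open>Each induction step crosses a quadrilateral with corners at the steps i and i+1
    towards \<open>u\<close> and \<open>v\<close>. Its sides are below d/2 or at most the distance
    of \<open>u\<close> and \<open>v\<close>, so its diagonal stays below \<open>d\<close>, and
    \<open>near_trans\<close> is applied once on either side of the diagonal.\<close>
  have \<beta>near: "near (\<beta> u i) (\<beta> v i)" if uv: "u \<in> K" "v \<in> K" "dist u v < d/2" and "i \<le> n" for u v i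
    using that(4)
  proof (induction i)
    case 0
    show ?case using \<beta>0 \<beta>c[of u 0] uv by (metis le0 near_refl)
  next
    case (Suc i)
    note S = \<beta>_Suc[OF \<beta>q, of u i] \<beta>_Suc[OF \<beta>q, of v i]
    have 1: "dist (pt u (Suc i)) (pt v i) < d"
    proof -
      have "dist (pt u (Suc i)) (pt v i) \<le> dist (pt u i) (pt u (Suc i)) + dist (pt u i) (pt v i)"
        by (metis dist_commute dist_triangle)
      then show ?thesis using pt_Suc[OF uv(1), of i] pt_same[of i u v] uv Suc by linarith
    qed
    have "near (\<beta> u (Suc i)) (\<beta> v i)"
      by (rule near_trans[OF HX HX HX adj \<beta>q \<beta>q \<beta>q, of u "Suc i" u i v i])
        (use Suc uv S 1 \<beta>c in \<open>auto intro: near_sym\<close>)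
    moreover have "dist (pt u (Suc i)) (pt v (Suc i)) < d"
      using pt_same[of "Suc i" u v] uv Suc d by simp
    ultimately show ?case
      by (intro near_trans[OF HX HX HX adj \<beta>q \<beta>q \<beta>q, of u "Suc i" v i v "Suc i"])
        (use Suc uv S in auto)
  qed
  \<comment> \<open>Towards the centre itself the segment is a point, all choices lie in one fibre,
    and nearness forces them to be equal.\<close>
  have a: "\<beta> a i = g0" if "i \<le> n" for i using that
  proof (induction i)
    case (Suc i)
    then show ?case
      using near_same_fibre[of "H a" "\<beta> a i" "\<beta> a (Suc i)"] \<beta>_Suc[OF \<beta>q, of a i]
        \<beta>q[of a i] assms(2,5) by (auto simp: pt_def)
  qed (simp add: \<beta>0)
  have ptn: "pt u n = u" for u using n by (simp add: pt_def)
  have "lift K H (\<lambda>u. \<beta> u n)"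
    by (rule liftI[where d = "d/2"]) (use d \<beta>near \<beta>q[of _ n] in \<open>auto simp: ptn\<close>)
  then show ?thesis using a[of n] by (intro exI[of _ "\<lambda>u. \<beta> u n"]) simp
qed

end

section \<open>Null-homotopic loops and local sections\<close>

lemma geodesic_pathE:
  assumes "geodesic_space X" "x \<in> X" "y \<in> X"
  obtains \<gamma> where "path \<gamma>" "path_image \<gamma> \<subseteq> X" "pathstart \<gamma> = x" "pathfinish \<gamma> = y"
    "\<And>u v. \<lbrakk>u \<in> {0..1}; v \<in> {0..1}\<rbrakk> \<Longrightarrow> dist (\<gamma> u) (\<gamma> v) = \<bar>u - v\<bar> * dist x y"
proof -
  obtain c where c: "c \<in> {0..dist x y} \<rightarrow> X" "c 0 = x" "c (dist x y) = y"
    "\<And>a b. \<lbrakk>a \<in> {0..dist x y}; b \<in> {0..dist x y}\<rbrakk> \<Longrightarrow> dist (c a) (c b) = \<bar>a - b\<bar>"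
    using assms unfolding geodesic_space_def by meson
  define \<gamma> where "\<gamma> u = c (u * dist x y)" for u
  have in_dom: "u * dist x y \<in> {0..dist x y}" if "u \<in> {0..1}" for u
    using that by (auto simp: mult_left_le_one_le)
  have dist: "dist (\<gamma> u) (\<gamma> v) = \<bar>u - v\<bar> * dist x y" if "u \<in> {0..1}" "v \<in> {0..1}" for u v
    using c(4)[OF in_dom[OF that(1)] in_dom[OF that(2)]]
    by (simp add: \<gamma>_def abs_mult flip: left_diff_distrib)
  have "(dist x y)-lipschitz_on {0..1} \<gamma>"
    by (rule lipschitz_onI) (simp_all add: dist dist_real_def mult.commute)
  then have "path \<gamma>"
    unfolding path_def by (rule lipschitz_on_continuous_on)
  moreover have "path_image \<gamma> \<subseteq> X"
    using c(1) in_dom by (auto simp: path_image_def \<gamma>_def)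
  moreover have "pathstart \<gamma> = x" "pathfinish \<gamma> = y"
    by (simp_all add: pathstart_def pathfinish_def \<gamma>_def c)
  ultimately show ?thesis using that dist by blast
qed

context coset_bundle
begin

text \<open>The null-homotopy is lifted over the whole square. Three sides of the square are mapped
  to \<open>z\<close>, where lifts are constant by uniqueness, so the lift along the remaining side
  \<gamma> begins and ends at the same element.\<close>

lemma lift_null_homotopic_loop:
  assumes "homotopic_paths X \<gamma> (\<lambda>_. z)" "z \<in> X" "g \<in> q z"
    and e: "e > 0" "\<And>x y. \<lbrakk>x \<in> X; y \<in> X; dist x y < e\<rbrakk> \<Longrightarrow> \<delta> x y \<le> D"
  shows "\<exists>b. lift {0..1} \<gamma> b \<and> b 0 = g \<and> b 1 = g"
proof -
  obtain h where h: "continuous_on ({0..1} \<times> {0..1}) h" "h \<in> ({0..1} \<times> {0..1}) \<rightarrow> X"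
    "\<And>x. x \<in> {0..1} \<Longrightarrow> h (0, x) = \<gamma> x" "\<And>x. x \<in> {0..1} \<Longrightarrow> h (1, x) = z"
    "\<And>t::real. t \<in> {0..1} \<Longrightarrow> h (t, 0) = pathstart \<gamma> \<and> h (t, 1) = pathfinish \<gamma>"
    using assms(1) unfolding homotopic_paths by (auto simp: pathstart_def pathfinish_def)
  have ends: "pathstart \<gamma> = z" "pathfinish \<gamma> = z"
    using homotopic_paths_imp_pathstart[OF assms(1)] homotopic_paths_imp_pathfinish[OF assms(1)]
    by (simp_all add: pathstart_def pathfinish_def)
  have h0: "h (t, 0) = z" "h (t, 1) = z" if "t \<in> {0..1}" for t
    using h(5)[OF that] ends by simp_all
  have "\<exists>b. b (0, 0) = g \<and> lift ({0..1} \<times> {0..1}) h b"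
  proof (rule lift_exists[where e = e])
    show "compact ({0..1} \<times> {0..1::real} :: (real \<times> real) set)"
      by (intro compact_Times compact_Icc)
    show "closed_segment (0, 0) u \<subseteq> {0..1} \<times> {0..1}" if "u \<in> {0..1} \<times> {0..1}" for u :: "real \<times> real"
      by (rule closed_segment_subset) (use that in \<open>auto intro: convex_Times\<close>)
    show "h ` ({0..1} \<times> {0..1}) \<subseteq> X" using h(2) by auto
    show "g \<in> q (h (0, 0))" using h0[of 0] assms(3) by simp
  qed (use h e in auto)
  then obtain b where b: "b (0, 0) = g" "lift ({0..1} \<times> {0..1}) h b" by blast
  have side: "lift {0..1} (\<lambda>t. h (f t)) (\<lambda>t. b (f t))"
    if "f = (\<lambda>t. (t, 0)) \<or> f = (\<lambda>t. (t, 1)) \<or> f = Pair 0 \<or> f = Pair 1" for f :: "real \<Rightarrow> real \<times> real"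
    by (rule lift_reparam[OF b(2)]) (use that in \<open>auto simp: dist_Pair_Pair\<close>)
  have const: "b (f 1) = b (f 0)"
    if "f = (\<lambda>t. (t, 0)) \<or> f = (\<lambda>t. (t, 1)) \<or> f = Pair 1" for f :: "real \<Rightarrow> real \<times> real"
  proof (rule lift_unique_same_start[where a = 0 and u = 1 and ?b2.0 = "\<lambda>_. b (f 0)" and K = "{0..1::real}" and H = "\<lambda>_. z"])
    have hf: "h (f t) = z" if "t \<in> {0..1}" for t
      using \<open>_ \<or> _\<close> h0 h(4) that by auto
    have f01: "f 0 \<in> {0..1} \<times> {0..1}" using that by auto
    show "lift {0..1} (\<lambda>_. z) (\<lambda>_. b (f 0))"
      using lift_const[OF assms(2), of "b (f 0)"] lift_fibre[OF b(2) f01] hf[of 0] by auto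
    have "lift {0..1} (\<lambda>t. h (f t)) (\<lambda>t. b (f t))" using side that by blast
    then show "lift {0..1} (\<lambda>_. z) (\<lambda>t. b (f t))"
      unfolding lift_def using hf by simp
  qed (use assms(2) in auto)
  have "b (0, 1) = g"
    using const[of "\<lambda>t. (t, 0)"] const[of "\<lambda>t. (t, 1)"] const[of "Pair 1"] b(1) by simp
  moreover have "lift {0..1} \<gamma> (\<lambda>t. b (0, t))"
    using side[of "Pair 0"] h(3) unfolding lift_def by simp
  ultimately show ?thesis using b(1) by blast
qed

text \<open>The scale is fixed here, unlike in \<open>lift\<close>, because sections over different
  balls are used side by side at the common scale 1/t.\<close>

definition section_on :: "real \<Rightarrow> 'x set \<Rightarrow> ('x \<Rightarrow> 'a) \<Rightarrow> bool" where
  "section_on e U b \<longleftrightarrow> (\<forall>w\<in>U. b w \<in> q w) \<and>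
     (\<forall>w\<in>U. \<forall>w'\<in>U. dist w w' < e \<longrightarrow> near (b w) (b w'))"

lemma section_on_lift: "section_on e U b \<Longrightarrow> e > 0 \<Longrightarrow> lift U (\<lambda>w. w) b"
  unfolding section_on_def lift_def by blast

lemma section_on_subset: "section_on e U b \<Longrightarrow> V \<subseteq> U \<Longrightarrow> section_on e V b"
  unfolding section_on_def by blast

text \<open>However many small steps the path takes, every point on it stays within \<open>D\<close>
  of the start, so \<open>near_trans\<close> can be applied from the start each time.\<close>

lemma near_along_short_path:
  assumes "lift {0..1} s b" "s ` {0..1} \<subseteq> X"
    and "\<And>u v. \<lbrakk>u \<in> {0..1::real}; v \<in> {0..1}\<rbrakk> \<Longrightarrow> \<delta> (s u) (s v) \<le> D"
  shows "near (b 0) (b 1)"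
proof -
  obtain d where d: "d > 0" "\<And>u v. \<lbrakk>u \<in> {0..1}; v \<in> {0..1}; dist u v < d\<rbrakk> \<Longrightarrow> near (b u) (b v)"
    using assms(1) by (auto simp: lift_def)
  note f = lift_fibre[OF assms(1)]
  have sX: "s u \<in> X" if "u \<in> {0..1}" for u using assms(2) that by blast
  show ?thesis
  proof (rule metric_connected_induct[of "{0..1::real}" 0 1 "\<lambda>u. near (b 0) (b u)" d])
    show "near (b 0) (b 0)" by (rule near_refl) (rule fibre_carrier[OF sX f], auto)
    fix u v :: real assume "u \<in> {0..1}" "v \<in> {0..1}" "dist u v < d" "near (b 0) (b u)"
    then show "near (b 0) (b v)"
      by (intro near_trans[OF sX sX sX assms(3) f f f, of 0 u v]) (auto intro: d)
  qed (use d in auto)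
qed

text \<open>The value at \<open>w\<close> is \<open>g\<close> transported along a geodesic from
  \<open>z\<close>. For close \<open>w\<close> and \<open>w'\<close>, the two geodesics and the
  short one between their ends form a loop whose lift closes up. Halving the radius leaves room for
  the short side, which is where \<open>e \<le> r / 2\<close> enters.\<close>

lemma local_section:
  assumes geo: "geodesic_space X" and z: "z \<in> X" "g \<in> q z"
    and null: "\<And>\<gamma>. \<lbrakk>path \<gamma>; path_image \<gamma> \<subseteq> X \<inter> ball z r; pathstart \<gamma> = z; pathfinish \<gamma> = z\<rbrakk>
      \<Longrightarrow> homotopic_paths X \<gamma> (\<lambda>_. z)"
    and e: "e > 0" "e \<le> r / 2" "\<And>x y. \<lbrakk>x \<in> X; y \<in> X; dist x y < e\<rbrakk> \<Longrightarrow> \<delta> x y \<le> D"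
  shows "\<exists>b. section_on e (X \<inter> ball z (r / 2)) b \<and> b z = g"
proof -
  let ?U = "X \<inter> ball z (r / 2)"
  have "\<exists>\<gamma> \<beta>. path \<gamma> \<and> path_image \<gamma> \<subseteq> ?U \<and> pathstart \<gamma> = z \<and> pathfinish \<gamma> = w \<and>
      lift {0..1} \<gamma> \<beta> \<and> \<beta> 0 = g \<and> (w = z \<longrightarrow> \<beta> 1 = g)" if w: "w \<in> ?U" for w
  proof -
    obtain \<gamma> where \<gamma>: "path \<gamma>" "path_image \<gamma> \<subseteq> X" "pathstart \<gamma> = z" "pathfinish \<gamma> = w"
      "\<And>u v. \<lbrakk>u \<in> {0..1}; v \<in> {0..1}\<rbrakk> \<Longrightarrow> dist (\<gamma> u) (\<gamma> v) = \<bar>u - v\<bar> * dist z w"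
      using geodesic_pathE[OF geo, of z w] z w by blast
    have \<gamma>0: "\<gamma> 0 = z" using \<gamma>(3) by (simp add: pathstart_def)
    have dz: "dist z (\<gamma> u) = u * dist z w" if "u \<in> {0..1}" for u
      using \<gamma>(5)[of 0 u] that \<gamma>0 by simp
    have "path_image \<gamma> \<subseteq> ?U"
    proof -
      have "dist z (\<gamma> u) < r / 2" if "u \<in> {0..1}" for u
        using dz[OF that] w that mult_left_le_one_le[of "dist z w" u] by simp
      then show ?thesis using \<gamma>(2) by (auto simp: path_image_def)
    qed
    moreover have "\<exists>\<beta>. \<beta> 0 = g \<and> lift {0..1} \<gamma> \<beta>"
      by (rule lift_exists[where e = e]) (use \<gamma> \<gamma>0 z e in \<open>auto simp: path_def path_image_def closed_segment_eq_real_ivl\<close>)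
    then obtain \<beta> where \<beta>: "\<beta> 0 = g" "lift {0..1} \<gamma> \<beta>" by blast
    moreover have "\<beta> 1 = g" if "w = z"
    proof -
      have "\<gamma> u = z" if "u \<in> {0..1}" for u using dz[OF that] \<open>w = z\<close> by simp
      then have "lift {0..1} (\<lambda>_. z) \<beta>" using \<beta>(2) by (simp add: lift_def)
      then show ?thesis
        using lift_unique_same_start[of "{0..1::real}" 0 1 "\<lambda>_. z" \<beta> "\<lambda>_. g"] lift_const[OF z, of "{0..1}"] \<beta>(1) z
        by (simp add: image_subset_iff)
    qed
    ultimately show ?thesis using \<gamma> by blast
  qed
  then obtain c \<beta> where c: "\<And>w. w \<in> ?U \<Longrightarrow> path (c w) \<and> path_image (c w) \<subseteq> ?U \<and> pathstart (c w) = z \<and>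
      pathfinish (c w) = w"
    and \<beta>: "\<And>w. w \<in> ?U \<Longrightarrow> lift {0..1} (c w) (\<beta> w) \<and> \<beta> w 0 = g \<and> (w = z \<longrightarrow> \<beta> w 1 = g)"
    by metis
  define b where "b w = \<beta> w 1" for w
  have r: "r > 0" using e by linarith
  have "near (b w) (b w')" if w: "w \<in> ?U" "w' \<in> ?U" "dist w w' < e" for w w'
  proof -
    obtain s where s: "path s" "path_image s \<subseteq> X" "pathstart s = w" "pathfinish s = w'"
      "\<And>u v. \<lbrakk>u \<in> {0..1}; v \<in> {0..1}\<rbrakk> \<Longrightarrow> dist (s u) (s v) = \<bar>u - v\<bar> * dist w w'"
      using geodesic_pathE[OF geo, of w w'] w by blast
    have s0: "s 0 = w" "s 1 = w'" using s(3,4) by (simp_all add: pathstart_def pathfinish_def)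
    have s_short: "dist (s u) (s v) < e" if "u \<in> {0..1}" "v \<in> {0..1}" for u v
    proof -
      have "\<bar>u - v\<bar> \<le> 1" using that by auto
      then have "\<bar>u - v\<bar> * dist w w' \<le> dist w w'" by (simp add: mult_left_le_one_le)
      then show ?thesis using s(5)[OF that] w(3) by linarith
    qed
    have sX: "s u \<in> X" if "u \<in> {0..1}" for u using s(2) that by (auto simp: path_image_def)
    have s_im: "path_image s \<subseteq> X \<inter> ball z r"
    proof -
      have "dist z (s u) < r" if "u \<in> {0..1}" for u
        using dist_triangle[of z "s u" w] s_short[of 0 u] that w(1) e(2) s0 by simp
      then show ?thesis using s(2) by (auto simp: path_image_def)
    qed
    have c_im: "path_image (c v) \<subseteq> X \<inter> ball z r" if "v \<in> ?U" for v
      using c[OF that] r by force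
    \<comment> \<open>The three pieces occupy the times [0,1/2], [1/2,3/4] and [3/4,1]; this is the
      origin of the arguments 1/2 and 3/4 of \<open>B0\<close> below.\<close>
    let ?\<gamma> = "c w +++ (s +++ reversepath (c w'))"
    have "homotopic_paths X ?\<gamma> (\<lambda>_. z)"
    proof (rule null)
      show "path_image ?\<gamma> \<subseteq> X \<inter> ball z r"
        using c_im[OF w(1)] c_im[OF w(2)] s_im
        by (intro subset_path_image_join) simp_all
    qed (use c[OF w(1)] c[OF w(2)] s in auto)
    then obtain B0 where B0: "lift {0..1} ?\<gamma> B0" "B0 0 = g" "B0 1 = g"
      using lift_null_homotopic_loop[OF _ z e(1,3)] by blast
    have cX: "c v ` {0..1} \<subseteq> X" if "v \<in> ?U" for v
      using c[OF that] by (auto simp: path_image_def)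
    have ends: "c w 1 = w" "c w' 1 = w'" using c[OF w(1)] c[OF w(2)] by (auto simp: pathfinish_def)
    have "lift {0..1} (c w) (\<lambda>u. B0 (u / 2))"
      by (rule lift_reparam[OF B0(1)]) (auto simp: dist_real_def joinpaths_def)
    then have 1: "B0 (1/2) = b w"
      using lift_unique_same_start[of "{0..1::real}" 0 1 "c w" "\<lambda>u. B0 (u / 2)" "\<beta> w"]
        \<beta>[OF w(1)] B0(2) cX[OF w(1)] by (simp add: b_def)
    \<comment> \<open>Reading the last piece backwards from \<open>B0 1 = g\<close> gives a lift of
      \<open>c w'\<close> that starts at \<open>g\<close>, hence the one defining
      \<open>b w'\<close>.\<close>
    have "lift {0..1} (c w') (\<lambda>u. B0 (1 - u / 4))"
    proof (rule lift_reparam[OF B0(1)])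
      fix u :: real assume u: "u \<in> {0..1}"
      show "c w' u = ?\<gamma> (1 - u / 4)"
      proof (cases "u = 1")
        case True then show ?thesis by (simp add: joinpaths_def ends s0)
      next
        case False
        then have "2 * (1 - u / 4) - 1 > 1 / 2" "1 - u/4 > 1/2" using u by auto
        then show ?thesis by (simp add: joinpaths_def reversepath_def)
      qed
    qed (auto simp: dist_real_def abs_if)
    then have 2: "B0 (3/4) = b w'"
      using lift_unique_same_start[of "{0..1::real}" 0 1 "c w'" "\<lambda>u. B0 (1 - u / 4)" "\<beta> w'"]
        \<beta>[OF w(2)] B0(3) cX[OF w(2)] by (simp add: b_def)
    have "lift {0..1} s (\<lambda>u. B0 (1/2 + u / 4))"
    proof (rule lift_reparam[OF B0(1)])
      fix u :: real assume u: "u \<in> {0..1}"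
      show "s u = ?\<gamma> (1/2 + u / 4)"
        using u by (cases "u = 0") (simp_all add: joinpaths_def ends s0)
    qed (auto simp: dist_real_def abs_if)
    then have "near (B0 (1/2 + 0 / 4)) (B0 (1/2 + 1 / 4))"
      by (rule near_along_short_path) (use sX s_short e(3) in auto)
    then show ?thesis using 1 2 by simp
  qed
  moreover have "b w \<in> q w" if "w \<in> ?U" for w
    using lift_fibre[of "{0..1}" "c w" "\<beta> w" 1] \<beta>[OF that] c[OF that] by (simp add: b_def pathfinish_def)
  moreover have "b z = g" using \<beta>[of z] z r by (simp add: b_def)
  ultimately show ?thesis unfolding section_on_def by blast
qed

end

section \<open>Holonomy\<close>

lemma small_adjacent:
  assumes "t > 0" "\<And>x y. \<lbrakk>x \<in> X; y \<in> X\<rbrakk> \<Longrightarrow> \<delta> x y \<le> t * dist x y" "x \<in> X" "y \<in> X" "dist x y < 1 / t"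
  shows "\<delta> x y \<le> 1"
proof -
  have "t * dist x y < 1" using assms(1,5) by (simp add: field_simps)
  then show ?thesis using assms(2)[OF assms(3,4)] by linarith
qed

context coset_bundle
begin

text \<open>The reference points \<open>\<sigma>\<close> are an arbitrary, possibly discontinuous,
  choice in the fibres. Transport is measured against them, and only modulo the candidate subgroup
  \<open>P\<close>.\<close>

definition linked :: "'a set \<Rightarrow> ('x \<Rightarrow> 'a) \<Rightarrow> 'x \<Rightarrow> 'x \<Rightarrow> bool" where
  "linked P \<sigma> x y \<longleftrightarrow> (\<exists>p\<in>P. near (\<sigma> x) (p \<otimes> \<sigma> y))"

lemma linked_sym:
  assumes P: "subgroup P G" and \<sigma>: "\<And>x. x \<in> X \<Longrightarrow> \<sigma> x \<in> q x"
    and xy: "x \<in> X" "y \<in> X" "linked P \<sigma> x y"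
  shows "linked P \<sigma> y x"
proof -
  obtain p where p: "p \<in> P" "near (\<sigma> x) (p \<otimes> \<sigma> y)" using xy by (auto simp: linked_def)
  have c: "\<sigma> x \<in> carrier G" "\<sigma> y \<in> carrier G" "p \<in> carrier G"
    using fibre_carrier \<sigma> xy p(1) subgroup.mem_carrier[OF P] by blast+
  have "near (inv p \<otimes> (p \<otimes> \<sigma> y)) (inv p \<otimes> \<sigma> x)"
    using near_sym[OF p(2)] c by (subst near_translate) auto
  then show ?thesis
    using c p(1) subgroup.m_inv_closed[OF P] by (auto simp: linked_def)
qed

text \<open>The bound on \<open>\<delta> x z\<close> comes from \<open>near_trans\<close>. It means
  that links may be chained only among points within \<open>D\<close> of a fixed starting
  point.\<close>

lemma linked_trans:
  assumes P: "subgroup P G" "P \<subseteq> N" and \<sigma>: "\<And>x. x \<in> X \<Longrightarrow> \<sigma> x \<in> q x"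
    and xyz: "x \<in> X" "y \<in> X" "z \<in> X" "\<delta> x z \<le> D" and "linked P \<sigma> x y" "linked P \<sigma> y z"
  shows "linked P \<sigma> x z"
proof -
  obtain p p' where p: "p \<in> P" "near (\<sigma> x) (p \<otimes> \<sigma> y)" and p': "p' \<in> P" "near (\<sigma> y) (p' \<otimes> \<sigma> z)"
    using assms(8,9) by (auto simp: linked_def)
  have c: "\<sigma> x \<in> carrier G" "\<sigma> y \<in> carrier G" "\<sigma> z \<in> carrier G" "p \<in> carrier G" "p' \<in> carrier G"
    using fibre_carrier \<sigma> xyz p p' subgroup.mem_carrier[OF P(1)] by blast+
  have pp': "p \<otimes> p' \<in> P" using p p' subgroup.m_closed[OF P(1)] by blast
  have "near (p \<otimes> \<sigma> y) ((p \<otimes> p') \<otimes> \<sigma> z)"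
    using p' c by (simp add: m_assoc near_translate)
  then have "near (\<sigma> x) ((p \<otimes> p') \<otimes> \<sigma> z)"
    using near_trans[OF xyz(1-4) \<sigma>[OF xyz(1)] fibre_translate[OF xyz(2) \<sigma>[OF xyz(2)]]
        fibre_translate[OF xyz(3) \<sigma>[OF xyz(3)]] p(2)] p(1) pp' P(2) by blast
  then show ?thesis using pp' by (auto simp: linked_def)
qed

text \<open>The fibre elements \<open>\<sigma> x\<close> come from sections over the balls of a finite net \<open>Y\<close>. The generators of
  \<open>P\<close> compare the sections over pairs of net points, and record one jump for each \<open>s \<in> S\<close>: that
  the jumps by \<open>s\<close> at all other points lie in \<open>P\<close> follows by moving along \<open>X\<close>, which is connected.\<close>

lemma holonomy_generators:
  assumes geo: "geodesic_space X" and "connected X" "compact X" and "2 \<le> D"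
    and t: "t > 0" "\<And>x y. \<lbrakk>x \<in> X; y \<in> X\<rbrakk> \<Longrightarrow> \<delta> x y \<le> t * dist x y"
    and S: "finite S" "\<And>s. s \<in> S \<Longrightarrow> continuous_on X s \<and> s ` X \<subseteq> X"
      "\<And>s x. \<lbrakk>s \<in> S; x \<in> X\<rbrakk> \<Longrightarrow> \<delta> x (s x) \<le> 1"
    and Y: "finite Y" "Y \<subseteq> X" "X \<subseteq> (\<Union>y\<in>Y. ball y (\<epsilon> / 4))" "1 / t \<le> \<epsilon> / 4"
    and sec: "\<And>y. y \<in> Y \<Longrightarrow> \<exists>b. section_on (1 / t) (X \<inter> ball y \<epsilon>) b"
  shows "\<exists>A \<sigma>. finite A \<and> card A \<le> card Y * card Y + card S \<and> A \<subseteq> N \<and> (\<forall>x\<in>X. \<sigma> x \<in> q x) \<and>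
    (\<forall>x\<in>X. \<forall>y\<in>X. dist x y < 1 / t \<longrightarrow> linked (generate G A) \<sigma> x y) \<and>
    (\<forall>x\<in>X. \<forall>s\<in>S. linked (generate G A) \<sigma> x (s x))"
proof (cases "X = {}")
  case True
  then show ?thesis by (intro exI[of _ "{}"]) auto
next
  case False
  then obtain x0 where x0: "x0 \<in> X" by blast
  interpret MS: Metric_space X \<delta> by (rule metric)
  have e: "1 / t > 0" and \<epsilon>: "\<epsilon> > 0" using t Y(4) zero_less_divide_1_iff[of t] by linarith+
  obtain b where b: "\<And>y. y \<in> Y \<Longrightarrow> section_on (1 / t) (X \<inter> ball y \<epsilon>) (b y)"
    using sec by metis
  have "\<exists>y. y \<in> Y \<and> dist y x < \<epsilon> / 4" if "x \<in> X" for x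
    using subsetD[OF Y(3) that] by auto
  then obtain \<pi> where \<pi>: "\<And>x. x \<in> X \<Longrightarrow> \<pi> x \<in> Y \<and> dist (\<pi> x) x < \<epsilon> / 4" by metis
  define \<sigma> where "\<sigma> x = b (\<pi> x) x" for x
  have \<sigma>: "\<sigma> x \<in> q x" if "x \<in> X" for x
    using b[of "\<pi> x"] \<pi>[OF that] that \<epsilon> unfolding \<sigma>_def section_on_def by auto
  note \<sigma>c = fibre_carrier[OF _ \<sigma>]
  \<comment> \<open>The transition between two sections is read off at the net point
    \<open>y\<close>. The default \<open>\<one>\<close> applies when \<open>y\<close> lies outside
    the second ball and keeps \<open>c y y'\<close> in \<open>N\<close>.\<close>
  define c where "c y y' = (if y \<in> ball y' \<epsilon> then b y y \<otimes> inv (b y' y) else \<one>)" for y y'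
  have bq: "b y w \<in> q w" if "y \<in> Y" "w \<in> X" "w \<in> ball y \<epsilon>" for y w
    using b[OF that(1)] that unfolding section_on_def by blast
  have c: "c y y' \<in> N" if "y \<in> Y" "y' \<in> Y" for y y'
  proof (cases "y \<in> ball y' \<epsilon>")
    case True
    then show ?thesis
      using fibre_quotient[of y "b y y" "b y' y"] bq[of y y] bq[of y' y] that Y(2) \<epsilon>
      by (auto simp: c_def)
  qed (simp add: c_def)
  have "\<exists>h. h \<in> q (s x0) \<and> near (\<sigma> x0) h" if "s \<in> S" for s
    using step[of x0 "s x0" "\<sigma> x0"] S(2,3)[OF that] x0 \<sigma> \<open>2 \<le> D\<close>
    by (force simp: near_def)
  then obtain h where h: "\<And>s. s \<in> S \<Longrightarrow> h s \<in> q (s x0) \<and> near (\<sigma> x0) (h s)" by metis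
  define d where "d s = h s \<otimes> inv (\<sigma> (s x0))" for s
  have sX: "s x \<in> X" if "s \<in> S" "x \<in> X" for s x using S(2) that by blast
  have d: "d s \<in> N" if "s \<in> S" for s
    using fibre_quotient[of "s x0"] h \<sigma> sX x0 that by (simp add: d_def)
  define A where "A = (\<lambda>(y, y'). c y y') ` (Y \<times> Y) \<union> d ` S"
  have A: "finite A" "A \<subseteq> N" using Y(1) S(1) c d by (auto simp: A_def)
  have "card A \<le> card ((\<lambda>(y, y'). c y y') ` (Y \<times> Y)) + card (d ` S)"
    unfolding A_def by (rule card_Un_le)
  also have "\<dots> \<le> card (Y \<times> Y) + card S"
    using Y(1) S(1) by (intro add_mono card_image_le) auto
  finally have cardA: "card A \<le> card Y * card Y + card S" by (simp add: card_cartesian_product)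
  let ?P = "generate G A"
  have AG: "A \<subseteq> carrier G" using A(2) subset by blast
  have P: "subgroup ?P G" "?P \<subseteq> N"
    using generate_is_subgroup[OF AG] generate_subgroup_incl[OF A(2) is_subgroup] by auto
  have small: "linked ?P \<sigma> x x'" if x: "x \<in> X" "x' \<in> X" "dist x x' < 1 / t" for x x'
  proof -
    define y y' where "y = \<pi> x" and "y' = \<pi> x'"
    have y: "y \<in> Y" "dist y x < \<epsilon> / 4" "y' \<in> Y" "dist y' x' < \<epsilon> / 4"
      using \<pi> x by (auto simp: y_def y'_def)
    have yx': "dist y x' < \<epsilon> / 2" using dist_triangle[of y x' x] y(2) x(3) Y(4) by linarith
    obtain s where s: "path s" "path_image s \<subseteq> X" "pathstart s = y" "pathfinish s = x'"
      "\<And>u v. \<lbrakk>u \<in> {0..1}; v \<in> {0..1}\<rbrakk> \<Longrightarrow> dist (s u) (s v) = \<bar>u - v\<bar> * dist y x'"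
      using geodesic_pathE[OF geo, of y x'] y x Y(2) by blast
    have s01: "s 0 = y" "s 1 = x'" using s(3,4) by (simp_all add: pathstart_def pathfinish_def)
    \<comment> \<open>The geodesic from \<open>y\<close> stays within \<epsilon>/2 of both of its
      ends, and \<open>x'\<close> is within \<epsilon>/4 of \<open>y'\<close>, so both sections are
      defined along it.\<close>
    have s_im: "path_image s \<subseteq> X \<inter> ball y \<epsilon> \<inter> ball y' \<epsilon>"
    proof -
      have "dist y (s u) < \<epsilon> \<and> dist y' (s u) < \<epsilon>" if u: "u \<in> {0..1}" for u
      proof -
        have "\<bar>0 - u\<bar> * dist y x' \<le> 1 * dist y x'" "\<bar>1 - u\<bar> * dist y x' \<le> 1 * dist y x'"
          using u by (auto simp: mult_left_le_one_le)
        then have "dist y (s u) < \<epsilon> / 2" "dist x' (s u) < \<epsilon> / 2"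
          using s(5)[of 0 u] s(5)[of 1 u] u yx' s01 by auto
        then show ?thesis using dist_triangle[of y' "s u" x'] y(4) \<epsilon> by linarith
      qed
      then show ?thesis using s(2) by (auto simp: path_image_def)
    qed
    have yim: "y \<in> path_image s" "x' \<in> path_image s"
      using s(3,4) pathstart_in_path_image pathfinish_in_path_image by blast+
    have cc: "b y y = c y y' \<otimes> b y' y"
    proof -
      have "b y y \<in> carrier G" "b y' y \<in> carrier G"
        using fibre_carrier bq[of y y] bq[of y' y] y s_im yim by blast+
      then show ?thesis using s_im yim by (auto simp: c_def m_assoc)
    qed
    \<comment> \<open>The transition found at \<open>y\<close> persists to \<open>x'\<close> because
      the geodesic between them is connected.\<close>
    have "b y x' = c y y' \<otimes> b y' x'"
    proof (rule lift_unique[where K = "path_image s" and H = "\<lambda>w. w" and a = y])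
      show "lift (path_image s) (\<lambda>w. w) (b y)" "lift (path_image s) (\<lambda>w. w) (b y')"
        using s_im b[OF y(1)] b[OF y(3)] e by (auto intro!: section_on_lift elim: section_on_subset)
    qed (use s yim c[OF y(1,3)] cc in \<open>auto intro: connected_path_image\<close>)
    moreover have "near (b y x) (b y x')"
      using b[OF y(1)] x y s_im yim \<epsilon> unfolding section_on_def by auto
    moreover have "c y y' \<in> ?P"
      using y by (intro generate.incl) (auto simp: A_def)
    ultimately show ?thesis by (auto simp: linked_def \<sigma>_def y_def y'_def)
  qed
  have D1: "\<delta> x y \<le> 1" if "x \<in> X" "y \<in> X" "dist x y < 1 / t" for x y
    using small_adjacent[OF t that] .
  have jump: "linked ?P \<sigma> x (s x)" if x: "x \<in> X" and s: "s \<in> S" for x s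
  proof -
    have "uniformly_continuous_on X s"
      using compact_uniformly_continuous S(2)[OF s] \<open>compact X\<close> by blast
    then obtain r where r: "r > 0" "\<And>u v. \<lbrakk>u \<in> X; v \<in> X; dist u v < r\<rbrakk> \<Longrightarrow> dist (s u) (s v) < 1 / t"
      using e unfolding uniformly_continuous_on_def by (metis dist_commute)
    show ?thesis
    proof (rule metric_connected_induct[of X x0 x "\<lambda>x. linked ?P \<sigma> x (s x)" "min r (1 / t)"])
      have "h s \<in> carrier G" "\<sigma> (s x0) \<in> carrier G"
        using h[OF s] fibre_carrier sX[OF s x0] \<sigma> by blast+
      then have "h s = d s \<otimes> \<sigma> (s x0)" by (simp add: d_def m_assoc)
      then show "linked ?P \<sigma> x0 (s x0)"
        using h[OF s] s unfolding linked_def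
        by (intro bexI[of _ "d s"] generate.incl) (auto simp: A_def)
      fix u v assume uv: "u \<in> X" "v \<in> X" "dist u v < min r (1 / t)" "linked ?P \<sigma> u (s u)"
      have suv: "s u \<in> X" "s v \<in> X" "dist (s u) (s v) < 1 / t" "dist v u < 1 / t"
        using uv sX[OF s] r(2)[of u v] by (auto simp: dist_commute)
      \<comment> \<open>The link at \<open>v\<close> is obtained by the detour v, u, s u, s v. The
        small move and the jump each cost at most 1, which needs \<open>2 \<le> D\<close>.\<close>
      have "\<delta> v (s u) \<le> \<delta> v u + \<delta> u (s u)" by (rule MS.triangle[OF uv(2,1) suv(1)])
      then have vsu: "\<delta> v (s u) \<le> D" using D1[of v u] S(3)[OF s uv(1)] uv suv \<open>2 \<le> D\<close> by linarith
      have "linked ?P \<sigma> v (s u)"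
        by (rule linked_trans[OF P \<sigma> uv(2,1) suv(1) vsu]) (use small uv suv in auto)
      have vsv: "\<delta> v (s v) \<le> D" using S(3)[OF s uv(2)] \<open>2 \<le> D\<close> by linarith
      show "linked ?P \<sigma> v (s v)"
        by (rule linked_trans[OF P \<sigma> uv(2) suv(1,2) vsv])
          (use \<open>linked ?P \<sigma> v (s u)\<close> small suv in auto)
    qed (use x x0 \<open>connected X\<close> r e in auto)
  qed
  show ?thesis
    by (intro exI[of _ A] exI[of _ \<sigma>]) (use A cardA \<sigma> small jump in auto)
qed

end

section \<open>Lengths of jumping-paths, and finite nets of balls whose loops contract\<close>

lemma dist_le_path_length:
  assumes "u \<in> {0..1}" "v \<in> {0..1}"
  shows "ennreal (dist (\<gamma> u) (\<gamma> v)) \<le> path_length \<gamma>"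
proof -
  have *: "ennreal (dist (\<gamma> u) (\<gamma> v)) \<le> path_length \<gamma>" if "u \<in> {0..1}" "v \<in> {0..1}" "u \<le> v" for u v
  proof -
    let ?\<tau> = "\<lambda>i::nat. if i = 0 then u else v"
    have "mono ?\<tau>" "range ?\<tau> \<subseteq> {0..1}" using that by (auto simp: mono_def)
    then show ?thesis
      unfolding path_length_def by (intro SUP_upper2[of "(1, ?\<tau>)"]) auto
  qed
  show ?thesis
    using *[of u v] *[of v u] assms by (cases "u \<le> v") (auto simp: dist_commute)
qed

lemma jumping_path_in_space:
  assumes "jumping_path X S n \<gamma> \<tau>" "i \<le> n" "u \<in> {0..1}"
  shows "\<gamma> i u \<in> X"
  using assms unfolding jumping_path_def path_image_def by (meson image_subset_iff)

lemma jumping_path_jump: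
  assumes "jumping_path X S n \<gamma> \<tau>" "Suc i \<le> n"
  shows "\<tau> (Suc i) \<in> S \<union> inv_into X ` S" "\<gamma> (Suc i) 0 = \<tau> (Suc i) (\<gamma> i 1)"
proof -
  have "Suc i \<in> {1..n}" using assms(2) by simp
  then show "\<tau> (Suc i) \<in> S \<union> inv_into X ` S" "\<gamma> (Suc i) 0 = \<tau> (Suc i) (\<gamma> i 1)"
    using assms(1) unfolding jumping_path_def pathstart_def pathfinish_def
    by (metis diff_Suc_1)+
qed

text \<open>Kept in \<open>ennreal\<close> because the continuous pieces may have infinite length;
  finiteness enters only once the total length is known.\<close>

lemma jumping_path_dist_start:
  assumes "Metric_space X \<delta>" "t > 0" "\<And>x y. \<lbrakk>x \<in> X; y \<in> X\<rbrakk> \<Longrightarrow> \<delta> x y \<le> t * dist x y"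
    and "\<And>s x. \<lbrakk>s \<in> S; x \<in> X\<rbrakk> \<Longrightarrow> \<delta> x (s x) \<le> 1" and S: "\<And>s. s \<in> S \<Longrightarrow> s ` X = X"
    and jp: "jumping_path X S n \<gamma> \<tau>" and "i \<le> n" "u \<in> {0..1}"
  shows "ennreal (\<delta> (pathstart (\<gamma> 0)) (\<gamma> i u)) \<le> of_nat i + (\<Sum>j\<le>i. ennreal t * path_length (\<gamma> j))"
  using assms(7,8)
proof (induction i arbitrary: u)
  case 0
  have "\<gamma> 0 u \<in> X" "\<gamma> 0 0 \<in> X" using jumping_path_in_space[OF jp] 0 by auto
  then have "ennreal (\<delta> (\<gamma> 0 0) (\<gamma> 0 u)) \<le> ennreal (t * dist (\<gamma> 0 0) (\<gamma> 0 u))"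
    using assms(3) by (intro ennreal_leI) blast
  also have "\<dots> = ennreal t * ennreal (dist (\<gamma> 0 0) (\<gamma> 0 u))"
    using assms(2) by (simp add: ennreal_mult)
  also have "\<dots> \<le> ennreal t * path_length (\<gamma> 0)"
    by (rule mult_left_mono[OF dist_le_path_length]) (use 0 in simp_all)
  finally show ?case by (simp add: pathstart_def)
next
  case (Suc i)
  interpret MS: Metric_space X \<delta> by fact
  let ?x = "pathstart (\<gamma> 0)"
  note X = jumping_path_in_space[OF jp]
  have x: "?x \<in> X" using X[of 0 0] by (simp add: pathstart_def)
  note jump = jumping_path_jump[OF jp Suc.prems(1)]
  have i: "\<gamma> i 1 \<in> X" "\<gamma> (Suc i) 0 \<in> X" "\<gamma> (Suc i) u \<in> X" using X Suc by auto
  have "\<delta> (\<gamma> i 1) (\<gamma> (Suc i) 0) \<le> 1"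
  proof (cases "\<tau> (Suc i) \<in> S")
    case True
    then show ?thesis using assms(4) i jump(2) by simp
  next
    case False
    then obtain s where s: "s \<in> S" "\<tau> (Suc i) = inv_into X s" using jump(1) by auto
    have "s (\<gamma> (Suc i) 0) = \<gamma> i 1"
      using i(1) S[OF s(1)] jump(2) s(2) by (simp add: f_inv_into_f)
    then show ?thesis using assms(4)[OF s(1) i(2)] MS.commute by simp
  qed
  then have "\<delta> ?x (\<gamma> (Suc i) u) \<le> \<delta> ?x (\<gamma> i 1) + 1 + t * dist (\<gamma> (Suc i) 0) (\<gamma> (Suc i) u)"
    using MS.triangle[OF x i(1,3)] MS.triangle[OF i] assms(3)[OF i(2,3)] by linarith
  then have "ennreal (\<delta> ?x (\<gamma> (Suc i) u)) \<le>
      ennreal (\<delta> ?x (\<gamma> i 1) + 1 + t * dist (\<gamma> (Suc i) 0) (\<gamma> (Suc i) u))"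
    by (rule ennreal_leI)
  also have "\<dots> = ennreal (\<delta> ?x (\<gamma> i 1)) + 1 + ennreal t * ennreal (dist (\<gamma> (Suc i) 0) (\<gamma> (Suc i) u))"
    using assms(2) by (simp add: ennreal_mult ennreal_plus)
  also have "\<dots> \<le> (of_nat i + (\<Sum>j\<le>i. ennreal t * path_length (\<gamma> j))) + 1
      + ennreal t * path_length (\<gamma> (Suc i))"
    by (rule add_mono[OF add_mono[OF Suc.IH order_refl] mult_left_mono[OF dist_le_path_length]])
      (use Suc.prems in simp_all)
  finally show ?case by (simp add: ac_simps)
qed

text \<open>An initial part is no longer than the whole. With c the distance of the ends, transport
  along a jumping-geodesic never leaves the \<delta>-ball about its start in which links may be
  chained.\<close>

lemma jumping_geodesic_stays_close:
  assumes "Metric_space X \<delta>" "t > 0" "\<And>x y. \<lbrakk>x \<in> X; y \<in> X\<rbrakk> \<Longrightarrow> \<delta> x y \<le> t * dist x y"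
    and "\<And>s x. \<lbrakk>s \<in> S; x \<in> X\<rbrakk> \<Longrightarrow> \<delta> x (s x) \<le> 1" and S: "\<And>s. s \<in> S \<Longrightarrow> s ` X = X"
    and jp: "jumping_path X S n \<gamma> \<tau>" and "jumping_length t n \<gamma> = ennreal c" "0 \<le> c"
    and "i \<le> n" "u \<in> {0..1}"
  shows "\<delta> (pathstart (\<gamma> 0)) (\<gamma> i u) \<le> c"
proof -
  have "ennreal (\<delta> (pathstart (\<gamma> 0)) (\<gamma> i u)) \<le> of_nat i + (\<Sum>j\<le>i. ennreal t * path_length (\<gamma> j))"
    by (rule jumping_path_dist_start[where X = X and S = S and n = n and \<tau> = \<tau>]; fact assms)
  also have "\<dots> \<le> of_nat n + (\<Sum>j\<le>n. ennreal t * path_length (\<gamma> j))"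
    using \<open>i \<le> n\<close> by (intro add_mono sum_mono2) auto
  also have "\<dots> = ennreal c" using assms(7) by (simp add: jumping_length_def)
  finally show ?thesis using \<open>0 \<le> c\<close> by simp
qed

text \<open>A Lebesgue number argument: a finite cover by balls of a quarter of the good radii
  determines \<epsilon> as a quarter of the least radius, and then a net of mesh \<epsilon>/4 is
  chosen. Both depend on \<open>X\<close> alone, which makes the later bound on the rank independent
  of the level.\<close>

lemma null_homotopic_net:
  fixes X :: "'x::metric_space set"
  assumes "compact X" "semilocally_simply_connected X"
  shows "\<exists>Y \<epsilon>. finite Y \<and> Y \<subseteq> X \<and> 0 < \<epsilon> \<and> X \<subseteq> (\<Union>y\<in>Y. ball y (\<epsilon> / 4)) \<and>
    (\<forall>y\<in>Y. \<exists>z\<in>X. \<exists>r. 4 * \<epsilon> \<le> r \<and> ball y \<epsilon> \<subseteq> ball z (r / 2) \<and>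
      (\<forall>\<gamma>. path \<gamma> \<and> path_image \<gamma> \<subseteq> X \<inter> ball z r \<and> pathstart \<gamma> = z \<and> pathfinish \<gamma> = z \<longrightarrow>
        homotopic_paths X \<gamma> (\<lambda>_. z)))"
proof (cases "X = {}")
  case True
  then show ?thesis by (intro exI[of _ "{}"] exI[of _ 1]) auto
next
  case False
  define null where "null z r \<longleftrightarrow> (\<forall>\<gamma>. path \<gamma> \<and> path_image \<gamma> \<subseteq> X \<inter> ball z r \<and> pathstart \<gamma> = z \<and>
    pathfinish \<gamma> = z \<longrightarrow> homotopic_paths X \<gamma> (\<lambda>_. z))" for z r
  have "\<exists>r>0. null z r" if z: "z \<in> X" for z
  proof -
    obtain U where U: "openin (top_of_set X) U" "z \<in> U"
      "\<forall>\<gamma>. path \<gamma> \<and> path_image \<gamma> \<subseteq> U \<and> pathstart \<gamma> = z \<and> pathfinish \<gamma> = z \<longrightarrow> homotopic_paths X \<gamma> (\<lambda>_. z)"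
      using assms(2) z unfolding semilocally_simply_connected_def by meson
    obtain V where V: "open V" "U = X \<inter> V" using U(1) by (auto simp: openin_open)
    obtain r where "r > 0" "ball z r \<subseteq> V" using V U(2) open_contains_ball by blast
    then show ?thesis using U(3) V(2) unfolding null_def by (intro exI[of _ r]) blast
  qed
  then obtain r where r: "\<And>z. z \<in> X \<Longrightarrow> r z > 0 \<and> null z (r z)" by metis
  have net: "\<exists>Y\<subseteq>X. finite Y \<and> X \<subseteq> (\<Union>y\<in>Y. ball y (f y))" if "\<And>z. z \<in> X \<Longrightarrow> f z > 0" for f :: "'x \<Rightarrow> real"
  proof -
    have "X \<subseteq> (\<Union>z\<in>X. ball z (f z))" using that by force
    then obtain Y where "Y \<subseteq> X" "finite Y" "X \<subseteq> (\<Union>y\<in>Y. ball y (f y))"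
      using compactE_image[OF assms(1), of X "\<lambda>z. ball z (f z)"] by blast
    then show ?thesis by blast
  qed
  obtain Z where Z: "Z \<subseteq> X" "finite Z" "X \<subseteq> (\<Union>z\<in>Z. ball z (r z / 4))"
    using net[of "\<lambda>z. r z / 4"] r by auto
  have "Z \<noteq> {}" using Z(3) False by auto
  define \<epsilon> where "\<epsilon> = Min (r ` Z) / 4"
  have "\<epsilon> > 0" using Z \<open>Z \<noteq> {}\<close> r by (auto simp: \<epsilon>_def Min_gr_iff)
  have \<epsilon>: "4 * \<epsilon> \<le> r z" if "z \<in> Z" for z using Z(2) that by (simp add: \<epsilon>_def)
  obtain Y where Y: "Y \<subseteq> X" "finite Y" "X \<subseteq> (\<Union>y\<in>Y. ball y (\<epsilon> / 4))"
    using net[of "\<lambda>_. \<epsilon> / 4"] \<open>\<epsilon> > 0\<close> by auto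
  have "\<exists>z\<in>X. \<exists>\<rho>. 4 * \<epsilon> \<le> \<rho> \<and> ball y \<epsilon> \<subseteq> ball z (\<rho> / 2) \<and> null z \<rho>" if y: "y \<in> Y" for y
  proof -
    obtain z where z: "z \<in> Z" "y \<in> ball z (r z / 4)" using Z(3) Y(1) y by blast
    have "ball y \<epsilon> \<subseteq> ball z (r z / 2)"
    proof
      fix w assume "w \<in> ball y \<epsilon>"
      then show "w \<in> ball z (r z / 2)"
        using z(2) \<epsilon>[OF z(1)] dist_triangle[of z w y] by simp
    qed
    then show ?thesis using z \<epsilon> r Z(1) by (intro bexI[of _ z] exI[of _ "r z"]) auto
  qed
  then show ?thesis
    using Y \<open>\<epsilon> > 0\<close> unfolding null_def by (intro exI[of _ Y] exI[of _ \<epsilon>]) simp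
qed

section \<open>Transport along jumping-paths, and surjectivity of the holonomy onto
  \<open>N\<close>\<close>

context coset_bundle
begin

text \<open>Every link starts at the initial point, so that \<open>close\<close> supplies the
  distance bound of \<open>linked_trans\<close>. Jumps by inverse maps are covered by the symmetry
  of \<open>linked\<close>.\<close>

lemma linked_along_jumping_path:
  assumes P: "subgroup P G" "P \<subseteq> N" and \<sigma>: "\<And>x. x \<in> X \<Longrightarrow> \<sigma> x \<in> q x"
    and small: "e > 0" "\<And>x y. \<lbrakk>x \<in> X; y \<in> X; dist x y < e\<rbrakk> \<Longrightarrow> linked P \<sigma> x y"
    and jump: "\<And>s x. \<lbrakk>s \<in> S; x \<in> X\<rbrakk> \<Longrightarrow> linked P \<sigma> x (s x)" and S: "\<And>s. s \<in> S \<Longrightarrow> s ` X = X"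
    and jp: "jumping_path X S n \<gamma> \<tau>"
    and close: "\<And>i u. \<lbrakk>i \<le> n; u \<in> {0..1}\<rbrakk> \<Longrightarrow> \<delta> (pathstart (\<gamma> 0)) (\<gamma> i u) \<le> D"
  shows "linked P \<sigma> (pathstart (\<gamma> 0)) (pathfinish (\<gamma> n))"
proof -
  let ?x = "pathstart (\<gamma> 0)"
  note X = jumping_path_in_space[OF jp]
  have x: "?x \<in> X" using X[of 0 0] by (simp add: pathstart_def)
  have along: "linked P \<sigma> ?x (\<gamma> i u)" if i: "i \<le> n" "linked P \<sigma> ?x (\<gamma> i 0)" and u: "u \<in> {0..1}" for i u
  proof -
    have "uniformly_continuous_on {0..1} (\<gamma> i)"
      using jp i(1) unfolding jumping_path_def path_def
      by (meson compact_Icc compact_uniformly_continuous)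
    then obtain d where d: "d > 0" "\<And>u v. \<lbrakk>u \<in> {0..1}; v \<in> {0..1}; dist u v < d\<rbrakk> \<Longrightarrow> dist (\<gamma> i u) (\<gamma> i v) < e"
      using small(1) unfolding uniformly_continuous_on_def by (metis dist_commute)
    show ?thesis
    proof (rule metric_connected_induct[of "{0..1}" 0 u "\<lambda>u. linked P \<sigma> ?x (\<gamma> i u)" d])
      fix u v :: real
      assume uv: "u \<in> {0..1}" "v \<in> {0..1}" "dist u v < d" "linked P \<sigma> ?x (\<gamma> i u)"
      have "linked P \<sigma> (\<gamma> i u) (\<gamma> i v)"
        by (rule small(2)[OF X[OF i(1) uv(1)] X[OF i(1) uv(2)] d(2)[OF uv(1-3)]])
      then show "linked P \<sigma> ?x (\<gamma> i v)"
        using linked_trans[OF P \<sigma> x X[OF i(1) uv(1)] X[OF i(1) uv(2)] close[OF i(1) uv(2)] uv(4)]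
        by blast
    qed (use i u d in auto)
  qed
  have "linked P \<sigma> ?x (\<gamma> i 0)" if "i \<le> n" for i using that
  proof (induction i)
    case 0
    show ?case using small(2)[OF x x] small(1) by (simp add: pathstart_def)
  next
    case (Suc i)
    then have i: "\<gamma> i 1 \<in> X" "\<gamma> (Suc i) 0 \<in> X" "linked P \<sigma> ?x (\<gamma> i 1)"
      using X along[of i 1] by auto
    note j = jumping_path_jump[OF jp Suc.prems]
    have l: "linked P \<sigma> (\<gamma> i 1) (\<gamma> (Suc i) 0)"
    proof (cases "\<tau> (Suc i) \<in> S")
      case True
      then show ?thesis using jump i j(2) by simp
    next
      case False
      then obtain s where s: "s \<in> S" "\<tau> (Suc i) = inv_into X s" using j(1) by auto
      have "s (\<gamma> (Suc i) 0) = \<gamma> i 1"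
        using i(1) S[OF s(1)] j(2) s(2) by (simp add: f_inv_into_f)
      then have "linked P \<sigma> (\<gamma> (Suc i) 0) (\<gamma> i 1)" using jump[OF s(1) i(2)] by simp
      then show ?thesis by (rule linked_sym[OF P(1) \<sigma> i(2,1), rotated]) simp_all
    qed
    have "\<delta> ?x (\<gamma> (Suc i) 0) \<le> D" using close Suc by simp
    then show ?case
      using linked_trans[OF P \<sigma> x i(1,2), OF _ _ i(3) l] by blast
  qed
  then show ?thesis using along[of n 1] by (simp add: pathfinish_def)
qed

text \<open>The map \<open>\<psi>\<close> compares \<open>G\<close>, as the covering of
  \<open>G Mod N\<close>, with the bundle pulled back along \<open>F\<close>. That
  \<open>\<psi> w\<close> equals \<open>\<sigma> (F w)\<close> up to \<open>P\<close> and a fixed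
  offset spreads along the generators to all of \<open>G\<close>. On \<open>N\<close> the map
  \<open>F\<close> is constant and \<open>\<psi>\<close> is equivariant, so there the statement
  reveals that each element of \<open>N\<close> is in \<open>P\<close>.\<close>

lemma holonomy_generates:
  assumes P: "subgroup P G" "P \<subseteq> N" and \<sigma>: "\<And>x. x \<in> X \<Longrightarrow> \<sigma> x \<in> q x"
    and F: "\<And>w. w \<in> carrier G \<Longrightarrow> F w \<in> X" "\<And>n w. \<lbrakk>n \<in> N; w \<in> carrier G\<rbrakk> \<Longrightarrow> F (n \<otimes> w) = F w"
    and \<psi>: "\<And>w. w \<in> carrier G \<Longrightarrow> \<psi> w \<in> q (F w)" "\<And>w. w \<in> carrier G \<Longrightarrow> near w (\<psi> w)"
    and T: "T \<subseteq> carrier G" "generate G T = carrier G"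
    and \<psi>T: "\<And>w s. \<lbrakk>w \<in> carrier G; s \<in> T\<rbrakk> \<Longrightarrow> near (\<psi> w) (\<psi> (w \<otimes> s))"
    and link: "\<And>w s. \<lbrakk>w \<in> carrier G; s \<in> T\<rbrakk> \<Longrightarrow> linked P \<sigma> (F w) (F (w \<otimes> s))"
  shows "P = N"
proof -
  note PG = subgroup.mem_carrier[OF P(1)]
  have \<psi>c: "\<psi> w \<in> carrier G" and \<sigma>c: "\<sigma> (F w) \<in> carrier G" if "w \<in> carrier G" for w
    using fibre_carrier[OF F(1) \<psi>(1)] fibre_carrier[OF F(1) \<sigma>[OF F(1)]] that by blast+
  define c where "c = \<psi> \<one> \<otimes> inv (\<sigma> (F \<one>))"
  have cN: "c \<in> N"
    using fibre_quotient[OF F(1) \<psi>(1) \<sigma>[OF F(1)]] by (simp add: c_def)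
  then have cG: "c \<in> carrier G" by (rule mem_carrier)
  define Q where "Q w \<longleftrightarrow> (\<exists>p\<in>P. \<psi> w = c \<otimes> p \<otimes> \<sigma> (F w))" for w
  have step_Q: "Q w'" if w: "w \<in> carrier G" "w' \<in> carrier G" "near (\<psi> w) (\<psi> w')"
      "linked P \<sigma> (F w) (F w')" "Q w" for w w'
  proof -
    obtain p where p: "p \<in> P" "\<psi> w = c \<otimes> p \<otimes> \<sigma> (F w)" using w(5) by (auto simp: Q_def)
    obtain p' where p': "p' \<in> P" "near (\<sigma> (F w)) (p' \<otimes> \<sigma> (F w'))" using w(4) by (auto simp: linked_def)
    have pp': "p \<otimes> p' \<in> P" using p p' subgroup.m_closed[OF P(1)] by blast
    have "near (c \<otimes> p \<otimes> \<sigma> (F w)) (c \<otimes> p \<otimes> (p' \<otimes> \<sigma> (F w')))"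
      using p' p PG cG w \<sigma>c by (subst near_translate) auto
    then have "near (\<psi> w) (c \<otimes> (p \<otimes> p') \<otimes> \<sigma> (F w'))"
      using p p' PG cG w \<sigma>c by (simp add: m_assoc)
    moreover have "c \<otimes> (p \<otimes> p') \<otimes> \<sigma> (F w') \<in> q (F w')"
      using fibre_translate[OF F(1) \<sigma>[OF F(1)]] w pp' P(2) cN by blast
    ultimately have "\<psi> w' = c \<otimes> (p \<otimes> p') \<otimes> \<sigma> (F w')"
      using near_unique[OF F(1)[OF w(2)] \<psi>(1)[OF w(2)] _ \<psi>c[OF w(1)] w(3)] by blast
    then show ?thesis using pp' by (auto simp: Q_def)
  qed
  have Q_T: "Q w \<longleftrightarrow> Q (w \<otimes> s)" if "w \<in> carrier G" "s \<in> T" for w s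
  proof -
    have ws: "w \<otimes> s \<in> carrier G" using that T(1) by blast
    have "linked P \<sigma> (F (w \<otimes> s)) (F w)"
      by (rule linked_sym[OF P(1) \<sigma> F(1) F(1) link]) (use that ws in auto)
    then show ?thesis
      using step_Q[OF that(1) ws \<psi>T[OF that] link[OF that]]
        step_Q[OF ws that(1) near_sym[OF \<psi>T[OF that] \<psi>c \<psi>c]] that ws by blast
  qed
  have Q_gen: "\<forall>w\<in>carrier G. Q w \<longleftrightarrow> Q (w \<otimes> g)" if "g \<in> generate G T" for g
    using that
  proof (induction g rule: generate.induct)
    case (inv h)
    show ?case
    proof
      fix w assume w: "w \<in> carrier G"
      have h: "h \<in> carrier G" using inv T(1) by blast
      then show "Q w \<longleftrightarrow> Q (w \<otimes> inv h)"
        using Q_T[of "w \<otimes> inv h" h] w inv by (simp add: m_assoc)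
    qed
  next
    case (eng h1 h2)
    have h: "h1 \<in> carrier G" "h2 \<in> carrier G" using eng.hyps T(2) by blast+
    show ?case
    proof
      fix w assume w: "w \<in> carrier G"
      have "Q w \<longleftrightarrow> Q (w \<otimes> h1)" using eng.IH(1) w by blast
      also have "\<dots> \<longleftrightarrow> Q (w \<otimes> h1 \<otimes> h2)" using eng.IH(2) w h by blast
      finally show "Q w \<longleftrightarrow> Q (w \<otimes> (h1 \<otimes> h2))" using w h by (simp only: m_assoc)
    qed
  next
    case (incl h)
    then show ?case using Q_T by blast
  qed simp
  have "Q \<one>"
    using \<psi>c \<sigma>c subgroup.one_closed[OF P(1)] unfolding Q_def c_def
    by (intro bexI[of _ \<one>]) (simp_all add: m_assoc)
  have "n \<in> P" if n: "n \<in> N" for n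
  proof -
    \<comment> \<open>Conjugation by \<open>c\<close> cancels the offset at the base point:
      \<open>m \<otimes> \<psi> \<one>\<close> becomes
      \<open>c \<otimes> n \<otimes> \<sigma> (F \<one>)\<close>, to be compared with
      \<open>c \<otimes> p \<otimes> \<sigma> (F \<one>)\<close>.\<close>
    define m where "m = c \<otimes> n \<otimes> inv c"
    have m: "m \<in> N" "m \<in> carrier G" "n \<in> carrier G"
      using inv_op_closed2[OF cG n] n mem_carrier by (simp_all add: m_def)
    have "Q (\<one> \<otimes> m)" using Q_gen \<open>Q \<one>\<close> T(2) m(2) by blast
    then have "Q m" using m(2) by simp
    then obtain p where p: "p \<in> P" "\<psi> m = c \<otimes> p \<otimes> \<sigma> (F \<one>)"
      using F(2)[OF m(1), of \<one>] m by (auto simp: Q_def)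
    have "near m (m \<otimes> \<psi> \<one>)"
      using \<psi>(2)[of \<one>] \<psi>c m near_translate[of m \<one> "\<psi> \<one>"] by simp
    moreover have "m \<otimes> \<psi> \<one> \<in> q (F m)" "\<psi> m \<in> q (F m)"
      using fibre_translate[OF F(1) \<psi>(1) m(1), of \<one>] F(2)[OF m(1), of \<one>] \<psi>(1)[OF m(2)] m by simp_all
    ultimately have "\<psi> m = m \<otimes> \<psi> \<one>"
      using near_unique[OF F(1)[OF m(2)]] \<psi>(2)[OF m(2)] m(2) by blast
    also have "\<psi> \<one> = c \<otimes> \<sigma> (F \<one>)" using \<psi>c \<sigma>c by (simp add: c_def m_assoc)
    finally have "c \<otimes> p \<otimes> \<sigma> (F \<one>) = c \<otimes> n \<otimes> \<sigma> (F \<one>)"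
      using p cG m \<sigma>c by (simp add: m_def m_assoc)
    then have "p = n" using cG m \<sigma>c[OF Group.monoid.one_closed] PG[OF p(1)] by simp
    then show ?thesis using p by simp
  qed
  then show ?thesis using P(2) by blast
qed

end

section \<open>Ranks of the kernels of a box space\<close>

primrec word_ball :: "('g, 'm) monoid_scheme \<Rightarrow> 'g set \<Rightarrow> nat \<Rightarrow> 'g set" where
  "word_ball G T 0 = {\<one>\<^bsub>G\<^esub>}"
| "word_ball G T (Suc n) = word_ball G T n \<union>
     (\<lambda>(w, s). w \<otimes>\<^bsub>G\<^esub> s) ` (word_ball G T n \<times> (T \<union> m_inv G ` T))"

lemma finite_word_ball: "finite T \<Longrightarrow> finite (word_ball G T n)"
  by (induction n) auto

lemma word_ball_mono: "m \<le> n \<Longrightarrow> word_ball G T m \<subseteq> word_ball G T n"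
  by (rule lift_Suc_mono_le[of "word_ball G T"]) auto

lemma one_in_word_ball: "\<one>\<^bsub>G\<^esub> \<in> word_ball G T n"
  using word_ball_mono[of 0 n G T] by auto

context group
begin

lemma word_ball_carrier: "T \<subseteq> carrier G \<Longrightarrow> word_ball G T n \<subseteq> carrier G"
  by (induction n) auto

lemma word_ball_mult:
  assumes "T \<subseteq> carrier G" "a \<in> word_ball G T m" "b \<in> word_ball G T n"
  shows "a \<otimes> b \<in> word_ball G T (m + n)"
  using assms(3)
proof (induction n arbitrary: b)
  case 0
  have "a \<in> carrier G" using assms word_ball_carrier by blast
  then show ?case using 0 assms(2) by simp
next
  case (Suc n)
  have a: "a \<in> carrier G" using assms word_ball_carrier by blast
  from Suc.prems consider "b \<in> word_ball G T n"
    | w s where "w \<in> word_ball G T n" "s \<in> T \<union> m_inv G ` T" "b = w \<otimes> s" by auto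
  then show ?case
  proof cases
    case 1
    then show ?thesis using Suc.IH by simp
  next
    case 2
    have "w \<in> carrier G" "s \<in> carrier G" using 2 assms(1) word_ball_carrier by auto
    then have "a \<otimes> b = (a \<otimes> w) \<otimes> s" using a 2 by (simp add: m_assoc)
    then show ?thesis using Suc.IH[OF 2(1)] 2(2) by force
  qed
qed

lemma word_ball_letter:
  assumes "T \<subseteq> carrier G" "s \<in> T \<union> m_inv G ` T"
  shows "s \<in> word_ball G T 1"
proof -
  have "s \<in> carrier G" using assms by auto
  then have "s = \<one> \<otimes> s" by simp
  then show ?thesis using assms(2) by force
qed

lemma word_ball_inv:
  assumes "T \<subseteq> carrier G" "a \<in> word_ball G T n"
  shows "inv a \<in> word_ball G T n"
  using assms(2)
proof (induction n arbitrary: a)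
  case (Suc n)
  from Suc.prems consider "a \<in> word_ball G T n"
    | w s where "w \<in> word_ball G T n" "s \<in> T \<union> m_inv G ` T" "a = w \<otimes> s" by auto
  then show ?case
  proof cases
    case 1
    then show ?thesis using Suc.IH by simp
  next
    case 2
    have "w \<in> carrier G" "s \<in> carrier G" using 2 assms(1) word_ball_carrier by auto
    then have "inv a = inv s \<otimes> inv w" using 2 by (simp add: inv_mult_group)
    moreover have "inv s \<in> T \<union> m_inv G ` T" using 2(2) assms(1) by auto
    ultimately show ?thesis
      using word_ball_mult[OF assms(1) word_ball_letter[OF assms(1)] Suc.IH[OF 2(1)]] by simp
  qed
qed simp

end

context normal
begin

lemma factor_element_carrier: "C \<in> carrier (G Mod H) \<Longrightarrow> g \<in> C \<Longrightarrow> g \<in> carrier G"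
  unfolding FactGroup_def using rcosets_carrier[OF is_group] by auto

text \<open>Paths in the quotient graph lift to \<open>G\<close> from any chosen element of the
  first coset. Edges are undirected, so an edge may be lifted by an inverse letter.\<close>

lemma coset_path_lift:
  assumes T: "T \<subseteq> carrier G"
    and "(C, C') \<in> cayley_edges (G Mod H) ((\<lambda>s. H #> s) ` T) ^^ n" "C \<in> carrier (G Mod H)" "g \<in> C"
  shows "C' \<in> carrier (G Mod H) \<and> (\<exists>h\<in>C'. inv g \<otimes> h \<in> word_ball G T n)"
  using assms(2)
proof (induction n arbitrary: C')
  case 0
  have "g \<in> carrier G" using assms(3,4) by (rule factor_element_carrier)
  then show ?case using 0 assms(3,4) by (auto intro!: bexI[of _ g])
next
  case (Suc n)
  then obtain C1 where C1: "(C, C1) \<in> cayley_edges (G Mod H) ((\<lambda>s. H #> s) ` T) ^^ n"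
    "(C1, C') \<in> cayley_edges (G Mod H) ((\<lambda>s. H #> s) ` T)" by auto
  then obtain h where h: "C1 \<in> carrier (G Mod H)" "h \<in> C1" "inv g \<otimes> h \<in> word_ball G T n"
    using Suc.IH by blast
  have gh: "g \<in> carrier G" "h \<in> carrier G"
    using assms(3,4) h factor_element_carrier by blast+
  have mul: "(H #> a) <#> (H #> s) = H #> (a \<otimes> s)" if "a \<in> carrier G" "s \<in> T" for a s
    using rcos_sum that T by blast
  obtain a s where as: "a \<in> carrier G" "s \<in> T"
    "C1 = H #> a \<and> C' = H #> (a \<otimes> s) \<or> C1 = H #> (a \<otimes> s) \<and> C' = H #> a"
    using C1(2) mul unfolding cayley_edges_def carrier_FactGroup by fastforce
  have s: "s \<in> carrier G" "a \<otimes> s \<in> carrier G" using as T by auto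
  from as(3) have "\<exists>r\<in>T \<union> m_inv G ` T. h \<otimes> r \<in> C'"
  proof
    assume C: "C1 = H #> a \<and> C' = H #> (a \<otimes> s)"
    then obtain n where "n \<in> H" "h = n \<otimes> a" using h(2) by (auto simp: r_coset_def)
    then have "h \<otimes> s \<in> C'" using C as s mem_carrier by (auto simp: r_coset_def m_assoc)
    then show ?thesis using as by blast
  next
    assume C: "C1 = H #> (a \<otimes> s) \<and> C' = H #> a"
    then obtain n where "n \<in> H" "h = n \<otimes> (a \<otimes> s)" using h(2) by (auto simp: r_coset_def)
    then have "h \<otimes> inv s \<in> C'" using C as s mem_carrier by (auto simp: r_coset_def m_assoc)
    then show ?thesis using as by blast
  qed
  then obtain r where r: "r \<in> T \<union> m_inv G ` T" "h \<otimes> r \<in> C'" by blast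
  have "r \<in> carrier G" using r T by auto
  then have "inv g \<otimes> (h \<otimes> r) = (inv g \<otimes> h) \<otimes> r" using gh by (simp add: m_assoc)
  then have "inv g \<otimes> (h \<otimes> r) \<in> word_ball G T (Suc n)" using h(3) r(1) by force
  moreover have "C' \<in> carrier (G Mod H)" using as s by (auto simp: carrier_FactGroup)
  ultimately show ?case using r(2) by blast
qed

lemma generator_edge:
  assumes "T \<subseteq> carrier G" "g \<in> carrier G" "s \<in> T"
  shows "(H #> g, H #> (g \<otimes> s)) \<in> cayley_edges (G Mod H) ((\<lambda>s. H #> s) ` T)"
    "(H #> (g \<otimes> s), H #> g) \<in> cayley_edges (G Mod H) ((\<lambda>s. H #> s) ` T)"
proof -
  have "H #> (g \<otimes> s) = (H #> g) <#> (H #> s)" using rcos_sum assms by (metis subsetD)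
  then show "(H #> g, H #> (g \<otimes> s)) \<in> cayley_edges (G Mod H) ((\<lambda>s. H #> s) ` T)"
    "(H #> (g \<otimes> s), H #> g) \<in> cayley_edges (G Mod H) ((\<lambda>s. H #> s) ` T)"
    using assms by (auto simp: cayley_edges_def carrier_FactGroup)
qed

lemma quotient_cayley_dist_generator:
  assumes "T \<subseteq> carrier G" "g \<in> carrier G" "s \<in> T"
  shows "quotient_cayley_dist G T H (H #> g) (H #> (g \<otimes> s)) \<le> 1"
proof -
  have "(LEAST n. (H #> g, H #> (g \<otimes> s)) \<in> cayley_edges (G Mod H) ((\<lambda>s. H #> s) ` T) ^^ n) \<le> 1"
    by (rule Least_le) (use generator_edge(1)[OF assms] in simp)
  then show ?thesis unfolding quotient_cayley_dist_def graph_dist_def by simp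
qed

lemma cosets_connected:
  assumes T: "T \<subseteq> carrier G" and "w \<in> generate G T" "g \<in> carrier G"
  shows "(H #> g, H #> (g \<otimes> w)) \<in> (cayley_edges (G Mod H) ((\<lambda>s. H #> s) ` T))\<^sup>*"
  using assms(2,3)
proof (induction w arbitrary: g rule: generate.induct)
  case one
  then show ?case by simp
next
  case (incl h)
  then show ?case using generator_edge(1)[OF T] by blast
next
  case (inv h)
  then have "h \<in> carrier G" using T by blast
  then show ?case
    using generator_edge(2)[OF T, of "g \<otimes> inv h" h] inv by (auto simp: m_assoc)
next
  case (eng h1 h2)
  have h: "h1 \<in> carrier G" "h2 \<in> carrier G"
    using eng.hyps generate_incl[OF T] by blast+
  have "(H #> g, H #> (g \<otimes> h1 \<otimes> h2)) \<in> (cayley_edges (G Mod H) ((\<lambda>s. H #> s) ` T))\<^sup>*"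
    using eng.IH(1)[OF eng.prems] eng.IH(2)[of "g \<otimes> h1"] h eng.prems by auto
  then show ?case using h eng.prems by (simp add: m_assoc)
qed

text \<open>\<open>graph_dist\<close> is a \<open>LEAST\<close>, which is attained only if some path
  exists; connectedness of the quotient graph, from \<open>T\<close> generating \<open>G\<close>,
  has to come first.\<close>

lemma quotient_cayley_dist_word:
  assumes T: "T \<subseteq> carrier G" "generate G T = carrier G"
    and C: "C \<in> carrier (G Mod H)" "C' \<in> carrier (G Mod H)" "g \<in> C"
    and R: "quotient_cayley_dist G T H C C' \<le> real R"
  shows "\<exists>h\<in>C'. inv g \<otimes> h \<in> word_ball G T R"
proof -
  let ?E = "cayley_edges (G Mod H) ((\<lambda>s. H #> s) ` T)"
  obtain a b where ab: "a \<in> carrier G" "C = H #> a" "b \<in> carrier G" "C' = H #> b"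
    using C by (auto simp: carrier_FactGroup)
  have "inv a \<otimes> b \<in> generate G T" using T(2) ab by simp
  then have "(C, C') \<in> ?E\<^sup>*" using cosets_connected[OF T(1), of "inv a \<otimes> b" a] ab by simp
  then obtain n where "(C, C') \<in> ?E ^^ n" using rtrancl_imp_relpow by blast
  then have "(C, C') \<in> ?E ^^ (LEAST n. (C, C') \<in> ?E ^^ n)" by (rule LeastI)
  moreover have "(LEAST n. (C, C') \<in> ?E ^^ n) \<le> R"
    using R unfolding quotient_cayley_dist_def graph_dist_def by simp
  ultimately show ?thesis using coset_path_lift[OF T(1) _ C(1,3)] word_ball_mono[of _ R G T] by blast
qed

end

section \<open>The rank bound at a single level\<close>

lemma warped_systemD:
  assumes "warped_system X S"
  shows "finite S" "\<And>s. s \<in> S \<Longrightarrow> continuous_on X s" "\<And>s. s \<in> S \<Longrightarrow> s ` X = X"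
    "compact X" "connected X"
proof -
  have *: "finite S \<and> (\<forall>s\<in>S. \<exists>s'. homeomorphism X X s s') \<and> compact X \<and> path_connected X"
    using assms by (simp add: warped_system_def)
  then show "finite S" "compact X" "connected X" by (auto intro: path_connected_imp_connected)
  show "continuous_on X s" "s ` X = X" if "s \<in> S" for s
    using * that by (meson homeomorphism_def)+
qed

text \<open>A coarse inverse of the quasi-isometry serves as the bundle: the fibre over
  \<open>x\<close> is a coset of \<open>N\<close> whose image lies within \<open>A\<close> of
  \<open>x\<close>. The number of generators involves only the net and \<open>S\<close>, neither of
  which depends on \<open>N\<close> or \<open>t\<close>.\<close>

lemma finite_rank_of_quasi_isometry:
  fixes G :: "('g, 'm) monoid_scheme" (structure) and X :: "'x::metric_space set"
  assumes "N \<lhd> G" and T: "finite_generating_set G T"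
    and X: "warped_system X S" "jumping_geodesic X S t"
    and Y: "finite Y" "Y \<subseteq> X" "0 < \<epsilon>" "X \<subseteq> (\<Union>y\<in>Y. ball y (\<epsilon> / 4))"
      "\<forall>y\<in>Y. \<exists>z\<in>X. \<exists>r. 4 * \<epsilon> \<le> r \<and> ball y \<epsilon> \<subseteq> ball z (r / 2) \<and>
        (\<forall>\<gamma>. path \<gamma> \<and> path_image \<gamma> \<subseteq> X \<inter> ball z r \<and> pathstart \<gamma> = z \<and> pathfinish \<gamma> = z \<longrightarrow>
          homotopic_paths X \<gamma> (\<lambda>_. z))"
    and t: "0 < t" "1 / t \<le> \<epsilon> / 4"
    and L: "1 \<le> L" "0 \<le> A"
      "quasi_isometric L A (carrier (G Mod N)) (quotient_cayley_dist G T N) X (warped_dist X S t)"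
    and R: "R = nat \<lceil>L * (L + 4 * A + 2)\<rceil>" "word_ball G T (9 * R) \<inter> N \<subseteq> {\<one>}"
  shows "\<exists>A. finite A \<and> card A \<le> card Y * card Y + card S \<and> A \<subseteq> N \<and> generate G A = N"
proof -
  interpret normal N G by fact
  let ?\<delta> = "warped_dist X S t" and ?Q = "carrier (G Mod N)" and ?d = "quotient_cayley_dist G T N"
  have T: "finite T" "T \<subseteq> carrier G" "generate G T = carrier G"
    using T by (auto simp: finite_generating_set_def)
  have cand: "?\<delta> \<in> warped_candidates X S t" by (rule warped_dist_in_candidates[OF t(1)])
  then have metric: "Metric_space X ?\<delta>" and tdist: "\<And>x y. \<lbrakk>x \<in> X; y \<in> X\<rbrakk> \<Longrightarrow> ?\<delta> x y \<le> t * dist x y"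
    and jump1: "\<And>s x. \<lbrakk>s \<in> S; x \<in> X\<rbrakk> \<Longrightarrow> ?\<delta> x (s x) \<le> 1"
    unfolding warped_candidates_def mem_Collect_eq by blast+
  interpret MS: Metric_space X ?\<delta> by (rule metric)
  note S = warped_systemD(1-3)[OF X(1)]
  have Xtop: "compact X" "connected X" "geodesic_space X"
    using warped_systemD(4,5)[OF X(1)] X(2) by (simp_all add: jumping_geodesic_def)
  obtain f where f: "f \<in> ?Q \<rightarrow> X"
    "\<And>x y. \<lbrakk>x \<in> ?Q; y \<in> ?Q\<rbrakk> \<Longrightarrow> ?d x y / L - A \<le> ?\<delta> (f x) (f y)"
    "\<And>x y. \<lbrakk>x \<in> ?Q; y \<in> ?Q\<rbrakk> \<Longrightarrow> ?\<delta> (f x) (f y) \<le> L * ?d x y + A"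
    "\<And>w. w \<in> X \<Longrightarrow> \<exists>x\<in>?Q. ?\<delta> (f x) w \<le> A"
    using L(3) unfolding quasi_isometric_def by blast
  obtain q where q: "\<And>x. x \<in> X \<Longrightarrow> q x \<in> ?Q \<and> ?\<delta> (f (q x)) x \<le> A" using f(4) by metis
  \<comment> \<open>\<open>L + A\<close> bounds how far \<open>f\<close> separates the ends of an
    edge, and the summand 2 provides what \<open>holonomy_generators\<close> asks of
    \<open>D\<close>.\<close>
  define D where "D = L + A + 2"
  have D2: "2 \<le> D" using L by (simp add: D_def)
  have fX: "f C \<in> X" if "C \<in> ?Q" for C using f(1) that by blast
  \<comment> \<open>Replacing two points by images of their fibres costs \<open>2 * A\<close>.
    Undoing the quasi-isometry costs another \<open>A\<close> and the factor \<open>L\<close>, which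
    explains the value of \<open>R\<close>.\<close>
  have d_le: "?d C C' \<le> real R" if "C \<in> ?Q" "C' \<in> ?Q" "?\<delta> (f C) (f C') \<le> D + 2 * A" for C C'
  proof -
    have "?d C C' / L \<le> L + 4 * A + 2" using f(2)[OF that(1,2)] that(3) by (simp add: D_def)
    then have "?d C C' \<le> L * (L + 4 * A + 2)" using L(1) by (simp add: field_simps)
    also have "\<dots> \<le> real R" unfolding R(1) by (rule real_nat_ceiling_ge)
    finally show ?thesis .
  qed
  have "1 * 1 \<le> L * (L + 4 * A + 2)" using L by (intro mult_mono) auto
  then have R1: "1 \<le> R" unfolding R(1) by (simp add: le_nat_iff)
  \<comment> \<open>A word of length \<open>R\<close> would suffice for \<open>step\<close>, but
    \<open>near_\<psi>\<close> needs a product of three such words. Three elements of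
    \<open>B\<close> then have length at most \<open>9 * R\<close>, the radius on which
    \<open>N\<close> is assumed trivial.\<close>
  define B where "B = word_ball G T (3 * R)"
  have B_carrier: "B \<subseteq> carrier G" unfolding B_def by (rule word_ball_carrier[OF T(2)])
  have R_B: "word_ball G T R \<subseteq> B" unfolding B_def by (rule word_ball_mono) simp
  interpret coset_bundle N G X ?\<delta> D q B
  proof unfold_locales
    show "q x \<in> rcosets N" if "x \<in> X" for x using q[OF that] by (simp add: FactGroup_def)
    show "\<exists>h\<in>q y. inv g \<otimes> h \<in> B" if xy: "x \<in> X" "y \<in> X" "?\<delta> x y \<le> D" "g \<in> q x" for x y g
    proof -
      have "?\<delta> (f (q x)) (f (q y)) \<le> ?\<delta> (f (q x)) x + (?\<delta> x y + ?\<delta> (f (q y)) y)"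
        using MS.triangle[of "f (q x)" x "f (q y)"] MS.triangle[of x y "f (q y)"] q xy fX MS.commute
        by (smt (verit))
      then have "?d (q x) (q y) \<le> real R" using d_le q[OF xy(1)] q[OF xy(2)] xy(3) by simp
      then show ?thesis
        using quotient_cayley_dist_word[OF T(2,3), of "q x" "q y" g R] q xy R_B by blast
    qed
    show "a \<otimes> b \<otimes> c = \<one>" if "a \<in> B" "b \<in> B" "c \<in> B" "a \<otimes> b \<otimes> c \<in> N" for a b c
    proof -
      have "a \<otimes> b \<otimes> c \<in> word_ball G T (3 * R + 3 * R + 3 * R)"
        using that unfolding B_def by (intro word_ball_mult[OF T(2)])
      then show ?thesis using R(2) that(4) by auto
    qed
    show "B \<subseteq> carrier G" by (rule B_carrier)
    show "\<one> \<in> B" unfolding B_def by (rule one_in_word_ball)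
    show "inv b \<in> B" if "b \<in> B" for b
      using word_ball_inv[OF T(2)] that unfolding B_def .
  qed
  have adj: "?\<delta> x y \<le> D" if "x \<in> X" "y \<in> X" "dist x y < 1 / t" for x y
  proof -
    have "?\<delta> x y \<le> 1" by (rule small_adjacent[OF t(1) tdist that])
    then show ?thesis using D2 by linarith
  qed
  have sec: "\<exists>b. section_on (1 / t) (X \<inter> ball y \<epsilon>) b" if y: "y \<in> Y" for y
  proof -
    obtain z r where z: "z \<in> X" "4 * \<epsilon> \<le> r" "ball y \<epsilon> \<subseteq> ball z (r / 2)"
      and null_all: "\<forall>\<gamma>. path \<gamma> \<and> path_image \<gamma> \<subseteq> X \<inter> ball z r \<and> pathstart \<gamma> = z \<and>
        pathfinish \<gamma> = z \<longrightarrow> homotopic_paths X \<gamma> (\<lambda>_. z)"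
      by (rule bexE[OF bspec[OF Y(5) y]]) (elim exE conjE, rule that)
    have null: "homotopic_paths X \<gamma> (\<lambda>_. z)"
      if "path \<gamma>" "path_image \<gamma> \<subseteq> X \<inter> ball z r" "pathstart \<gamma> = z" "pathfinish \<gamma> = z" for \<gamma>
      by (rule null_all[rule_format]) (intro conjI that)
    obtain g where g: "g \<in> q z" using fibre_nonempty[OF z(1)] by blast
    have "0 < 1 / t" "1 / t \<le> r / 2" using t z(2) Y(3) by auto
    from local_section[OF Xtop(3) z(1) g null this adj]
    obtain b where "section_on (1 / t) (X \<inter> ball z (r / 2)) b" by blast
    then have "section_on (1 / t) (X \<inter> ball y \<epsilon>) b"
      by (rule section_on_subset) (use z(3) in blast)
    then show ?thesis by blast
  qed
  have cont: "continuous_on X s \<and> s ` X \<subseteq> X" if "s \<in> S" for s using S(2,3) that by simp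
  obtain A' \<sigma> where A': "finite A'" "card A' \<le> card Y * card Y + card S" "A' \<subseteq> N"
    and \<sigma>: "\<And>x. x \<in> X \<Longrightarrow> \<sigma> x \<in> q x"
    and small: "\<And>x y. \<lbrakk>x \<in> X; y \<in> X; dist x y < 1 / t\<rbrakk> \<Longrightarrow> linked (generate G A') \<sigma> x y"
    and jump: "\<And>s x. \<lbrakk>s \<in> S; x \<in> X\<rbrakk> \<Longrightarrow> linked (generate G A') \<sigma> x (s x)"
  proof -
    have H: "\<exists>A \<sigma>. finite A \<and> card A \<le> card Y * card Y + card S \<and> A \<subseteq> N \<and> (\<forall>x\<in>X. \<sigma> x \<in> q x) \<and>
      (\<forall>x\<in>X. \<forall>y\<in>X. dist x y < 1 / t \<longrightarrow> linked (generate G A) \<sigma> x y) \<and>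
      (\<forall>x\<in>X. \<forall>s\<in>S. linked (generate G A) \<sigma> x (s x))"
      by (rule holonomy_generators[where \<epsilon> = \<epsilon>]; fact Xtop D2 t tdist S(1) cont jump1 Y sec)
    show ?thesis by (rule exE[OF H]) (elim exE conjE, rule that, auto)
  qed
  let ?P = "generate G A'"
  have P: "subgroup ?P G" "?P \<subseteq> N"
    using generate_is_subgroup generate_subgroup_incl[OF A'(3) is_subgroup] A'(3) subset by blast+
  have link: "linked ?P \<sigma> x y" if xy: "x \<in> X" "y \<in> X" "?\<delta> x y \<le> D" for x y
  proof -
    obtain n \<gamma> \<tau> where g: "jumping_path X S n \<gamma> \<tau>" "pathstart (\<gamma> 0) = x" "pathfinish (\<gamma> n) = y"
      "jumping_length t n \<gamma> = ennreal (?\<delta> x y)"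
      using X(2) xy unfolding jumping_geodesic_def by blast
    have "?\<delta> (pathstart (\<gamma> 0)) (\<gamma> i u) \<le> ?\<delta> x y" if "i \<le> n" "u \<in> {0..1}" for i u
      by (rule jumping_geodesic_stays_close[where X = X and S = S and n = n and \<tau> = \<tau> and t = t];
          fact metric t tdist jump1 S(3) g MS.nonneg that)
    then have close: "?\<delta> (pathstart (\<gamma> 0)) (\<gamma> i u) \<le> D" if "i \<le> n" "u \<in> {0..1}" for i u
      using that xy(3) by fastforce
    have "0 < 1 / t" using t by simp
    have "linked ?P \<sigma> (pathstart (\<gamma> 0)) (pathfinish (\<gamma> n))"
      by (rule linked_along_jumping_path[where S = S and \<tau> = \<tau> and e = "1 / t"];
          fact P \<sigma> \<open>0 < 1 / t\<close> small jump S(3) g(1) close)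
    then show ?thesis using g(2,3) by simp
  qed
  define F where "F w = f (N #> w)" for w
  have coset: "N #> w \<in> ?Q" if "w \<in> carrier G" for w using that by (auto simp: carrier_FactGroup)
  have F: "F w \<in> X" if "w \<in> carrier G" for w using fX coset that by (simp add: F_def)
  have F_inv: "F (n \<otimes> w) = F w" if "n \<in> N" "w \<in> carrier G" for n w
    using that coset_join2[of n N] mem_carrier is_subgroup subset
    by (simp add: F_def flip: coset_mult_assoc)
  \<comment> \<open>The coset \<open>q (F w)\<close> may differ from \<open>N #> w\<close>, because
    \<open>q\<close> inverts \<open>f\<close> only coarsely; it is nevertheless within
    \<open>R\<close> of it.\<close>
  have "\<exists>h. h \<in> q (F w) \<and> inv w \<otimes> h \<in> word_ball G T R" if w: "w \<in> carrier G" for w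
  proof -
    have "?\<delta> (f (N #> w)) (f (q (F w))) \<le> A"
      using q[OF F[OF w]] MS.commute by (simp add: F_def)
    then have "?d (N #> w) (q (F w)) \<le> real R"
      using D2 L(2) by (intro d_le coset w) (use q[OF F[OF w]] in auto)
    then show ?thesis
      using quotient_cayley_dist_word[OF T(2,3) coset[OF w] _ rcos_self[OF w is_subgroup]]
        q[OF F[OF w]] by blast
  qed
  then obtain \<psi> where \<psi>: "\<And>w. w \<in> carrier G \<Longrightarrow> \<psi> w \<in> q (F w)"
    "\<And>w. w \<in> carrier G \<Longrightarrow> inv w \<otimes> \<psi> w \<in> word_ball G T R" by metis
  have near_\<psi>: "near (\<psi> w) (\<psi> (w \<otimes> s))" if w: "w \<in> carrier G" and s: "s \<in> T" for w s
  proof -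
    have c: "s \<in> carrier G" "w \<otimes> s \<in> carrier G" using w s T(2) by auto
    have \<psi>c: "\<psi> w \<in> carrier G" "\<psi> (w \<otimes> s) \<in> carrier G"
      using fibre_carrier[OF F \<psi>(1)] w c by blast+
    have 1: "inv (\<psi> w) \<otimes> w \<in> word_ball G T R"
      using word_ball_inv[OF T(2) \<psi>(2)[OF w]] w \<psi>c by (simp add: inv_mult_group)
    have "s \<in> word_ball G T R"
      using word_ball_letter[OF T(2)] s word_ball_mono[OF R1, of G T] by blast
    then have "(inv (\<psi> w) \<otimes> w) \<otimes> s \<otimes> (inv (w \<otimes> s) \<otimes> \<psi> (w \<otimes> s)) \<in> word_ball G T (R + R + R)"
      by (intro word_ball_mult[OF T(2)] 1 \<psi>(2) c)
    moreover have "(inv (\<psi> w) \<otimes> w) \<otimes> s \<otimes> (inv (w \<otimes> s) \<otimes> \<psi> (w \<otimes> s)) = inv (\<psi> w) \<otimes> \<psi> (w \<otimes> s)"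
      using w c \<psi>c by (simp add: m_assoc inv_mult_group)
    moreover have "3 * R = R + R + R" by simp
    ultimately have "inv (\<psi> w) \<otimes> \<psi> (w \<otimes> s) \<in> B" by (simp only: B_def)
    then show ?thesis by (simp only: near_def)
  qed
  have "?P = N"
  proof (rule holonomy_generates[where \<sigma> = \<sigma> and F = F and \<psi> = \<psi> and T = T])
    show "near w (\<psi> w)" if "w \<in> carrier G" for w
      using \<psi>(2)[OF that] R_B by (auto simp: near_def)
    fix w s assume w: "w \<in> carrier G" and s: "s \<in> T"
    then have ws: "w \<otimes> s \<in> carrier G" using T(2) by blast
    have "?\<delta> (F w) (F (w \<otimes> s)) \<le> L * ?d (N #> w) (N #> (w \<otimes> s)) + A"
      unfolding F_def by (intro f(3) coset w ws)
    also have "\<dots> \<le> L * 1 + A"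
      using quotient_cayley_dist_generator[OF T(2) w s] L(1) by (intro add_mono mult_left_mono) auto
    finally show "linked ?P \<sigma> (F w) (F (w \<otimes> s))"
      using F w ws by (intro link) (auto simp: D_def)
  qed (fact P \<sigma> F F_inv \<psi>(1) T(2,3) near_\<psi>)+
  then show ?thesis using A' by blast
qed

section \<open>Schreier generators and the rank gradient\<close>

context group
begin

lemma rcos_eq_iff:
  assumes "subgroup H G" "a \<in> carrier G" "b \<in> carrier G"
  shows "H #> a = H #> b \<longleftrightarrow> a \<otimes> inv b \<in> H"
  using assms by (metis is_group rcos_self repr_independence subgroup.rcos_module)

text \<open>Products of a representative of \<open>H\<close> in \<open>K\<close> with a
  representative of \<open>K\<close> in \<open>G\<close> lie in distinct cosets of
  \<open>H\<close>.\<close>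

lemma card_cosets_tower:
  assumes H: "subgroup H G" and K: "subgroup K G" and "H \<subseteq> K" and fin: "finite (rcosets H)"
  shows "finite ((\<lambda>k. H #> k) ` K)" "card ((\<lambda>k. H #> k) ` K) * card (rcosets K) \<le> card (rcosets H)"
proof -
  let ?I = "(\<lambda>k. H #> k) ` K"
  note KG = subgroup.mem_carrier[OF K]
  have I_sub: "?I \<subseteq> rcosets H" using KG by (auto simp: RCOSETS_def)
  then show "finite ?I" using fin finite_subset by blast
  have "\<exists>k. k \<in> K \<and> H #> k = C" if "C \<in> ?I" for C using that by blast
  then obtain \<tau> where \<tau>: "\<And>C. C \<in> ?I \<Longrightarrow> \<tau> C \<in> K \<and> H #> \<tau> C = C" by metis
  have "\<exists>a. a \<in> carrier G \<and> K #> a = E" if "E \<in> rcosets K" for E using that by (auto simp: RCOSETS_def)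
  then obtain \<rho> where \<rho>: "\<And>E. E \<in> rcosets K \<Longrightarrow> \<rho> E \<in> carrier G \<and> K #> \<rho> E = E" by metis
  define h where "h = (\<lambda>(C, E). H #> (\<tau> C \<otimes> \<rho> E))"
  have "inj_on h (?I \<times> rcosets K)"
  proof (rule inj_onI)
    fix p p' assume p: "p \<in> ?I \<times> rcosets K" "p' \<in> ?I \<times> rcosets K" "h p = h p'"
    obtain C E C' E' where pp: "p = (C, E)" "p' = (C', E')" by (cases p, cases p')
    with p have *: "C \<in> ?I" "E \<in> rcosets K" "C' \<in> ?I" "E' \<in> rcosets K" "h (C, E) = h (C', E')"
      by blast+
    note t = \<tau>[OF *(1)] \<tau>[OF *(3)] \<rho>[OF *(2)] \<rho>[OF *(4)]
    have c: "\<tau> C \<in> carrier G" "\<tau> C' \<in> carrier G" "\<rho> E \<in> carrier G" "\<rho> E' \<in> carrier G"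
      using t KG by auto
    have "(\<tau> C \<otimes> \<rho> E) \<otimes> inv (\<tau> C' \<otimes> \<rho> E') \<in> H"
      using *(5) rcos_eq_iff[OF H] c by (simp add: h_def)
    then have eq: "\<tau> C \<otimes> (\<rho> E \<otimes> inv (\<rho> E')) \<otimes> inv (\<tau> C') \<in> H"
      using c by (simp add: m_assoc inv_mult_group)
    then have "\<tau> C \<otimes> (\<rho> E \<otimes> inv (\<rho> E')) \<otimes> inv (\<tau> C') \<in> K" using \<open>H \<subseteq> K\<close> by blast
    then have "inv (\<tau> C) \<otimes> (\<tau> C \<otimes> (\<rho> E \<otimes> inv (\<rho> E')) \<otimes> inv (\<tau> C')) \<otimes> \<tau> C' \<in> K"
      using t subgroup.m_closed[OF K] by (simp add: subgroup.m_inv_closed[OF K])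
    then have "\<rho> E \<otimes> inv (\<rho> E') \<in> K" using c by (simp add: m_assoc)
    then have E: "E = E'" using rcos_eq_iff[OF K c(3,4)] t by simp
    then have "\<tau> C \<otimes> inv (\<tau> C') \<in> H" using eq c by simp
    then show "p = p'" unfolding pp using rcos_eq_iff[OF H c(1,2)] t E by simp
  qed
  moreover have "h ` (?I \<times> rcosets K) \<subseteq> rcosets H"
  proof -
    have "h (C, E) \<in> rcosets H" if "C \<in> ?I" "E \<in> rcosets K" for C E
      unfolding h_def prod.case
      by (rule rcosetsI[OF subgroup.subset[OF H] m_closed]) (use \<tau>[OF that(1)] \<rho>[OF that(2)] KG in auto)
    then show ?thesis by blast
  qed
  ultimately have "card (?I \<times> rcosets K) \<le> card (rcosets H)" using card_inj_on_le fin by blast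
  then show "card ?I * card (rcosets K) \<le> card (rcosets H)" by (simp add: card_cartesian_product)
qed

text \<open>Schreier's generators \<open>\<tau>(Hx) a \<tau>(Hxa)\<inverse>\<close>, where \<open>\<tau>\<close> picks coset representatives.\<close>

lemma schreier_generators:
  assumes H: "subgroup H G" and A: "finite A" "A \<subseteq> carrier G" and "H \<subseteq> generate G A"
    and fin: "finite (rcosets H)"
  shows "\<exists>A'. finite A' \<and> A' \<subseteq> carrier G \<and> generate G A' = H \<and>
    card A' * card (rcosets (generate G A)) \<le> card A * card (rcosets H)"
proof -
  define K where "K = generate G A"
  have K: "subgroup K G" unfolding K_def by (rule generate_is_subgroup[OF A(2)])
  note KG = subgroup.mem_carrier[OF K] and HG = subgroup.mem_carrier[OF H]
  note Kc = subgroup.m_closed[OF K] subgroup.m_inv_closed[OF K] subgroup.one_closed[OF K]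
  have HK: "H \<subseteq> K" using assms(4) by (simp add: K_def)
  let ?I = "(\<lambda>k. H #> k) ` K"
  have I: "finite ?I" "card ?I * card (rcosets K) \<le> card (rcosets H)"
    using card_cosets_tower[OF H K HK fin] by auto
  have HI: "H = H #> \<one>" using subgroup.subset[OF H] by simp
  \<comment> \<open>Representing \<open>H\<close> itself by the identity makes \<open>r h\<close>
    trivial for \<open>h \<in> H\<close>; the general formula below then yields \<open>h\<close>
    itself at x = 1.\<close>
  have "\<exists>k. k \<in> K \<and> H #> k = C \<and> (C = H \<longrightarrow> k = \<one>)" if "C \<in> ?I" for C
    using that HI Kc(3) by (cases "C = H") auto
  then obtain \<tau> where \<tau>: "\<And>C. C \<in> ?I \<Longrightarrow> \<tau> C \<in> K \<and> H #> \<tau> C = C \<and> (C = H \<longrightarrow> \<tau> C = \<one>)" by metis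
  define r where "r x = \<tau> (H #> x)" for x
  have r: "r x \<in> K" "H #> r x = H #> x" if "x \<in> K" for x using \<tau>[of "H #> x"] that by (auto simp: r_def)
  have rG: "r x \<in> carrier G" if "x \<in> K" for x using r(1)[OF that] KG by blast
  have r_one: "r h = \<one>" if "h \<in> H" for h
  proof -
    have "H #> h = H" using that HG H by (simp add: coset_join2)
    then show ?thesis using \<tau>[of H] HI Kc(3) by (auto simp: r_def)
  qed
  define g where "g = (\<lambda>(C, a). \<tau> C \<otimes> a \<otimes> inv (r (\<tau> C \<otimes> a)))"
  define A' where "A' = g ` (?I \<times> A)"
  have AK: "a \<in> K" if "a \<in> A" for a using that generate.incl[of a A G] by (simp add: K_def)
  have r_mult: "r (r x \<otimes> k) = r (x \<otimes> k)" if "x \<in> K" "k \<in> K" for x k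
  proof -
    have "H #> (r x \<otimes> k) = (H #> r x) #> k" "H #> (x \<otimes> k) = (H #> x) #> k"
      using that rG KG subgroup.subset[OF H] by (simp_all add: coset_mult_assoc)
    then show ?thesis using r(2)[OF that(1)] by (simp add: r_def)
  qed
  have g_r: "g (H #> x, a) = r x \<otimes> a \<otimes> inv (r (x \<otimes> a))" if "x \<in> K" "a \<in> A" for x a
    using r_mult[OF that(1) AK[OF that(2)]] by (simp add: g_def flip: r_def)
  have A'_H: "A' \<subseteq> H"
  proof -
    have "g (H #> x, a) \<in> H" if x: "x \<in> K" and a: "a \<in> A" for x a
    proof -
      have xa: "x \<otimes> a \<in> K" "r x \<otimes> a \<in> K" using Kc x AK[OF a] r by auto
      have "H #> (r x \<otimes> a) = H #> r (r x \<otimes> a)" using r(2)[OF xa(2)] by simp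
      then have "H #> (r x \<otimes> a) = H #> r (x \<otimes> a)" using r_mult[OF x AK[OF a]] by simp
      then show ?thesis
        using rcos_eq_iff[OF H KG[OF xa(2)] rG[OF xa(1)]] g_r[OF x a] by simp
    qed
    then show ?thesis by (auto simp: A'_def)
  qed
  have A'_G: "A' \<subseteq> carrier G" using A'_H HG by blast
  have "finite A'" using I(1) A(1) by (simp add: A'_def)
  have "card A' \<le> card (?I \<times> A)"
    unfolding A'_def by (rule card_image_le) (use I(1) A(1) in simp)
  then have "card A' * card (rcosets K) \<le> card ?I * card A * card (rcosets K)"
    by (simp add: card_cartesian_product)
  also have "\<dots> = card A * (card ?I * card (rcosets K))" by simp
  also have "\<dots> \<le> card A * card (rcosets H)" using I(2) by (rule mult_le_mono2)
  finally have card: "card A' * card (rcosets K) \<le> card A * card (rcosets H)" .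
  let ?P = "generate G A'"
  have P: "subgroup ?P G" by (rule generate_is_subgroup[OF A'_G])
  \<comment> \<open>The expression is a cocycle in \<open>k\<close>: the middle factors cancel for a
    product. Letting \<open>x\<close> range over all of \<open>K\<close> makes the induction go
    through, and on letters of \<open>A\<close> the expression is a Schreier generator.\<close>
  have main: "k \<in> K \<and> (\<forall>x\<in>K. r x \<otimes> k \<otimes> inv (r (x \<otimes> k)) \<in> ?P)" if "k \<in> generate G A" for k
    using that
  proof (induction k rule: generate.induct)
    case one
    then show ?case
      using Kc(3) rG KG subgroup.one_closed[OF P] by auto
  next
    case (incl a)
    show ?case
    proof (intro conjI ballI)
      show "a \<in> K" by (rule AK[OF incl])
      fix x assume x: "x \<in> K"
      show "r x \<otimes> a \<otimes> inv (r (x \<otimes> a)) \<in> ?P"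
        unfolding g_r[OF x incl, symmetric]
        by (rule generate.incl) (use x incl in \<open>auto simp: A'_def\<close>)
    qed
  next
    case (inv a)
    have a: "a \<in> K" "a \<in> carrier G" using AK[OF inv] KG by auto
    show ?case
    proof (intro conjI ballI)
      show "inv a \<in> K" using a Kc by blast
      fix x assume x: "x \<in> K"
      define y where "y = x \<otimes> inv a"
      have y: "y \<in> K" "y \<otimes> a = x" using a x Kc KG by (auto simp: y_def m_assoc)
      have "r y \<otimes> a \<otimes> inv (r (y \<otimes> a)) \<in> ?P"
        unfolding g_r[OF y(1) inv, symmetric]
        by (rule generate.incl) (use y inv in \<open>auto simp: A'_def\<close>)
      then have "inv (r y \<otimes> a \<otimes> inv (r x)) \<in> ?P"
        using subgroup.m_inv_closed[OF P] y(2) by simp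
      moreover have "inv (r y \<otimes> a \<otimes> inv (r x)) = r x \<otimes> inv a \<otimes> inv (r y)"
        using rG[OF x] rG[OF y(1)] a by (simp add: inv_mult_group m_assoc)
      ultimately show "r x \<otimes> inv a \<otimes> inv (r (x \<otimes> inv a)) \<in> ?P" by (simp add: y_def)
    qed
  next
    case (eng k l)
    have kl: "k \<in> K" "l \<in> K" "k \<in> carrier G" "l \<in> carrier G" using eng.IH KG by auto
    show ?case
    proof (intro conjI ballI)
      show "k \<otimes> l \<in> K" using kl Kc by blast
      fix x assume x: "x \<in> K"
      have xk: "x \<otimes> k \<in> K" "x \<otimes> k \<otimes> l \<in> K" using x kl Kc by blast+
      have "(r x \<otimes> k \<otimes> inv (r (x \<otimes> k))) \<otimes> (r (x \<otimes> k) \<otimes> l \<otimes> inv (r (x \<otimes> k \<otimes> l))) \<in> ?P"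
        by (rule subgroup.m_closed[OF P]) (use eng.IH x xk in blast)+
      then show "r x \<otimes> (k \<otimes> l) \<otimes> inv (r (x \<otimes> (k \<otimes> l))) \<in> ?P"
        using rG[OF x] rG[OF xk(1)] rG[OF xk(2)] kl KG[OF x] by (simp add: m_assoc)
    qed
  qed
  have "h \<in> ?P" if h: "h \<in> H" for h
  proof -
    have "r \<one> \<otimes> h \<otimes> inv (r (\<one> \<otimes> h)) \<in> ?P"
      using main[of h] assms(4) h Kc(3) by blast
    then show ?thesis
      using r_one[OF h] r_one[OF subgroup.one_closed[OF H]] HG[OF h] by simp
  qed
  then have "?P = H" using generate_subgroup_incl[OF A'_H H] by blast
  then show ?thesis using \<open>finite A'\<close> A'_G card unfolding K_def by blast
qed

end

section \<open>Residual filtrations and the vanishing of the rank gradient\<close>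

lemma subgroup_rank_le:
  assumes "finite A" "A \<subseteq> carrier G" "generate G A = H"
  shows "subgroup_rank G H \<le> card A"
  unfolding subgroup_rank_def by (rule Least_le) (use assms in blast)

lemma residual_filtrationD:
  assumes "residual_filtration G N"
  shows "N k \<lhd> G" "finite (rcosets\<^bsub>G\<^esub> N k)" "j \<le> k \<Longrightarrow> N k \<subseteq> N j" "(\<Inter>k. N k) = {\<one>\<^bsub>G\<^esub>}"
proof -
  show "N k \<subseteq> N j" if "j \<le> k"
    by (rule lift_Suc_antimono_le[OF _ that]) (use assms in \<open>simp add: residual_filtration_def\<close>)
qed (use assms in \<open>simp_all add: residual_filtration_def\<close>)

text \<open>Used twice: for a word ball it yields the separation of fibres, and for the quotients of
  a finite set it yields large index.\<close>

lemma residual_filtration_avoids: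
  assumes N: "residual_filtration G N" and "finite E"
  shows "\<exists>k0. \<forall>k\<ge>k0. E \<inter> N k \<subseteq> {\<one>\<^bsub>G\<^esub>}"
  using assms(2)
proof (induction E rule: finite_induct)
  case (insert x E)
  then obtain k0 where k0: "\<And>k. k \<ge> k0 \<Longrightarrow> E \<inter> N k \<subseteq> {\<one>\<^bsub>G\<^esub>}" by blast
  obtain k1 where k1: "x = \<one>\<^bsub>G\<^esub> \<or> x \<notin> N k1"
    using residual_filtrationD(4)[OF N] by blast
  have "insert x E \<inter> N k \<subseteq> {\<one>\<^bsub>G\<^esub>}" if "k \<ge> max k0 k1" for k
    using k0[of k] k1 residual_filtrationD(3)[OF N, of k1 k] that by auto
  then show ?case by blast
qed simp

lemma residual_filtration_index_unbounded:
  fixes G (structure)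
  assumes "group G" "infinite (carrier G)" and N: "residual_filtration G N"
  shows "\<exists>k0. \<forall>k\<ge>k0. M \<le> card (rcosets N k)"
proof -
  interpret group G by fact
  obtain F where F: "F \<subseteq> carrier G" "finite F" "card F = M"
    using infinite_arbitrarily_large[OF assms(2)] by blast
  let ?E = "(\<lambda>(x, y). x \<otimes> inv y) ` (F \<times> F)"
  obtain k0 where k0: "\<And>k. k \<ge> k0 \<Longrightarrow> ?E \<inter> N k \<subseteq> {\<one>}"
    using residual_filtration_avoids[OF N, of ?E] F(2) by blast
  have "M \<le> card (rcosets N k)" if k: "k \<ge> k0" for k
  proof -
    have Nk: "subgroup (N k) G" using residual_filtrationD(1)[OF N] normal_imp_subgroup by blast
    have "inj_on (\<lambda>x. N k #> x) F"
    proof (rule inj_onI)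
      fix x y assume xy: "x \<in> F" "y \<in> F" "N k #> x = N k #> y"
      then have c: "x \<in> carrier G" "y \<in> carrier G" using F(1) by auto
      have "x \<otimes> inv y \<in> N k" using rcos_eq_iff[OF Nk c] xy(3) by simp
      then have "x \<otimes> inv y = \<one>" using k0[OF k] xy by blast
      then have "x \<otimes> inv y \<otimes> y = \<one> \<otimes> y" by simp
      then show "x = y" using c by (simp add: m_assoc)
    qed
    moreover have "(\<lambda>x. N k #> x) ` F \<subseteq> rcosets N k" using F(1) by (auto simp: RCOSETS_def)
    ultimately show ?thesis
      using card_inj_on_le[OF _ _ residual_filtrationD(2)[OF N]] F(3) by blast
  qed
  then show ?thesis by blast
qed

text \<open>A single level j of bounded rank and large index controls all later ones: Schreier's
  count gives rk(N k)/[G : N k] \<le> C/[G : N j].\<close>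

lemma rank_gradient_zero_if_rank_bounded_often:
  fixes G (structure)
  assumes "group G" "infinite (carrier G)" and N: "residual_filtration G N"
    and bounded: "\<And>k0. \<exists>k\<ge>k0. \<exists>A. finite A \<and> card A \<le> C \<and> A \<subseteq> carrier G \<and> generate G A = N k"
  shows "has_rank_gradient G N 0"
proof -
  interpret group G by fact
  let ?i = "\<lambda>k. real (card (rcosets N k))"
  note Nd = residual_filtrationD[OF N]
  have sub: "subgroup (N k) G" for k using Nd(1) normal_imp_subgroup by blast
  have pos: "?i k > 0" for k
    using Nd(2)[of k] subgroup.subgroup_in_rcosets[OF sub is_group] by (auto simp: card_gt_0_iff)
  show ?thesis unfolding has_rank_gradient_def
  proof (rule LIMSEQ_I)
    fix e :: real assume e: "e > 0"
    obtain M :: nat where M: "real M > real C / e" using reals_Archimedean2 by blast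
    obtain k0 where k0: "\<And>k. k \<ge> k0 \<Longrightarrow> M \<le> card (rcosets N k)"
      using residual_filtration_index_unbounded[OF assms(1,2) N] by blast
    obtain j A where j: "j \<ge> k0" and A: "finite A" "card A \<le> C" "A \<subseteq> carrier G" "generate G A = N j"
      using bounded by blast
    have "real C / e < ?i j" using M k0[OF j] by linarith
    then have Cj: "real C / ?i j < e" using e pos[of j] by (simp add: field_simps)
    have "norm (real (subgroup_rank G (N k)) / ?i k - 0) < e" if k: "k \<ge> j" for k
    proof -
      obtain A' where A': "finite A'" "A' \<subseteq> carrier G" "generate G A' = N k"
        "card A' * card (rcosets N j) \<le> card A * card (rcosets N k)"
        using schreier_generators[OF sub A(1,3), of k] A(4) Nd(2,3) k by auto
      have "subgroup_rank G (N k) * card (rcosets N j) \<le> card A' * card (rcosets N j)"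
        by (intro mult_le_mono1 subgroup_rank_le A')
      also have "\<dots> \<le> C * card (rcosets N k)" using A'(4) A(2) by (meson le_trans mult_le_mono1)
      finally have "real (subgroup_rank G (N k)) * ?i j \<le> real C * ?i k"
        by (metis of_nat_le_iff of_nat_mult)
      then have "real (subgroup_rank G (N k)) / ?i k \<le> real C / ?i j"
        using pos[of j] pos[of k] by (simp add: field_simps)
      then show ?thesis using Cj by simp
    qed
    then show "\<exists>no. \<forall>k\<ge>no. norm (real (subgroup_rank G (N k)) / ?i k - 0) < e" by blast
  qed
qed

lemma rank_bounded_often:
  fixes G :: "('g, 'm) monoid_scheme" (structure) and X :: "'x::metric_space set"
  assumes "group G" and T: "finite_generating_set G T" and N: "residual_filtration G N"
    and X: "warped_system X S" and box: "box_space_coarsely_equivalent_to_warped_system G T N X S"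
  shows "\<exists>C. \<forall>k0. \<exists>k\<ge>k0. \<exists>A. finite A \<and> card A \<le> C \<and> A \<subseteq> carrier G \<and> generate G A = N k"
proof -
  from box[unfolded box_space_coarsely_equivalent_to_warped_system_def coarsely_equivalent_def]
  obtain t :: "nat \<Rightarrow> real" and L A where t: "\<forall>k. 1 \<le> t k" "\<not> bdd_above (range t)"
    and L: "1 \<le> L" "0 \<le> A" and qi: "\<forall>k. quasi_isometric L A (carrier (G Mod N k))
      (quotient_cayley_dist G T (N k)) X (warped_dist X S (t k))"
    by (elim exE conjE) (rule that)
  have slsc: "compact X" "semilocally_simply_connected X" using X by (simp_all add: warped_system_def)
  from null_homotopic_net[OF slsc] obtain Y \<epsilon> where Y: "finite Y" "Y \<subseteq> X" "0 < \<epsilon>"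
      "X \<subseteq> (\<Union>y\<in>Y. ball y (\<epsilon> / 4))"
    and Ynull: "\<forall>y\<in>Y. \<exists>z\<in>X. \<exists>r. 4 * \<epsilon> \<le> r \<and> ball y \<epsilon> \<subseteq> ball z (r / 2) \<and>
      (\<forall>\<gamma>. path \<gamma> \<and> path_image \<gamma> \<subseteq> X \<inter> ball z r \<and> pathstart \<gamma> = z \<and> pathfinish \<gamma> = z \<longrightarrow>
        homotopic_paths X \<gamma> (\<lambda>_. z))"
    by (elim exE conjE) (rule that)
  obtain t0 where t0: "\<And>t. t \<ge> t0 \<Longrightarrow> jumping_geodesic X S t"
    using X unfolding warped_system_def eventually_at_top_linorder by blast
  define R where "R = nat \<lceil>L * (L + 4 * A + 2)\<rceil>"
  have "finite (word_ball G T (9 * R))"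
    using T by (simp add: finite_generating_set_def finite_word_ball)
  then obtain k1 where k1: "\<And>k. k \<ge> k1 \<Longrightarrow> word_ball G T (9 * R) \<inter> N k \<subseteq> {\<one>}"
    using residual_filtration_avoids[OF N] by blast
  have "\<exists>k\<ge>k0. \<exists>A. finite A \<and> card A \<le> card Y * card Y + card S \<and> A \<subseteq> carrier G \<and> generate G A = N k" for k0
  proof -
    let ?m = "max k0 k1"
    \<comment> \<open>All other constants are fixed before k. Exceeding the scales up to index
      \<open>?m\<close> as well forces k beyond \<open>?m\<close>, so an unbounded sequence suffices
      where a divergent one might be expected.\<close>
    obtain k where k: "t k > Max (insert (max t0 (4 / \<epsilon>)) (t ` {..?m}))"
      using t(2) unfolding bdd_above_def by (metis linorder_le_less_linear rangeE)
    then have tk: "t k > t0" "t k > 4 / \<epsilon>" "\<And>j. j \<le> ?m \<Longrightarrow> t k > t j" by simp_all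
    have "\<not> k \<le> ?m" using tk(3)[of k] by blast
    then have kbig: "k \<ge> k0" "k \<ge> k1" by simp_all
    have "0 < t k" using t(1)[rule_format, of k] by linarith
    have "1 / t k \<le> \<epsilon> / 4" using tk(2) \<open>0 < t k\<close> Y(3) by (simp add: field_simps)
    have "\<exists>A. finite A \<and> card A \<le> card Y * card Y + card S \<and> A \<subseteq> N k \<and> generate G A = N k"
      by (rule finite_rank_of_quasi_isometry[where t = "t k" and L = L and A = A and \<epsilon> = \<epsilon> and R = R])
        (fact residual_filtrationD(1)[OF N] T X t0[OF less_imp_le[OF tk(1)]] Y Ynull \<open>0 < t k\<close>
          \<open>1 / t k \<le> \<epsilon> / 4\<close> L qi[rule_format] R_def k1[OF kbig(2)])+
    moreover have "N k \<subseteq> carrier G"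
      using residual_filtrationD(1)[OF N] normal_imp_subgroup subgroup.subset by blast
    ultimately show ?thesis using kbig(1) by (meson order_trans)
  qed
  then show ?thesis by blast
qed

section \<open>Mixed radix expansions and the profinite space\<close>

text \<open>The factor 4 opens gaps: all digits after position n together move the value by at most
  a third of the n-th weight, while a change of digit n moves it by at least a full weight.\<close>

definition radix_weight :: "(nat \<Rightarrow> nat) \<Rightarrow> nat \<Rightarrow> real" where
  "radix_weight m k = (\<Prod>j\<le>k. 1 / (4 * real (m j)))"

definition radix_value :: "(nat \<Rightarrow> nat) \<Rightarrow> (nat \<Rightarrow> nat) \<Rightarrow> real" where
  "radix_value m a = (\<Sum>k. real (a k) * radix_weight m k)"

context
  fixes m :: "nat \<Rightarrow> nat"
  assumes m: "\<And>k. 0 < m k"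
begin

lemma radix_weight_pos: "0 < radix_weight m k"
  unfolding radix_weight_def using m by (intro prod_pos) simp

lemma radix_weight_Suc: "real (m (Suc k)) * radix_weight m (Suc k) = radix_weight m k / 4"
  using m[of "Suc k"] by (simp add: radix_weight_def)

lemma radix_weight_decay: "radix_weight m (n + j) \<le> radix_weight m n * (1/4) ^ j"
proof (induction j)
  case (Suc j)
  have "1 * radix_weight m (Suc (n + j)) \<le> real (m (Suc (n + j))) * radix_weight m (Suc (n + j))"
    using m[of "Suc (n + j)"] radix_weight_pos[of "Suc (n + j)"] by (intro mult_right_mono) auto
  then show ?case using Suc radix_weight_Suc[of "n + j"] by simp
qed simp

lemma radix_weight_antimono: "j \<le> n \<Longrightarrow> radix_weight m n \<le> radix_weight m j"
proof -
  assume "j \<le> n"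
  then have "radix_weight m n \<le> radix_weight m j * (1/4) ^ (n - j)"
    using radix_weight_decay[of j "n - j"] by simp
  also have "\<dots> \<le> radix_weight m j"
    using radix_weight_pos[of j] by (intro mult_left_le power_le_one) auto
  finally show ?thesis .
qed

lemma radix_weight_tendsto_0: "radix_weight m \<longlonglongrightarrow> 0"
proof (rule tendsto_sandwich[of "\<lambda>_. 0" _ _ "\<lambda>n. radix_weight m 0 * (1/4) ^ n"])
  show "(\<lambda>n. radix_weight m 0 * (1/4) ^ n) \<longlonglongrightarrow> 0"
    by (intro tendsto_mult_right_zero LIMSEQ_realpow_zero) auto
  show "\<forall>\<^sub>F n in sequentially. 0 \<le> radix_weight m n"
    by (simp add: less_imp_le radix_weight_pos)
  show "\<forall>\<^sub>F n in sequentially. radix_weight m n \<le> radix_weight m 0 * (1/4) ^ n"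
    using radix_weight_decay[of 0] by (intro always_eventually allI) simp
qed simp

text \<open>By \<open>radix_weight_Suc\<close>, a digit times its weight is at most a quarter of the
  preceding weight, so the tail is dominated by a geometric series of ratio 1/4 with sum one third
  of the n-th weight.\<close>

lemma radix_tail:
  assumes d: "\<And>k. \<bar>d k\<bar> \<le> real (m k)"
  shows "summable (\<lambda>k. d k * radix_weight m k)"
    "\<bar>\<Sum>j. d (j + Suc n) * radix_weight m (j + Suc n)\<bar> \<le> radix_weight m n / 3"
proof -
  have bound: "norm (d (j + Suc n) * radix_weight m (j + Suc n)) \<le> radix_weight m n / 4 * (1/4) ^ j" for j n
  proof -
    have "norm (d (j + Suc n) * radix_weight m (j + Suc n)) \<le> real (m (Suc (n + j))) * radix_weight m (Suc (n + j))"
      using d[of "Suc (n + j)"] radix_weight_pos[of "Suc (n + j)"]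
      by (simp add: abs_mult add.commute mult_right_mono)
    also have "\<dots> \<le> radix_weight m n / 4 * (1/4) ^ j"
      using radix_weight_decay[of n j] by (simp add: radix_weight_Suc)
    finally show ?thesis .
  qed
  have geo: "summable (\<lambda>j. radix_weight m n / 4 * (1/4) ^ j)"
    "(\<Sum>j. radix_weight m n / 4 * (1/4) ^ j) = radix_weight m n / 3" for n
  proof -
    have "(\<lambda>j. radix_weight m n / 4 * (1/4) ^ j) sums (radix_weight m n / 4 * (1 / (1 - 1/4)))"
      by (intro sums_mult geometric_sums) auto
    then show "summable (\<lambda>j. radix_weight m n / 4 * (1/4) ^ j)"
      "(\<Sum>j. radix_weight m n / 4 * (1/4) ^ j) = radix_weight m n / 3"
      by (auto simp: sums_iff)
  qed
  have "summable (\<lambda>j. d (j + Suc 0) * radix_weight m (j + Suc 0))"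
    by (rule summable_comparison_test'[OF geo(1)[of 0]]) (rule bound)
  then show "summable (\<lambda>k. d k * radix_weight m k)" by (subst (asm) summable_iff_shift)
  have "norm (\<Sum>j. d (j + Suc n) * radix_weight m (j + Suc n)) \<le> (\<Sum>j. radix_weight m n / 4 * (1/4) ^ j)"
    by (rule norm_suminf_le[OF bound geo(1)])
  then show "\<bar>\<Sum>j. d (j + Suc n) * radix_weight m (j + Suc n)\<bar> \<le> radix_weight m n / 3"
    unfolding geo(2) real_norm_def .
qed

lemma radix_value_diff:
  assumes "\<And>k. a k < m k" "\<And>k. b k < m k" "\<And>k. k < n \<Longrightarrow> a k = b k"
  shows "\<bar>radix_value m a - radix_value m b - (real (a n) - real (b n)) * radix_weight m n\<bar>
    \<le> radix_weight m n / 3"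
proof -
  let ?d = "\<lambda>k. (real (a k) - real (b k))"
  have d: "\<bar>?d k\<bar> \<le> real (m k)" for k using assms(1,2)[of k] by linarith
  have "\<bar>real (a k)\<bar> \<le> real (m k)" "\<bar>real (b k)\<bar> \<le> real (m k)" for k
    using assms(1,2)[of k] by linarith+
  then have "radix_value m a - radix_value m b = (\<Sum>k. ?d k * radix_weight m k)"
    unfolding radix_value_def left_diff_distrib by (intro suminf_diff radix_tail(1))
  also have "\<dots> = (\<Sum>j. ?d (j + Suc n) * radix_weight m (j + Suc n)) + (\<Sum>k<Suc n. ?d k * radix_weight m k)"
    by (rule suminf_split_initial_segment[OF radix_tail(1)[OF d]])
  also have "(\<Sum>k<Suc n. ?d k * radix_weight m k) = ?d n * radix_weight m n"
    using assms(3) by simp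
  finally show ?thesis using radix_tail(2)[of ?d n, OF d] by simp
qed

lemma radix_value_close:
  assumes "\<And>k. a k < m k" "\<And>k. b k < m k" "\<And>k. k \<le> n \<Longrightarrow> a k = b k"
  shows "\<bar>radix_value m a - radix_value m b\<bar> \<le> radix_weight m n / 3"
  using radix_value_diff[of a b n] assms by simp

text \<open>At the first differing digit the values are at least 1 - 1/3 of its weight apart, and
  the weights decrease.\<close>

lemma radix_digits_agree:
  assumes "\<And>k. a k < m k" "\<And>k. b k < m k" "\<bar>radix_value m a - radix_value m b\<bar> < 2/3 * radix_weight m n"
    and "k \<le> n"
  shows "a k = b k"
  using assms(4)
proof (induction k rule: less_induct)
  case (less k)
  have pre: "a j = b j" if "j < k" for j using less that by simp
  show ?case
  proof (rule ccontr)
    assume "a k \<noteq> b k"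
    then have "1 \<le> \<bar>real (a k) - real (b k)\<bar>" by linarith
    then have "1 * radix_weight m k \<le> \<bar>real (a k) - real (b k)\<bar> * radix_weight m k"
      using radix_weight_pos[of k] by (intro mult_right_mono) auto
    then have "radix_weight m k \<le> \<bar>(real (a k) - real (b k)) * radix_weight m k\<bar>"
      using radix_weight_pos[of k] by (simp add: abs_mult)
    then have "2/3 * radix_weight m k \<le> \<bar>radix_value m a - radix_value m b\<bar>"
      using radix_value_diff[OF assms(1,2) pre, of k] by linarith
    then show False
      using assms(3) radix_weight_antimono[OF less.prems] by linarith
  qed
qed

end

text \<open>With the whole group at level 0 that level carries no information: \<open>walk\<close>
  can start at \<open>\<one>\<close>, and a single cylinder covers the space.\<close>

locale residual_chain = group G for G (structure) +
  fixes H :: "nat \<Rightarrow> 'a set"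
  assumes chain: "residual_filtration G H" and top: "H 0 = carrier G"
begin

lemma normal_H: "H k \<lhd> G" and finite_index: "finite (rcosets (H k))"
  and antimono: "j \<le> k \<Longrightarrow> H k \<subseteq> H j" and trivial_Int: "(\<Inter>k. H k) = {\<one>}"
  using residual_filtrationD[OF chain] by blast+

lemma subgroup_H: "subgroup (H k) G"
  using normal_H normal_imp_subgroup by blast

lemma H_carrier: "H k \<subseteq> carrier G"
  using subgroup_H subgroup.subset by blast

abbreviation index :: "nat \<Rightarrow> nat" where "index k \<equiv> card (rcosets (H k))"

lemma index_pos: "0 < index k"
  using finite_index subgroup.subgroup_in_rcosets[OF subgroup_H is_group] by (auto simp: card_gt_0_iff)

lemma coset_in: "a \<in> carrier G \<Longrightarrow> H k #> a \<in> rcosets (H k)"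
  by (rule rcosetsI[OF H_carrier])

lemma coset_mono:
  assumes "j \<le> k" "a \<in> carrier G" "b \<in> carrier G" "H k #> a = H k #> b"
  shows "H j #> a = H j #> b"
  using assms rcos_eq_iff[OF subgroup_H] antimono[OF assms(1)] by blast

text \<open>The inverse limit of the quotients \<open>G / H\<^sub>k\<close>.\<close>

definition points :: "(nat \<Rightarrow> 'a set) set" where
  "points = {\<omega>. \<forall>k. \<omega> k \<in> rcosets (H k) \<and> \<omega> (Suc k) \<subseteq> \<omega> k}"

lemma points_coset: "\<omega> \<in> points \<Longrightarrow> \<omega> k \<in> rcosets (H k)"
  by (simp add: points_def)

lemma points_nested: "\<omega> \<in> points \<Longrightarrow> j \<le> k \<Longrightarrow> \<omega> k \<subseteq> \<omega> j"
  by (rule lift_Suc_antimono_le[of \<omega>]) (auto simp: points_def)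

lemma points_rep:
  assumes "\<omega> \<in> points"
  shows "\<exists>a\<in>carrier G. \<forall>j\<le>k. \<omega> j = H j #> a"
proof -
  obtain a where a: "a \<in> carrier G" "\<omega> k = H k #> a"
    using points_coset[OF assms, of k] by (auto simp: RCOSETS_def)
  have "\<omega> j = H j #> a" if "j \<le> k" for j
  proof -
    have "a \<in> \<omega> j" using points_nested[OF assms that] a rcos_self[OF a(1) subgroup_H] by blast
    moreover obtain b where "b \<in> carrier G" "\<omega> j = H j #> b"
      using points_coset[OF assms, of j] by (auto simp: RCOSETS_def)
    ultimately show ?thesis using repr_independence[OF _ _ subgroup_H] by blast
  qed
  then show ?thesis using a(1) by blast
qed

lemma points_agree_below:
  assumes "\<omega> \<in> points" "\<omega>' \<in> points" "\<omega> k = \<omega>' k" "j \<le> k"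
  shows "\<omega> j = \<omega>' j"
proof -
  obtain a b where ab: "a \<in> carrier G" "b \<in> carrier G" "\<forall>j\<le>k. \<omega> j = H j #> a" "\<forall>j\<le>k. \<omega>' j = H j #> b"
    using points_rep[OF assms(1)] points_rep[OF assms(2)] by meson
  then show ?thesis using coset_mono[OF assms(4) ab(1,2)] assms(3,4) by simp
qed

definition digit :: "(nat \<Rightarrow> 'a set) \<Rightarrow> nat \<Rightarrow> nat" where
  "digit \<omega> k = to_nat_on (rcosets (H k)) (\<omega> k)"

text \<open>The embedding meets the demand of \<open>standard_prob_space\<close> for a Borel set of
  reals. Agreement up to level n corresponds, up to constants, to a distance of order
  \<open>weight n\<close>.\<close>

definition embed :: "(nat \<Rightarrow> 'a set) \<Rightarrow> real" where
  "embed \<omega> = radix_value index (digit \<omega>)"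

abbreviation weight :: "nat \<Rightarrow> real" where "weight \<equiv> radix_weight index"

lemma digit_less: "\<omega> \<in> points \<Longrightarrow> digit \<omega> k < index k"
  unfolding digit_def
  using bij_betwE[OF to_nat_on_finite[OF finite_index]] points_coset by blast

lemma digit_eq_iff:
  assumes "\<omega> \<in> points" "\<omega>' \<in> points"
  shows "digit \<omega> k = digit \<omega>' k \<longleftrightarrow> \<omega> k = \<omega>' k"
  unfolding digit_def
  using inj_onD[OF bij_betw_imp_inj_on[OF to_nat_on_finite[OF finite_index]]] points_coset assms by metis

lemma embed_close:
  assumes "\<omega> \<in> points" "\<omega>' \<in> points" "\<omega> n = \<omega>' n"
  shows "\<bar>embed \<omega> - embed \<omega>'\<bar> \<le> weight n / 3"
  unfolding embed_def
  by (rule radix_value_close[of index, OF index_pos])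
    (use assms digit_less digit_eq_iff points_agree_below in auto)

lemma agree_if_embed_close:
  assumes "\<omega> \<in> points" "\<omega>' \<in> points" "\<bar>embed \<omega> - embed \<omega>'\<bar> < 2/3 * weight n" "k \<le> n"
  shows "\<omega> k = \<omega>' k"
  using radix_digits_agree[of index "digit \<omega>" "digit \<omega>'", OF index_pos digit_less digit_less] assms
    digit_eq_iff unfolding embed_def by blast

lemma inj_embed: "inj_on embed points"
proof (rule inj_onI)
  fix \<omega> \<omega>' assume *: "\<omega> \<in> points" "\<omega>' \<in> points" "embed \<omega> = embed \<omega>'"
  show "\<omega> = \<omega>'"
  proof
    fix k show "\<omega> k = \<omega>' k"
      by (rule agree_if_embed_close[OF *(1,2), of k])
        (use *(3) radix_weight_pos[of index k, OF index_pos] in auto)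
  qed
qed

definition E :: "real set" where "E = embed ` points"

definition level :: "nat \<Rightarrow> real \<Rightarrow> 'a set" where
  "level k y = the_inv_into points embed y k"

lemma level_embed: "\<omega> \<in> points \<Longrightarrow> level k (embed \<omega>) = \<omega> k"
  by (simp add: level_def the_inv_into_f_f[OF inj_embed])

lemma level_points: "y \<in> E \<Longrightarrow> (\<lambda>k. level k y) \<in> points"
  by (auto simp: E_def level_embed)

lemma embed_level: "y \<in> E \<Longrightarrow> embed (\<lambda>k. level k y) = y"
  by (auto simp: E_def level_embed)

lemma E_eqI:
  assumes "y \<in> E" "z \<in> E" "\<And>k. level k y = level k z"
  shows "y = z"
proof -
  have "(\<lambda>k. level k y) = (\<lambda>k. level k z)" by (rule ext) (rule assms(3))
  then have "embed (\<lambda>k. level k y) = embed (\<lambda>k. level k z)" by (rule arg_cong)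
  then show ?thesis by (simp only: embed_level[OF assms(1)] embed_level[OF assms(2)])
qed

lemma level_close: "\<lbrakk>y \<in> E; z \<in> E; level n y = level n z\<rbrakk> \<Longrightarrow> \<bar>y - z\<bar> \<le> weight n / 3"
  using embed_close[OF level_points level_points] by (simp add: embed_level)

lemma level_agree: "\<lbrakk>y \<in> E; z \<in> E; \<bar>y - z\<bar> < 2/3 * weight n; k \<le> n\<rbrakk> \<Longrightarrow> level k y = level k z"
  using agree_if_embed_close[OF level_points level_points] by (simp add: embed_level)

lemma weight_pos: "0 < weight k"
  by (rule radix_weight_pos[OF index_pos])

text \<open>Each level of a convergent sequence is eventually constant, by the gaps; the eventual
  levels form a point of the inverse limit, whose image is the limit.\<close>

lemma closed_E: "closed E"
  unfolding closed_sequential_limits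
proof (intro allI impI, elim conjE)
  fix y l assume y: "\<forall>n. y n \<in> E" "y \<longlonglongrightarrow> l"
  have "\<exists>N. \<forall>i\<ge>N. \<forall>j\<ge>N. level n (y i) = level n (y j)" for n
  proof -
    have "Cauchy y" using y(2) by (rule LIMSEQ_imp_Cauchy)
    moreover have "0 < 2/3 * weight n" using weight_pos[of n] by simp
    ultimately obtain N where N: "\<forall>i\<ge>N. \<forall>j\<ge>N. dist (y i) (y j) < 2/3 * weight n"
      unfolding Cauchy_def by blast
    have "level n (y i) = level n (y j)" if "i \<ge> N" "j \<ge> N" for i j
      by (rule level_agree[OF y(1)[rule_format] y(1)[rule_format] _ order_refl])
        (use N that in \<open>simp add: dist_real_def\<close>)
    then show ?thesis by blast
  qed
  then obtain N where N: "\<And>n i j. i \<ge> N n \<Longrightarrow> j \<ge> N n \<Longrightarrow> level n (y i) = level n (y j)" by metis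
  define \<omega> where "\<omega> n = level n (y (N n))" for n
  have \<omega>: "\<omega> n = level n (y i)" if "i \<ge> N n" for n i using N[of n "N n" i] that by (simp add: \<omega>_def)
  have pts: "\<omega> \<in> points"
    unfolding points_def
  proof (intro CollectI allI)
    fix k
    define i where "i = max (N k) (N (Suc k))"
    have "\<omega> k = level k (y i)" "\<omega> (Suc k) = level (Suc k) (y i)" by (auto simp: i_def intro!: \<omega>)
    then show "\<omega> k \<in> rcosets H k \<and> \<omega> (Suc k) \<subseteq> \<omega> k"
      using level_points[of "y i"] y(1) by (simp add: points_def)
  qed
  have "y \<longlonglongrightarrow> embed \<omega>"
  proof (rule LIMSEQ_I)
    fix e :: real assume "e > 0"
    then obtain n where n: "weight n < e"
      using order_tendstoD(2)[OF radix_weight_tendsto_0[of index, OF index_pos], of e]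
      by (auto simp: eventually_sequentially)
    have "norm (y i - embed \<omega>) < e" if "i \<ge> N n" for i
      using embed_close[OF level_points pts, of "y i" n] \<omega>[OF that] y(1) n weight_pos[of n]
      by (simp add: embed_level)
    then show "\<exists>no. \<forall>i\<ge>no. norm (y i - embed \<omega>) < e" by blast
  qed
  then have "l = embed \<omega>" using y(2) LIMSEQ_unique by blast
  then show "l \<in> E" using pts by (simp add: E_def)
qed

definition cyl :: "nat \<Rightarrow> 'a set \<Rightarrow> real set" where
  "cyl k C = {y \<in> E. level k y = C}"

text \<open>The empty set is included so that the family is closed under intersection.\<close>

definition cyls :: "real set set" where
  "cyls = insert {} {cyl k C | k C. C \<in> rcosets (H k)}"

text \<open>Cylinders are relatively open, since a point of \<open>E\<close> within two thirds of
  \<open>weight k\<close> of a cylinder at level k belongs to it.\<close>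

lemma cyl_sets: "cyl k C \<in> sets (restrict_space borel E)"
proof -
  have eq: "cyl k C = E \<inter> (\<Union>y\<in>cyl k C. ball y (2/3 * weight k))"
  proof
    show "cyl k C \<subseteq> E \<inter> (\<Union>y\<in>cyl k C. ball y (2/3 * weight k))"
      using weight_pos[of k] by (auto simp: cyl_def)
    show "E \<inter> (\<Union>y\<in>cyl k C. ball y (2/3 * weight k)) \<subseteq> cyl k C"
    proof
      fix z assume "z \<in> E \<inter> (\<Union>y\<in>cyl k C. ball y (2/3 * weight k))"
      then obtain y where "y \<in> E" "level k y = C" "z \<in> E" "\<bar>y - z\<bar> < 2/3 * weight k"
        by (auto simp: cyl_def dist_real_def)
      then show "z \<in> cyl k C" using level_agree[of y z k k] by (simp add: cyl_def)
    qed
  qed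
  have "open (\<Union>y\<in>cyl k C. ball y (2/3 * weight k))" by blast
  then show ?thesis unfolding sets_restrict_space 
    by (intro image_eqI[where x = "\<Union>y\<in>cyl k C. ball y (2/3 * weight k)"] eq borel_open)
qed

lemma countable_cyls: "countable cyls"
proof -
  have "{cyl k C | k C. C \<in> rcosets (H k)} = (\<Union>k. cyl k ` (rcosets (H k)))" by blast
  then show ?thesis
    using countable_finite[OF finite_index] unfolding cyls_def by auto
qed

text \<open>Cylinders are a countable base of the topology of \<open>E\<close>, so each relatively
  open set is a countable union of them. Measurability and equality of measures may then be tested
  on cylinders.\<close>

lemma sets_E: "sets (restrict_space borel E) = sigma_sets E cyls"
proof
  show "sigma_sets E cyls \<subseteq> sets (restrict_space borel E)"
  proof -
    have "cyls \<subseteq> sets (restrict_space borel E)" using cyl_sets by (auto simp: cyls_def)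
    then show ?thesis using sets.sigma_sets_subset[of cyls "restrict_space borel E"] by (simp add: space_restrict_space)
  qed
  have sub: "cyls \<subseteq> Pow E" by (auto simp: cyls_def cyl_def)
  have opn: "E \<inter> U \<in> sigma_sets E cyls" if U: "open U" for U
  proof -
    have eq: "E \<inter> U = \<Union>{c \<in> cyls. c \<subseteq> U}"
    proof
      show "\<Union>{c \<in> cyls. c \<subseteq> U} \<subseteq> E \<inter> U" using sub by blast
      show "E \<inter> U \<subseteq> \<Union>{c \<in> cyls. c \<subseteq> U}"
      proof
        fix y assume y: "y \<in> E \<inter> U"
        then obtain e where e: "e > 0" "ball y e \<subseteq> U" using y by (auto elim: openE[OF U])
        obtain n where n: "weight n < e"
          using order_tendstoD(2)[OF radix_weight_tendsto_0[of index, OF index_pos] e(1)]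
          by (auto simp: eventually_sequentially)
        have "cyl n (level n y) \<subseteq> ball y e"
        proof
          fix z assume "z \<in> cyl n (level n y)"
          then have "\<bar>y - z\<bar> \<le> weight n / 3" using y level_close[of y z n] by (auto simp: cyl_def)
          then show "z \<in> ball y e" using n weight_pos[of n] by (simp add: dist_real_def)
        qed
        moreover have "cyl n (level n y) \<in> cyls"
          using y level_points points_coset unfolding cyls_def by blast
        moreover have "y \<in> cyl n (level n y)" using y by (simp add: cyl_def)
        ultimately show "y \<in> \<Union>{c \<in> cyls. c \<subseteq> U}" using e(2) by blast
      qed
    qed
    have "countable {c \<in> cyls. c \<subseteq> U}" using countable_cyls by (rule countable_subset[rotated]) blast
    moreover have "{c \<in> cyls. c \<subseteq> U} \<subseteq> sigma_sets E cyls" by auto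
    ultimately show ?thesis
      unfolding eq by (rule sigma_algebra.countable_Union[OF sigma_algebra_sigma_sets[OF sub]])
  qed
  show "sets (restrict_space borel E) \<subseteq> sigma_sets E cyls"
  proof
    fix X assume "X \<in> sets (restrict_space borel E)"
    then obtain B where B: "B \<in> sets borel" "X = E \<inter> B" by (auto simp: sets_restrict_space)
    interpret sigma_algebra E "sigma_sets E cyls" by (rule sigma_algebra_sigma_sets[OF sub])
    have "B \<in> sigma_sets UNIV {U. open U}" using B(1) by (simp add: borel_def)
    then have "E \<inter> B \<in> sigma_sets E cyls"
    proof (induction B rule: sigma_sets.induct)
      case (Compl a)
      have "E \<inter> (UNIV - a) = E - E \<inter> a" by blast
      then show ?case using Compl.IH by auto
    next
      case (Union a)
      have "(\<Union>i. E \<inter> a i) \<in> sigma_sets E cyls" by (rule sigma_sets.Union[OF Union.IH])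
      then show ?case by simp
    qed (auto intro: opn)
    then show "X \<in> sigma_sets E cyls" using B(2) by simp
  qed
qed

end

section \<open>Haar measure\<close>

context residual_chain
begin

definition children :: "nat \<Rightarrow> 'a set set" where
  "children k = (\<lambda>g. H (Suc k) #> g) ` H k"

text \<open>Reducing \<open>i\<close> modulo the number of children makes every sequence of naturals a valid sequence of
  digits, so that no null set has to be discarded from the product space \<open>P\<close> below.\<close>

definition rep :: "nat \<Rightarrow> nat \<Rightarrow> 'a" where
  "rep k i = (SOME g. g \<in> H k \<and> H (Suc k) #> g = from_nat_into (children k) (i mod card (children k)))"

text \<open>The new factor lies in \<open>H k\<close> and enters on the left, so the coset at level
  k is kept and only the one at level k+1 is refined.\<close>

primrec walk :: "(nat \<Rightarrow> nat) \<Rightarrow> nat \<Rightarrow> 'a" where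
  "walk x 0 = \<one>"
| "walk x (Suc k) = rep k (x k) \<otimes> walk x k"

lemma finite_children: "finite (children k)"
proof (rule finite_subset[OF _ finite_index[of "Suc k"]])
  show "children k \<subseteq> rcosets H (Suc k)"
    using H_carrier[of k] coset_in[of _ "Suc k"] by (auto simp: children_def)
qed

lemma children_nonempty: "children k \<noteq> {}"
  using subgroup.one_closed[OF subgroup_H] by (auto simp: children_def)

lemma card_children_pos: "0 < card (children k)"
  using finite_children children_nonempty by (simp add: card_gt_0_iff)

lemma rep: "rep k i \<in> H k" "H (Suc k) #> rep k i = from_nat_into (children k) (i mod card (children k))"
proof -
  have "from_nat_into (children k) (i mod card (children k)) \<in> children k"
    by (rule from_nat_into[OF children_nonempty])
  then have "\<exists>g. g \<in> H k \<and> H (Suc k) #> g = from_nat_into (children k) (i mod card (children k))"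
    unfolding children_def by (elim imageE) (metis (no_types, lifting))
  from someI_ex[OF this] show "rep k i \<in> H k"
    "H (Suc k) #> rep k i = from_nat_into (children k) (i mod card (children k))"
    unfolding rep_def by (rule conjunct1, rule conjunct2)
qed

lemma rep_digit:
  assumes "g \<in> H k"
  shows "\<exists>d<card (children k). \<forall>i. H (Suc k) #> rep k i = H (Suc k) #> g \<longleftrightarrow> i mod card (children k) = d"
proof -
  let ?b = "from_nat_into (children k)" and ?s = "card (children k)"
  have bij: "bij_betw ?b {..<?s} (children k)"
    by (rule bij_betw_from_nat_into_finite[OF finite_children])
  have "H (Suc k) #> g \<in> ?b ` {..<?s}"
    using assms bij_betw_imp_surj_on[OF bij] by (auto simp: children_def)
  then obtain d where d: "d < ?s" "?b d = H (Suc k) #> g" by auto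
  have "H (Suc k) #> rep k i = H (Suc k) #> g \<longleftrightarrow> i mod ?s = d" for i
    using inj_onD[OF bij_betw_imp_inj_on[OF bij], of "i mod ?s" d] d card_children_pos[of k]
    by (auto simp: rep(2))
  then show ?thesis using d(1) by blast
qed

lemma rep_carrier: "rep k i \<in> carrier G"
  using rep(1) H_carrier by blast

lemma walk_carrier: "walk x k \<in> carrier G"
  by (induction k) (simp_all add: rep_carrier)

lemma walk_cong:
  assumes "\<And>j. j < k \<Longrightarrow> x j mod card (children j) = x' j mod card (children j)"
  shows "walk x k = walk x' k"
  using assms
proof (induction k)
  case (Suc k)
  have "rep k (x k) = rep k (x' k)" unfolding rep_def Suc.prems[OF lessI] ..
  then show ?case using Suc by simp
qed simp

lemma coset_rep_walk: "H k #> (rep k i \<otimes> walk x k) = H k #> walk x k"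
  using rcos_eq_iff[OF subgroup_H, of "rep k i \<otimes> walk x k" "walk x k" k] rep(1)[of k i] rep_carrier walk_carrier
  by (simp add: m_assoc)

lemma coset_Suc_subset: "H (Suc k) #> a \<subseteq> H k #> a"
  using antimono[of k "Suc k"] by (auto simp: r_coset_def)

lemma walk_points: "(\<lambda>k. H k #> walk x k) \<in> points"
  unfolding points_def
proof (intro CollectI allI conjI)
  fix k
  show "H k #> walk x k \<in> rcosets H k" by (rule coset_in[OF walk_carrier])
  show "H (Suc k) #> walk x (Suc k) \<subseteq> H k #> walk x k"
    using coset_Suc_subset[of k "walk x (Suc k)"] coset_rep_walk[of k "x k" x] by simp
qed

text \<open>This turns a cylinder of \<open>E\<close> into a cylinder of the product space. Once the
  first k digits are right, the walk is a fixed element, and the next coset condition concerns one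
  digit only.\<close>

lemma walk_digits:
  assumes "g \<in> carrier G"
  shows "\<exists>d. (\<forall>j<k. d j < card (children j)) \<and>
    (\<forall>x. H k #> walk x k = H k #> g \<longleftrightarrow> (\<forall>j<k. x j mod card (children j) = d j))"
proof (induction k)
  case 0
  have "H 0 #> walk x 0 = H 0 #> g" for x
    using rcos_eq_iff[OF subgroup_H, of \<one> g 0] assms by (simp add: top)
  then show ?case by simp
next
  case (Suc k)
  then obtain d where d: "\<And>j. j < k \<Longrightarrow> d j < card (children j)"
    "\<And>x. H k #> walk x k = H k #> g \<longleftrightarrow> (\<forall>j<k. x j mod card (children j) = d j)" by blast
  \<comment> \<open>The entries of \<open>d\<close> are already reduced, so \<open>d\<close> is
    itself a digit sequence that reaches the required coset.\<close>
  define p where "p = walk d k"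
  have p: "p \<in> carrier G" by (simp add: p_def walk_carrier)
  have "H k #> p = H k #> g" unfolding p_def using d(2)[of d] d(1) by simp
  then have "g \<otimes> inv p \<in> H k" using rcos_eq_iff[OF subgroup_H assms p, of k] by simp
  then obtain e where e: "e < card (children k)"
    "\<And>i. H (Suc k) #> rep k i = H (Suc k) #> (g \<otimes> inv p) \<longleftrightarrow> i mod card (children k) = e"
    using rep_digit by blast
  have "H (Suc k) #> walk x (Suc k) = H (Suc k) #> g \<longleftrightarrow>
      (\<forall>j<Suc k. x j mod card (children j) = (d(k := e)) j)" (is "?L \<longleftrightarrow> ?R") for x
  proof -
    have step: "?L \<longleftrightarrow> x k mod card (children k) = e" if "walk x k = p"
    proof -
      have "rep k (x k) \<otimes> p \<otimes> inv g = rep k (x k) \<otimes> inv (g \<otimes> inv p)"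
        using p assms rep_carrier by (simp add: m_assoc inv_mult_group)
      then show ?thesis
        using e(2)[of "x k"] rcos_eq_iff[OF subgroup_H, of "rep k (x k) \<otimes> p" g]
          rcos_eq_iff[OF subgroup_H, of "rep k (x k)" "g \<otimes> inv p"] p assms rep_carrier that by simp
    qed
    have pre: "walk x k = p" if "\<forall>j<k. x j mod card (children j) = d j"
      unfolding p_def by (rule walk_cong) (use that d(1) in simp)
    show ?thesis
    proof
      assume L: ?L
      then have "H k #> walk x (Suc k) = H k #> g"
        by (rule coset_mono[OF le_SucI[OF order_refl] walk_carrier assms])
      then have "\<forall>j<k. x j mod card (children j) = d j"
        using d(2) coset_rep_walk by simp
      then show ?R using step[OF pre] L by (auto simp: less_Suc_eq)
    next
      assume R: ?R
      then have "\<forall>j<k. x j mod card (children j) = d j" "x k mod card (children k) = e" by auto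
      then show ?L using step[OF pre] by blast
    qed
  qed
  moreover have "\<forall>j<Suc k. (d(k := e)) j < card (children j)" using d(1) e(1) by (simp add: less_Suc_eq)
  ultimately show ?case by blast
qed

definition digit_measure :: "nat \<Rightarrow> nat measure" where
  "digit_measure k = measure_pmf (pmf_of_set {..<card (children k)})"

definition P :: "(nat \<Rightarrow> nat) measure" where
  "P = PiM UNIV digit_measure"

sublocale digits: product_prob_space digit_measure UNIV
  by (rule product_prob_spaceI) (simp add: digit_measure_def measure_pmf.prob_space_axioms)

lemma prob_space_P: "prob_space P"
  unfolding P_def by (rule digits.P.prob_space_axioms)

lemma space_P: "space P = UNIV"
  by (auto simp: P_def space_PiM digit_measure_def)

lemma measurable_digit: "(\<lambda>x. x k) \<in> measurable P (count_space UNIV)"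
proof -
  have "(\<lambda>x. x k) \<in> measurable P (digit_measure k)"
    unfolding P_def by (rule measurable_component_singleton) simp
  then show ?thesis by (simp add: digit_measure_def)
qed

lemma measurable_walk: "(\<lambda>x. walk x k) \<in> measurable P (count_space UNIV)"
proof (induction k)
  case (Suc k)
  have "(\<lambda>x. rep k i \<otimes> walk x k) \<in> measurable P (count_space UNIV)" for i
    by (rule measurable_compose[OF Suc.IH]) simp
  then have "(\<lambda>x. (\<lambda>i x. rep k i \<otimes> walk x k) (x k) x) \<in> measurable P (count_space UNIV)"
    by (rule measurable_compose_countable[OF _ measurable_digit])
  then show ?case by simp
qed simp

definition haar_point :: "(nat \<Rightarrow> nat) \<Rightarrow> real" where
  "haar_point x = embed (\<lambda>k. H k #> walk x k)"

lemma haar_point_E: "haar_point x \<in> E"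
  unfolding haar_point_def E_def using walk_points by blast

lemma level_haar_point: "level k (haar_point x) = H k #> walk x k"
  unfolding haar_point_def by (rule level_embed[OF walk_points])

lemma measurable_haar_point: "haar_point \<in> measurable P (restrict_space borel E)"
proof (rule measurable_restrict_space2)
  show "haar_point \<in> space P \<rightarrow> E" using haar_point_E by blast
  have "(\<lambda>x. real (to_nat_on (rcosets (H k)) (H k #> walk x k)) * weight k) \<in> borel_measurable P" for k
    by (rule measurable_compose[OF measurable_walk]) simp
  then show "haar_point \<in> borel_measurable P"
    unfolding haar_point_def embed_def radix_value_def digit_def by (rule borel_measurable_suminf)
qed

text \<open>Haar measure on the inverse limit, as the law of a random point whose children are
  chosen uniformly and independently at each level.\<close>

definition \<mu> :: "real measure" where
  "\<mu> = distr P (restrict_space borel E) haar_point"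

lemma space_\<mu>: "space \<mu> = E" and sets_\<mu>: "sets \<mu> = sets (restrict_space borel E)"
  by (simp_all add: \<mu>_def space_restrict_space)

lemma prob_space_\<mu>: "prob_space \<mu>"
  unfolding \<mu>_def by (rule prob_space.prob_space_distr[OF prob_space_P measurable_haar_point])

lemma standard_\<mu>: "standard_prob_space \<mu>"
  unfolding standard_prob_space_def space_\<mu>
  using prob_space_\<mu> sets_\<mu> closed_E by simp

lemma emeasure_cyl_prod:
  assumes "C \<in> rcosets (H k)"
  shows "emeasure \<mu> (cyl k C) = (\<Prod>j<k. ennreal (1 / real (card (children j))))"
proof -
  obtain g where g: "g \<in> carrier G" "C = H k #> g" using assms by (auto simp: RCOSETS_def)
  obtain d where d: "\<And>j. j < k \<Longrightarrow> d j < card (children j)"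
    "\<And>x. H k #> walk x k = H k #> g \<longleftrightarrow> (\<forall>j<k. x j mod card (children j) = d j)"
    using walk_digits[OF g(1)] by blast
  let ?X = "\<lambda>j. {i. i mod card (children j) = d j}"
  have "emeasure \<mu> (cyl k C) = emeasure P (haar_point -` cyl k C \<inter> space P)"
    unfolding \<mu>_def by (rule emeasure_distr[OF measurable_haar_point cyl_sets])
  also have "haar_point -` cyl k C \<inter> space P = {x \<in> space P. \<forall>j\<in>{..<k}. x j \<in> ?X j}"
    using d(2) haar_point_E by (auto simp: space_P cyl_def level_haar_point g(2))
  also have "emeasure P \<dots> = (\<Prod>j\<in>{..<k}. emeasure (digit_measure j) (?X j))"
    unfolding P_def by (rule digits.emeasure_PiM_Collect) (simp_all add: digit_measure_def)
  also have "\<dots> = (\<Prod>j\<in>{..<k}. ennreal (1 / real (card (children j))))"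
  proof (rule prod.cong[OF refl])
    fix j assume j: "j \<in> {..<k}"
    have "{..<card (children j)} \<inter> ?X j = {d j}" using d(1)[of j] j by auto
    moreover have "{..<card (children j)} \<noteq> {}" using card_children_pos[of j] by auto
    ultimately show "emeasure (digit_measure j) (?X j) = ennreal (1 / real (card (children j)))"
      unfolding digit_measure_def by (subst emeasure_pmf_of_set) simp_all
  qed
  finally show ?thesis .
qed

text \<open>The product formula does not depend on the coset, and the cylinders of a level partition
  \<open>E\<close>; so each has measure one over their number.\<close>

lemma measure_cyl:
  assumes "C \<in> rcosets (H k)"
  shows "emeasure \<mu> (cyl k C) = ennreal (1 / real (index k))"
proof -
  interpret \<mu>: prob_space \<mu> by (rule prob_space_\<mu>)
  define v where "v = (\<Prod>j<k. 1 / real (card (children j)))"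
  have v: "emeasure \<mu> (cyl k C) = ennreal v" if "C \<in> rcosets (H k)" for C
    unfolding emeasure_cyl_prod[OF that] v_def by (simp add: prod_ennreal)
  have v0: "0 \<le> v" unfolding v_def by (intro prod_nonneg) simp
  have "E = (\<Union>C\<in>rcosets (H k). cyl k C)"
    using points_coset[OF level_points] by (auto simp: cyl_def)
  then have "1 = measure \<mu> (\<Union>C\<in>rcosets (H k). cyl k C)"
    using \<mu>.prob_space space_\<mu> by simp
  also have "\<dots> = (\<Sum>C\<in>rcosets (H k). measure \<mu> (cyl k C))"
  proof (rule \<mu>.finite_measure_finite_Union[OF finite_index])
    show "cyl k ` (rcosets (H k)) \<subseteq> sets \<mu>" using cyl_sets by (auto simp: sets_\<mu>)
    show "disjoint_family_on (cyl k) (rcosets (H k))" by (auto simp: disjoint_family_on_def cyl_def)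
  qed
  also have "\<dots> = real (index k) * v"
    using v v0 by (simp add: measure_def)
  finally have "v = 1 / real (index k)" using index_pos[of k] by (simp add: field_simps)
  then show ?thesis using v[OF assms] by simp
qed

end

section \<open>Cost of the profinite action\<close>

context residual_chain
begin

text \<open>Restricted to \<open>E\<close> because \<open>group_action\<close> asks for elements of
  \<open>Bij E\<close>, which are extensional functions.\<close>

definition act :: "'a \<Rightarrow> real \<Rightarrow> real" where
  "act g = (\<lambda>y\<in>E. embed (\<lambda>k. (H k #> g) <#> level k y))"

lemma coset_mult: "\<lbrakk>a \<in> carrier G; b \<in> carrier G\<rbrakk> \<Longrightarrow> (H k #> a) <#> (H k #> b) = H k #> (a \<otimes> b)"
  by (rule normal.rcos_sum[OF normal_H])

lemma level_rep: "y \<in> E \<Longrightarrow> \<exists>a\<in>carrier G. \<forall>j\<le>k. level j y = H j #> a"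
  using points_rep[OF level_points] by blast

lemma level_coset: "y \<in> E \<Longrightarrow> \<exists>a\<in>carrier G. level k y = H k #> a"
  using level_rep[of y k] by blast

lemma act_points:
  assumes g: "g \<in> carrier G" and y: "y \<in> E"
  shows "(\<lambda>k. (H k #> g) <#> level k y) \<in> points"
  unfolding points_def
proof (intro CollectI allI)
  fix k
  obtain a where a: "a \<in> carrier G" "\<And>j. j \<le> Suc k \<Longrightarrow> level j y = H j #> a"
    using level_rep[OF y] by blast
  have "level k y = H k #> a" "level (Suc k) y = H (Suc k) #> a" using a(2) by auto
  then show "(H k #> g) <#> level k y \<in> rcosets H k \<and> (H (Suc k) #> g) <#> level (Suc k) y \<subseteq> (H k #> g) <#> level k y"
    using coset_mult[OF g a(1)] coset_in coset_Suc_subset g a(1) by simp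
qed

lemma act_in_E:
  assumes "g \<in> carrier G" "y \<in> E"
  shows "act g y \<in> E"
  using act_points[OF assms] assms(2) by (simp add: act_def E_def)

lemma level_act:
  assumes "g \<in> carrier G" "y \<in> E"
  shows "level k (act g y) = (H k #> g) <#> level k y"
  using level_embed[OF act_points[OF assms]] assms(2) by (simp add: act_def)

lemma level_act_coset:
  assumes "g \<in> carrier G" "y \<in> E" "a \<in> carrier G" "level k y = H k #> a"
  shows "level k (act g y) = H k #> (g \<otimes> a)"
  using level_act[OF assms(1,2)] assms(4) coset_mult[OF assms(1,3)] by simp

lemma act_mult:
  assumes g: "g \<in> carrier G" and h: "h \<in> carrier G" and y: "y \<in> E"
  shows "act (g \<otimes> h) y = act g (act h y)"
proof (rule E_eqI)
  show "act (g \<otimes> h) y \<in> E" "act g (act h y) \<in> E"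
    by (intro act_in_E m_closed g h y)+
  fix k
  obtain a where a: "a \<in> carrier G" "level k y = H k #> a" using level_coset[OF y, of k] by blast
  have "level k (act g (act h y)) = H k #> (g \<otimes> (h \<otimes> a))"
    by (rule level_act_coset[OF g act_in_E[OF h y] m_closed[OF h a(1)] level_act_coset[OF h y a]])
  then show "level k (act (g \<otimes> h) y) = level k (act g (act h y))"
    using level_act_coset[OF m_closed[OF g h] y a] g h a(1) by (simp add: m_assoc)
qed

lemma act_one:
  assumes "y \<in> E"
  shows "act \<one> y = y"
proof (rule E_eqI[OF act_in_E[OF one_closed assms] assms])
  fix k
  obtain a where a: "a \<in> carrier G" "level k y = H k #> a" using level_coset[OF assms, of k] by blast
  then show "level k (act \<one> y) = level k y" using level_act_coset[OF one_closed assms a] by simp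
qed

lemma act_inv:
  assumes "g \<in> carrier G" "y \<in> E"
  shows "act (inv g) (act g y) = y" "act g (act (inv g) y) = y"
  using act_mult[of "inv g" g y] act_mult[of g "inv g" y] act_one assms by simp_all

lemma act_bij: "g \<in> carrier G \<Longrightarrow> bij_betw (act g) E E"
  by (rule bij_betwI[where g = "act (inv g)"]) (auto simp: act_in_E act_inv)

lemma group_action_act: "group_action G E act"
proof -
  have bij: "act g \<in> Bij E" if "g \<in> carrier G" for g
    using act_bij[OF that] by (simp add: Bij_def act_def)
  have "act \<in> hom G (BijGroup E)"
  proof (rule homI)
    show "act g \<in> carrier (BijGroup E)" if "g \<in> carrier G" for g
      using bij[OF that] by (simp add: BijGroup_def)
    fix g h assume gh: "g \<in> carrier G" "h \<in> carrier G"
    have "act (g \<otimes> h) = compose E (act g) (act h)"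
    proof
      fix y show "act (g \<otimes> h) y = compose E (act g) (act h) y"
        by (cases "y \<in> E") (simp_all add: compose_def act_mult[OF gh], simp add: act_def)
    qed
    then show "act (g \<otimes> h) = act g \<otimes>\<^bsub>BijGroup E\<^esub> act h"
      using bij gh by (simp add: BijGroup_def)
  qed
  then show ?thesis
    unfolding group_action_def group_hom_def group_hom_axioms_def
    using is_group group_BijGroup by blast
qed

lemma act_vimage_cyl:
  assumes g: "g \<in> carrier G" and a: "a \<in> carrier G"
  shows "act g -` cyl k (H k #> a) \<inter> E = cyl k (H k #> (inv g \<otimes> a))"
proof (intro equalityI subsetI)
  fix y assume "y \<in> act g -` cyl k (H k #> a) \<inter> E"
  then have y: "y \<in> E" "act g y \<in> E" "level k (act g y) = H k #> a" by (auto simp: cyl_def)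
  have "level k (act (inv g) (act g y)) = H k #> (inv g \<otimes> a)"
    by (rule level_act_coset[OF inv_closed[OF g] y(2) a y(3)])
  then show "y \<in> cyl k (H k #> (inv g \<otimes> a))" using y act_inv(1)[OF g y(1)] by (simp add: cyl_def)
next
  fix y assume "y \<in> cyl k (H k #> (inv g \<otimes> a))"
  then have y: "y \<in> E" "level k y = H k #> (inv g \<otimes> a)" by (auto simp: cyl_def)
  have "level k (act g y) = H k #> (g \<otimes> (inv g \<otimes> a))"
    by (rule level_act_coset[OF g y(1) _ y(2)]) (use g a in simp)
  then show "y \<in> act g -` cyl k (H k #> a) \<inter> E"
    using y act_in_E[OF g y(1)] g a by (simp add: cyl_def)
qed

lemma sets_\<mu>_cyls: "sets \<mu> = sigma_sets E cyls"
  using sets_\<mu> sets_E by simp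

lemma cyls_subset: "cyls \<subseteq> Pow E"
  by (auto simp: cyls_def cyl_def)

lemma measurable_act:
  assumes g: "g \<in> carrier G"
  shows "act g \<in> measurable \<mu> \<mu>"
proof (rule measurable_sigma_sets[OF sets_\<mu>_cyls cyls_subset])
  show "act g \<in> space \<mu> \<rightarrow> E" using act_in_E[OF g] by (simp add: space_\<mu>)
  fix Y assume "Y \<in> cyls"
  then consider "Y = {}" | k a where "Y = cyl k (H k #> a)" "a \<in> carrier G"
    by (auto simp: cyls_def RCOSETS_def)
  then show "act g -` Y \<inter> space \<mu> \<in> sets \<mu>"
  proof cases
    case 2
    then show ?thesis using act_vimage_cyl[OF g 2(2)] cyl_sets by (simp add: space_\<mu> sets_\<mu>)
  qed simp
qed

lemma cyl_Int:
  assumes "j \<le> k"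
  shows "cyl j C \<inter> cyl k D = {} \<or> cyl j C \<inter> cyl k D = cyl k D"
proof (cases "cyl j C \<inter> cyl k D = {}")
  case False
  then obtain y where y: "y \<in> E" "level j y = C" "level k y = D" by (auto simp: cyl_def)
  have "z \<in> cyl j C" if z: "z \<in> cyl k D" for z
    using points_agree_below[OF level_points level_points _ assms, of z y] z y by (simp add: cyl_def)
  then show ?thesis by blast
qed simp

lemma Int_stable_cyls: "Int_stable cyls"
proof (rule Int_stableI)
  fix X Y assume XY: "X \<in> cyls" "Y \<in> cyls"
  show "X \<inter> Y \<in> cyls"
  proof (cases "X = {} \<or> Y = {}")
    case True
    then show ?thesis by (auto simp: cyls_def)
  next
    case False
    then obtain j C k D where "X = cyl j C" "Y = cyl k D" using XY by (auto simp: cyls_def)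
    then have "X \<inter> Y = {} \<or> X \<inter> Y = X \<or> X \<inter> Y = Y"
      using cyl_Int[of j k C D] cyl_Int[of k j D C] by (metis inf_commute linear)
    then show ?thesis using XY by (auto simp: cyls_def)
  qed
qed

text \<open>Translation permutes the cylinders of each level, and these all have the same
  measure.\<close>

lemma distr_act:
  assumes g: "g \<in> carrier G"
  shows "distr \<mu> \<mu> (act g) = \<mu>"
proof (rule measure_eqI_generator_eq[OF Int_stable_cyls cyls_subset, where A = "\<lambda>_. cyl 0 (carrier G)"])
  show "sets (distr \<mu> \<mu> (act g)) = sigma_sets E cyls" "sets \<mu> = sigma_sets E cyls"
    by (simp_all add: sets_\<mu>_cyls)
  fix Y assume "Y \<in> cyls"
  then consider "Y = {}" | k a where "Y = cyl k (H k #> a)" "a \<in> carrier G"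
    by (auto simp: cyls_def RCOSETS_def)
  then show "emeasure (distr \<mu> \<mu> (act g)) Y = emeasure \<mu> Y"
  proof cases
    case 2
    have "emeasure (distr \<mu> \<mu> (act g)) Y = emeasure \<mu> (act g -` Y \<inter> space \<mu>)"
      by (rule emeasure_distr[OF measurable_act[OF g]]) (simp add: 2 sets_\<mu> cyl_sets)
    also have "\<dots> = emeasure \<mu> (cyl k (H k #> (inv g \<otimes> a)))"
      using act_vimage_cyl[OF g 2(2)] 2(1) by (simp add: space_\<mu>)
    also have "\<dots> = emeasure \<mu> Y"
      using measure_cyl[OF coset_in] 2 g by simp
    finally show ?thesis .
  qed simp
next
  have top_coset: "carrier G \<in> rcosets (H 0)"
    using subgroup.subgroup_in_rcosets[OF subgroup_H[of 0] is_group] by (simp add: top)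
  then show "range (\<lambda>_. cyl 0 (carrier G)) \<subseteq> cyls" by (auto simp: cyls_def)
  have "level 0 y = carrier G" if y: "y \<in> E" for y
  proof -
    obtain a where a: "a \<in> carrier G" "level 0 y = H 0 #> a" using level_coset[OF y, of 0] by blast
    then show ?thesis using coset_join2[OF a(1) subgroup_H[of 0]] by (simp add: top)
  qed
  then show "(\<Union>i. cyl 0 (carrier G)) = E" by (auto simp: cyl_def)
  show "emeasure (distr \<mu> \<mu> (act g)) (cyl 0 (carrier G)) \<noteq> \<infinity>"
    using prob_space.prob_space_distr[OF prob_space_\<mu> measurable_act[OF g]]
      finite_measure.emeasure_finite prob_space.finite_measure by (metis infinity_ennreal_def)
qed

lemma pmp_act: "pmp_action G \<mu> act"
  unfolding pmp_action_def using group_action_act measurable_act distr_act by (simp add: space_\<mu>)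

text \<open>If g fixes a point, comparing level k gives \<open>g \<in> H k\<close>, for every k.
  Freeness thus holds at every point.\<close>

lemma free_act: "essentially_free G \<mu> act"
  unfolding essentially_free_def
proof (rule AE_I2)
  fix y assume "y \<in> space \<mu>"
  then have y: "y \<in> E" by (simp add: space_\<mu>)
  have "g = \<one>" if g: "g \<in> carrier G" "act g y = y" for g
  proof -
    have "g \<in> H k" for k
    proof -
      obtain a where a: "a \<in> carrier G" "level k y = H k #> a" using level_coset[OF y, of k] by blast
      have "H k #> (g \<otimes> a) = H k #> a" using level_act_coset[OF g(1) y a] g(2) a(2) by simp
      then show ?thesis
        using rcos_eq_iff[OF subgroup_H, of "g \<otimes> a" a k] g(1) a(1) by (simp add: m_assoc)
    qed
    then show ?thesis using trivial_Int by blast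
  qed
  then show "stabilizer G act y = {\<one>}"
    using act_one[OF y] by (auto simp: stabilizer_def)
qed

lemma act_image:
  assumes g: "g \<in> carrier G" and C: "C \<subseteq> E"
  shows "act g ` C = act (inv g) -` C \<inter> E"
proof (intro equalityI subsetI)
  fix z assume "z \<in> act g ` C"
  then obtain y where "y \<in> C" "z = act g y" by blast
  then show "z \<in> act (inv g) -` C \<inter> E" using C act_in_E[OF g] act_inv(1)[OF g] by auto
next
  fix z assume z: "z \<in> act (inv g) -` C \<inter> E"
  then have "z = act g (act (inv g) z)" using act_inv(2)[OF g] by simp
  then show "z \<in> act g ` C" using z by blast
qed

text \<open>The graphing lives on the cylinder of \<open>H\<^sub>k\<close>: it consists of generators of \<open>H\<^sub>k\<close>, which generate
  the relation there, and of translations onto all cylinders of level \<open>k\<close>.\<close>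

lemma cost_act_le:
  assumes A: "finite A" "A \<subseteq> carrier G" "generate G A = H k"
  shows "cost G \<mu> act \<le> ennreal (1 + real (card A) / real (index k))"
proof -
  define B where "B = cyl k (H k)"
  have B_coset: "H k \<in> rcosets (H k)" by (rule subgroup.subgroup_in_rcosets[OF subgroup_H is_group])
  have B: "B \<in> sets \<mu>" "B \<subseteq> E" by (auto simp: B_def cyl_sets sets_\<mu>) (auto simp: cyl_def)
  obtain as where as: "set as = A" "length as = card A"
    using finite_distinct_list[OF A(1)] distinct_card by metis
  obtain Cs where Cs: "set Cs = rcosets (H k)" "length Cs = index k"
    using finite_distinct_list[OF finite_index] distinct_card by metis
  have "\<exists>a. a \<in> carrier G \<and> H k #> a = C" if "C \<in> rcosets (H k)" for C using that by (auto simp: RCOSETS_def)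
  then obtain \<rho> where \<rho>: "\<And>C. C \<in> rcosets (H k) \<Longrightarrow> \<rho> C \<in> carrier G \<and> H k #> \<rho> C = C" by metis
  define gs where "gs = as @ map \<rho> Cs"
  have gs_set: "set gs = A \<union> \<rho> ` (rcosets (H k))" and gs_len: "length gs = card A + index k"
    by (auto simp: gs_def as Cs)
  have gs_carrier: "set gs \<subseteq> carrier G" using gs_set A(2) \<rho> by auto
  define h where "h i = (if i < length gs then gs ! i else \<one>)" for i
  \<comment> \<open>Every domain in use is the same cylinder \<open>B\<close>; empty domains fill
    the list up to an infinite sequence.\<close>
  define U where "U i = (if i < length gs then B else {})" for i
  have h: "h i \<in> carrier G" for i using gs_carrier nth_mem by (auto simp: h_def)
  have U: "U i \<in> sets \<mu>" "U i \<subseteq> E" for i using B by (auto simp: U_def)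
  let ?f = "\<lambda>i. act (h i)"
  let ?R = "(graphing_edges U ?f \<union> (graphing_edges U ?f)\<inverse>)\<^sup>*"
  have R_sym: "(x, y) \<in> ?R \<Longrightarrow> (y, x) \<in> ?R" for x y
    using sym_rtrancl[OF sym_Un_converse] by (rule symD)
  have edge: "(x, act g x) \<in> ?R" if x: "x \<in> B" and g: "g \<in> set gs" for x g
  proof -
    obtain i where "i < length gs" "gs ! i = g" using g by (auto simp: in_set_conv_nth)
    then have "(x, act g x) \<in> graphing_edges U ?f"
      using x unfolding graphing_edges_def by (auto simp: U_def h_def)
    then show ?thesis by blast
  qed
  have level_B: "b \<in> B \<longleftrightarrow> b \<in> E \<and> level k b = H k #> \<one>" for b
    using H_carrier by (auto simp: B_def cyl_def)
  have to_B: "\<exists>u\<in>carrier G. act u x \<in> B \<and> (x, act u x) \<in> ?R" if x: "x \<in> E" for x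
  proof -
    define g where "g = \<rho> (level k x)"
    have "level k x \<in> rcosets (H k)" using points_coset[OF level_points[OF x]] by simp
    then have g: "g \<in> carrier G" "level k x = H k #> g" "g \<in> set gs"
      using \<rho> by (auto simp: g_def gs_set)
    have "level k (act (inv g) x) = H k #> \<one>"
      using level_act_coset[OF inv_closed[OF g(1)] x g(1,2)] g(1) by simp
    then have b: "act (inv g) x \<in> B" using act_in_E[OF inv_closed[OF g(1)] x] level_B by simp
    have "(act (inv g) x, x) \<in> ?R" using edge[OF b g(3)] act_inv(2)[OF g(1) x] by simp
    then show ?thesis using b R_sym g(1) by (intro bexI[of _ "inv g"]) simp_all
  qed
  have act_B: "act u b \<in> B" if "u \<in> H k" "b \<in> B" for u b
  proof -
    have u: "u \<in> carrier G" using that(1) H_carrier by blast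
    have "level k (act u b) = H k #> (u \<otimes> \<one>)"
      using level_act_coset[OF u _ one_closed] that(2) level_B by blast
    also have "\<dots> = H k #> \<one>" using coset_join2[OF u subgroup_H that(1)] u H_carrier by simp
    finally show ?thesis using act_in_E[OF u] that(2) level_B by blast
  qed
  have within_B: "\<forall>b\<in>B. (b, act u b) \<in> ?R" if "u \<in> generate G A" for u
    using that
  proof (induction u rule: generate.induct)
    case one
    then show ?case using act_one B(2) by auto
  next
    case (incl u)
    then show ?case using edge gs_set by blast
  next
    case (inv u)
    have u: "u \<in> carrier G" "inv u \<in> H k"
      using A(2,3) inv generate.inv[OF inv, of G] by blast+
    show ?case
    proof
      fix b assume b: "b \<in> B"
      have "(act (inv u) b, act u (act (inv u) b)) \<in> ?R"
        using edge[OF act_B[OF u(2) b]] inv gs_set by blast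
      then show "(b, act (inv u) b) \<in> ?R" using act_inv(2)[OF u(1)] b B(2) R_sym by auto
    qed
  next
    case (eng u v)
    have uv: "u \<in> carrier G" "v \<in> carrier G" "v \<in> H k"
      using eng.hyps A(3) H_carrier by blast+
    show ?case
    proof
      fix b assume b: "b \<in> B"
      have "(b, act v b) \<in> ?R" "(act v b, act u (act v b)) \<in> ?R"
        using eng.IH b act_B[OF uv(3) b] by blast+
      then have "(b, act u (act v b)) \<in> ?R" by (rule rtrancl_trans)
      then show "(b, act (u \<otimes> v) b) \<in> ?R" using act_mult[OF uv(1,2)] b B(2) by auto
    qed
  qed
  have generates: "(x, y) \<in> ?R" if x: "x \<in> E" and y_orbit: "y \<in> orbit G act x" for x y
  proof -
    obtain g where g: "g \<in> carrier G" "y = act g x" using y_orbit by (auto simp: orbit_def)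
    have y: "y \<in> E" using act_in_E[OF g(1) x] g(2) by simp
    obtain u where u: "u \<in> carrier G" "act u x \<in> B" "(x, act u x) \<in> ?R" using to_B[OF x] by blast
    obtain v where v: "v \<in> carrier G" "act v y \<in> B" "(y, act v y) \<in> ?R" using to_B[OF y] by blast
    \<comment> \<open>This element carries \<open>act u x\<close> to \<open>act v y\<close>. Both
      lie in \<open>B\<close>, so it belongs to \<open>H k\<close>, where the generators in
      \<open>A\<close> already connect them.\<close>
    define w where "w = v \<otimes> g \<otimes> inv u"
    have w: "w \<in> carrier G" using u v g by (simp add: w_def)
    have "act (inv u) (act u x) = x" by (rule act_inv(1)[OF u(1) x])
    moreover have "act w (act u x) = act v (act g (act (inv u) (act u x)))"
      unfolding w_def using act_mult act_in_E u(1) v(1) g(1) x by simp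
    ultimately have wx: "act w (act u x) = act v y" using g(2) by simp
    have "level k (act w (act u x)) = H k #> (w \<otimes> \<one>)"
      using level_act_coset[OF w _ one_closed] u(2) level_B by blast
    then have "H k #> w = H k #> \<one>" using wx v(2) level_B w by simp
    then have "w \<in> H k" using rcos_eq_iff[OF subgroup_H w one_closed] w by simp
    then have "(act u x, act v y) \<in> ?R" using within_B[of w] A(3) u(2) wx by auto
    then show ?thesis using u(3) R_sym[OF v(3)] by (meson rtrancl_trans)
  qed
  have "graphing G \<mu> act U ?f"
    unfolding graphing_def
  proof (intro conjI allI ballI impI)
    fix i
    show "U i \<in> sets \<mu>" by (rule U)
    show "inj_on (?f i) (U i)"
      by (rule inj_on_subset[OF bij_betw_imp_inj_on[OF act_bij[OF h]] U(2)])
    show "?f i \<in> measurable (restrict_space \<mu> (U i)) \<mu>"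
      by (rule measurable_restrict_space1[OF measurable_act[OF h]])
    show "?f i x \<in> orbit G act x" for x using h by (auto simp: orbit_def)
    fix C assume C: "C \<in> sets \<mu>"
    have CE: "C \<subseteq> E" using sets.sets_into_space[OF C] by (simp add: space_\<mu>)
    have hi: "inv (h i) \<in> carrier G" using h by simp
    have im: "?f i ` C = act (inv (h i)) -` C \<inter> space \<mu>"
      using act_image[OF h CE] by (simp add: space_\<mu>)
    show "?f i ` C \<in> sets \<mu>" unfolding im by (rule measurable_sets[OF measurable_act[OF hi] C])
    show "emeasure \<mu> (?f i ` C) = emeasure \<mu> C"
      unfolding im using emeasure_distr[OF measurable_act[OF hi] C] distr_act[OF hi] by simp
  next
    show "AE x in \<mu>. \<forall>y\<in>orbit G act x. (x, y) \<in> ?R"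
      by (rule AE_I2) (use generates space_\<mu> in blast)
  qed
  then have "cost G \<mu> act \<le> (\<Sum>i. emeasure \<mu> (U i))"
    unfolding cost_def by (intro INF_lower2[of "(U, ?f)"]) auto
  also have "\<dots> = (\<Sum>i<length gs. emeasure \<mu> (U i))"
    by (rule suminf_finite) (auto simp: U_def)
  also have "\<dots> = (\<Sum>i<length gs. ennreal (1 / real (index k)))"
    by (rule sum.cong[OF refl]) (simp add: U_def B_def measure_cyl[OF B_coset])
  also have "\<dots> = ennreal (\<Sum>i<length gs. 1 / real (index k))"
    by (rule sum_ennreal) simp
  \<comment> \<open>The transversal contributes one domain for each coset, of total measure 1; the
    generators contribute the small remainder.\<close>
  also have "(\<Sum>i<length gs. 1 / real (index k)) = 1 + real (card A) / real (index k)"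
    using index_pos[of k] by (simp add: gs_len add_divide_distrib)
  finally show ?thesis .
qed

end

text \<open>Fixed price equates p with the cost of the profinite action. At levels where the rank is
  at most C and the index is large, the bound on that cost is as close to 1 as desired.\<close>

lemma fixed_price_le_one:
  fixes G (structure)
  assumes "group G" "infinite (carrier G)" and N: "residual_filtration G N"
    and bounded: "\<And>k0. \<exists>k\<ge>k0. \<exists>A. finite A \<and> card A \<le> C \<and> A \<subseteq> carrier G \<and> generate G A = N k"
    and price: "fixed_price G p"
  shows "p \<le> 1"
proof -
  interpret group G by fact
  \<comment> \<open>A residual filtration may begin with a proper subgroup, so the whole group is
    put in front; \<open>H (Suc j)\<close> is then \<open>N j\<close>.\<close>
  define H where "H k = (case k of 0 \<Rightarrow> carrier G | Suc j \<Rightarrow> N j)" for k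
  note Nd = residual_filtrationD[OF N]
  have "carrier G \<lhd> G"
    by (rule normal_invI) (simp_all add: subgroup_self)
  moreover have "rcosets (carrier G) \<subseteq> {carrier G}"
    using coset_join2[OF _ subgroup_self] by (auto simp: RCOSETS_def)
  then have "finite (rcosets (carrier G))" by (rule finite_subset) simp
  moreover have "N 0 \<subseteq> carrier G" using Nd(1) normal_imp_subgroup subgroup.subset by blast
  moreover have "(\<Inter>k. H k) = {\<one>}"
  proof -
    have "(\<Inter>k. H k) = H 0 \<inter> (\<Inter>k. H (Suc k))"
      by (auto simp: H_def split: nat.splits)
    also have "\<dots> = {\<one>}" using Nd(4) by (auto simp: H_def)
    finally show ?thesis .
  qed
  ultimately have "residual_filtration G H"
    unfolding residual_filtration_def using Nd(1,2) Nd(3)[of _ "Suc _"]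
    by (auto simp: H_def split: nat.splits)
  then interpret residual_chain G H
    by unfold_locales (simp_all add: H_def)
  have p: "p = cost G \<mu> act"
    using price standard_\<mu> pmp_act free_act unfolding fixed_price_def by blast
  show ?thesis
  proof (rule ennreal_le_epsilon)
    fix e :: real assume e: "e > 0"
    obtain M :: nat where M: "real M > real C / e" using reals_Archimedean2 by blast
    obtain k0 where k0: "\<And>k. k \<ge> k0 \<Longrightarrow> M \<le> card (rcosets N k)"
      using residual_filtration_index_unbounded[OF assms(1,2) N] by blast
    obtain j A where j: "j \<ge> k0" and A: "finite A" "card A \<le> C" "A \<subseteq> carrier G" "generate G A = N j"
      using bounded by blast
    have HN: "H (Suc j) = N j" by (simp add: H_def)
    have "real C / e < real (index (Suc j))" using M k0[OF j] by (simp add: HN)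
    then have "real C / real (index (Suc j)) < e"
      using e index_pos[of "Suc j"] by (simp add: field_simps)
    moreover have "real (card A) / real (index (Suc j)) \<le> real C / real (index (Suc j))"
      using A(2) by (simp add: divide_right_mono)
    ultimately have le: "1 + real (card A) / real (index (Suc j)) \<le> 1 + e" by linarith
    have "p \<le> ennreal (1 + real (card A) / real (index (Suc j)))"
      unfolding p by (rule cost_act_le) (simp_all add: A HN)
    also have "\<dots> \<le> ennreal (1 + e)" by (rule ennreal_leI[OF le])
    also have "\<dots> = 1 + ennreal e" using e by (simp add: ennreal_plus)
    finally show "p \<le> 1 + ennreal e" .
  qed
qed

theorem corollary9p4:
  fixes G :: "('g, 'm) monoid_scheme"
  assumes "group G" and "infinite (carrier G)" and "finitely_generated G"
  shows "(finitely_presented G \<longrightarrow>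
           (\<forall>T N (X :: 'x::metric_space set) S.
              finite_generating_set G T \<and> residual_filtration G N \<and> warped_system X S \<and>
              box_space_coarsely_equivalent_to_warped_system G T N X S \<longrightarrow>
              has_rank_gradient G N 0)) \<and>
         (\<forall>p. fixed_price G p \<and> p > 1 \<longrightarrow>
           \<not> (\<exists>T N (X :: 'x set) S.
              finite_generating_set G T \<and> residual_filtration G N \<and> warped_system X S \<and>
              box_space_coarsely_equivalent_to_warped_system G T N X S))"
proof (intro conjI impI allI notI)
  fix T N S and X :: "'x set"
  assume "finite_generating_set G T \<and> residual_filtration G N \<and> warped_system X S \<and>
    box_space_coarsely_equivalent_to_warped_system G T N X S"
  then have *: "finite_generating_set G T" "residual_filtration G N" "warped_system X S"
    "box_space_coarsely_equivalent_to_warped_system G T N X S" by simp_all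
  obtain C where "\<And>k0. \<exists>k\<ge>k0. \<exists>A. finite A \<and> card A \<le> C \<and> A \<subseteq> carrier G \<and> generate G A = N k"
    using rank_bounded_often[OF assms(1) *] by blast
  then show "has_rank_gradient G N 0"
    by (rule rank_gradient_zero_if_rank_bounded_often[OF assms(1,2) *(2)])
next
  fix p assume p: "fixed_price G p \<and> p > 1"
  assume "\<exists>T N (X :: 'x set) S. finite_generating_set G T \<and> residual_filtration G N \<and>
    warped_system X S \<and> box_space_coarsely_equivalent_to_warped_system G T N X S"
  then obtain T N S and X :: "'x set" where *: "finite_generating_set G T" "residual_filtration G N"
    "warped_system X S" "box_space_coarsely_equivalent_to_warped_system G T N X S" by blast
  obtain C where "\<And>k0. \<exists>k\<ge>k0. \<exists>A. finite A \<and> card A \<le> C \<and> A \<subseteq> carrier G \<and> generate G A = N k"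
    using rank_bounded_often[OF assms(1) *] by blast
  then have "p \<le> 1"
    using fixed_price_le_one[OF assms(1,2) *(2)] p by blast
  then show False using p leD by blast
qed

end
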